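(* The category $\mathbf{MV}$-$\mathbf{Frm}$ of MV-frames and the category $\ell u$-$\mathbf{Frm}$ of $\ell u$-frames are equivalent; the equivalence is given by the restriction of the Chang–Mundici functor $\Gamma$.
   Context: $\mathbf{MV}$-$\mathbf{Frm}$ has as objects complete MV-algebras and as morphisms MV-algebra homomorphisms preserving arbitrary joins. An $\ell u$-group $\langle G,u\rangle$ is an abelian lattice-ordered group with a strong unit $u\ge0$ (every $x$ satisfies $|x|\le nu$ for some integer $n\ge1$); an $\ell u$-frame is an $\ell u$-group whose group is complete (every nonempty bounded subset has a supremum and an infimum). $\ell u$-$\mathbf{Frm}$ has $\ell u$-frames as objects and as morphisms group and lattice homomorphisms preserving all existing arbitrary suprema and mapping unit to unit. $\Gamma(G,u)=[0,u]$ with $x\oplus y=(x+y)\wedge u$, $\neg x=u-x$, and $\Gamma(f)$ is the restriction of $f$; $\Gamma$ is an equivalence between $\ell u$-groups and MV-algebras (Chang–Mundici). *)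

theory Defs
  imports "HOL-Algebra.Group"
begin

section \<open>Categories, functors, equivalences\<close>

text \<open>Arrows are indexed by their source and target, so hom-sets need not be disjoint, and
  composition \<open>Comp C X Y Z g f\<close> is the composite of \<open>f : X \<rightarrow> Y\<close> and \<open>g : Y \<rightarrow> Z\<close>.\<close>

record ('o, 'm) category =
  Obj :: "'o set"
  Hom :: "'o \<Rightarrow> 'o \<Rightarrow> 'm set"
  Id :: "'o \<Rightarrow> 'm"
  Comp :: "'o \<Rightarrow> 'o \<Rightarrow> 'o \<Rightarrow> 'm \<Rightarrow> 'm \<Rightarrow> 'm"

locale category =
  fixes C :: "('o, 'm) category"
  assumes Id_in_Hom: "X \<in> Obj C \<Longrightarrow> Id C X \<in> Hom C X X"
    and Comp_in_Hom: "\<lbrakk>X \<in> Obj C; Y \<in> Obj C; Z \<in> Obj C; f \<in> Hom C X Y; g \<in> Hom C Y Z\<rbrakk>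
      \<Longrightarrow> Comp C X Y Z g f \<in> Hom C X Z"
    and Comp_Id_right: "\<lbrakk>X \<in> Obj C; Y \<in> Obj C; f \<in> Hom C X Y\<rbrakk>
      \<Longrightarrow> Comp C X X Y f (Id C X) = f"
    and Comp_Id_left: "\<lbrakk>X \<in> Obj C; Y \<in> Obj C; f \<in> Hom C X Y\<rbrakk>
      \<Longrightarrow> Comp C X Y Y (Id C Y) f = f"
    and Comp_assoc: "\<lbrakk>W \<in> Obj C; X \<in> Obj C; Y \<in> Obj C; Z \<in> Obj C;
        f \<in> Hom C W X; g \<in> Hom C X Y; h \<in> Hom C Y Z\<rbrakk>
      \<Longrightarrow> Comp C W Y Z h (Comp C W X Y g f) = Comp C W X Z (Comp C X Y Z h g) f"

definition is_iso :: "('o, 'm) category \<Rightarrow> 'o \<Rightarrow> 'o \<Rightarrow> 'm \<Rightarrow> bool" where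
  "is_iso C X Y f \<longleftrightarrow> f \<in> Hom C X Y \<and>
     (\<exists>g \<in> Hom C Y X. Comp C X Y X g f = Id C X \<and> Comp C Y X Y f g = Id C Y)"

text \<open>The subcategory with objects those satisfying \<open>P\<close> and arrows \<open>f : X \<rightarrow> Y\<close> those
  satisfying \<open>Q X Y f\<close>; a functor is restricted to it simply by using the same two maps.\<close>

definition subcategory ::
    "('o, 'm) category \<Rightarrow> ('o \<Rightarrow> bool) \<Rightarrow> ('o \<Rightarrow> 'o \<Rightarrow> 'm \<Rightarrow> bool) \<Rightarrow> ('o, 'm) category" where
  "subcategory C P Q =
     C\<lparr>Obj := {X \<in> Obj C. P X}, Hom := (\<lambda>X Y. {f \<in> Hom C X Y. Q X Y f})\<rparr>"

record ('o, 'm, 'p, 'n) cat_map =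
  on_obj :: "'o \<Rightarrow> 'p"
  on_arr :: "'o \<Rightarrow> 'o \<Rightarrow> 'm \<Rightarrow> 'n"

definition id_map :: "('o, 'm, 'o, 'm) cat_map" where
  "id_map = \<lparr>on_obj = (\<lambda>X. X), on_arr = (\<lambda>X Y f. f)\<rparr>"

definition comp_map ::
    "('p, 'n, 'q, 'l) cat_map \<Rightarrow> ('o, 'm, 'p, 'n) cat_map \<Rightarrow> ('o, 'm, 'q, 'l) cat_map" where
  "comp_map K F = \<lparr>on_obj = (\<lambda>X. on_obj K (on_obj F X)),
     on_arr = (\<lambda>X Y f. on_arr K (on_obj F X) (on_obj F Y) (on_arr F X Y f))\<rparr>"

locale cat_functor = source: category C + target: category D
  for C :: "('o, 'm) category" and D :: "('p, 'n) category" +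
  fixes F :: "('o, 'm, 'p, 'n) cat_map"
  assumes obj_closed: "X \<in> Obj C \<Longrightarrow> on_obj F X \<in> Obj D"
    and arr_closed: "\<lbrakk>X \<in> Obj C; Y \<in> Obj C; f \<in> Hom C X Y\<rbrakk>
      \<Longrightarrow> on_arr F X Y f \<in> Hom D (on_obj F X) (on_obj F Y)"
    and preserves_Id: "X \<in> Obj C \<Longrightarrow> on_arr F X X (Id C X) = Id D (on_obj F X)"
    and preserves_Comp: "\<lbrakk>X \<in> Obj C; Y \<in> Obj C; Z \<in> Obj C; f \<in> Hom C X Y; g \<in> Hom C Y Z\<rbrakk>
      \<Longrightarrow> on_arr F X Z (Comp C X Y Z g f) =
        Comp D (on_obj F X) (on_obj F Y) (on_obj F Z) (on_arr F Y Z g) (on_arr F X Y f)"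

definition natural_iso ::
    "('o, 'm) category \<Rightarrow> ('p, 'n) category \<Rightarrow> ('o, 'm, 'p, 'n) cat_map \<Rightarrow>
     ('o, 'm, 'p, 'n) cat_map \<Rightarrow> ('o \<Rightarrow> 'n) \<Rightarrow> bool" where
  "natural_iso C D F F' \<tau> \<longleftrightarrow>
     (\<forall>X \<in> Obj C. is_iso D (on_obj F X) (on_obj F' X) (\<tau> X)) \<and>
     (\<forall>X \<in> Obj C. \<forall>Y \<in> Obj C. \<forall>f \<in> Hom C X Y.
        Comp D (on_obj F X) (on_obj F Y) (on_obj F' Y) (\<tau> Y) (on_arr F X Y f) =
        Comp D (on_obj F X) (on_obj F' X) (on_obj F' Y) (on_arr F' X Y f) (\<tau> X))"

definition is_equivalence ::
    "('o, 'm) category \<Rightarrow> ('p, 'n) category \<Rightarrow> ('o, 'm, 'p, 'n) cat_map \<Rightarrow> bool" where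
  "is_equivalence C D F \<longleftrightarrow> cat_functor C D F \<and>
     (\<exists>K \<eta> \<epsilon>. cat_functor D C K \<and>
        natural_iso C C id_map (comp_map K F) \<eta> \<and>
        natural_iso D D (comp_map F K) id_map \<epsilon>)"


section \<open>Lattice-ordered groups with strong unit\<close>

record 'a lu_group = "'a gorder" +
  lu_add :: "'a \<Rightarrow> 'a \<Rightarrow> 'a" (infixl "\<boxplus>\<index>" 65)
  lu_zero :: 'a
  lu_unit :: 'a

definition lu_monoid :: "'a lu_group \<Rightarrow> 'a monoid" where
  "lu_monoid G = \<lparr>carrier = carrier G, monoid.mult = lu_add G, one = lu_zero G\<rparr>"

abbreviation lu_neg :: "'a lu_group \<Rightarrow> 'a \<Rightarrow> 'a" where
  "lu_neg G x \<equiv> inv\<^bsub>lu_monoid G\<^esub> x"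

abbreviation lu_mult :: "'a lu_group \<Rightarrow> nat \<Rightarrow> 'a \<Rightarrow> 'a" where
  "lu_mult G n x \<equiv> x [^]\<^bsub>lu_monoid G\<^esub> n"

locale lu_group = lattice G + additive: comm_group "lu_monoid G"
  for G :: "'a lu_group" (structure) +
  assumes add_left_mono: "\<lbrakk>x \<in> carrier G; y \<in> carrier G; z \<in> carrier G; x \<sqsubseteq> y\<rbrakk>
      \<Longrightarrow> z \<boxplus> x \<sqsubseteq> z \<boxplus> y"
    and unit_closed: "lu_unit G \<in> carrier G"
    and unit_nonneg: "lu_zero G \<sqsubseteq> lu_unit G"
    and strong_unit: "x \<in> carrier G \<Longrightarrow>
      \<exists>n::nat. n \<ge> 1 \<and> x \<squnion> lu_neg G x \<sqsubseteq> lu_mult G n (lu_unit G)"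

definition lu_frame :: "'a lu_group \<Rightarrow> bool" where
  "lu_frame G \<longleftrightarrow> lu_group G \<and>
     (\<forall>S \<subseteq> carrier G. S \<noteq> {} \<and> Upper G S \<noteq> {} \<and> Lower G S \<noteq> {} \<longrightarrow>
        (\<exists>s. is_lub G s S) \<and> (\<exists>i. is_glb G i S))"

definition lu_hom :: "'a lu_group \<Rightarrow> 'a lu_group \<Rightarrow> ('a \<Rightarrow> 'a) set" where
  "lu_hom G H = {f \<in> hom (lu_monoid G) (lu_monoid H).
     join_pres G H f \<and> meet_pres G H f \<and> f (lu_unit G) = lu_unit H}"

text \<open>Preservation of all existing suprema, the empty one included.\<close>

definition preserves_sups :: "('a, 'c) gorder_scheme \<Rightarrow> ('b, 'd) gorder_scheme \<Rightarrow> ('a \<Rightarrow> 'b) \<Rightarrow> bool" where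
  "preserves_sups L M f \<longleftrightarrow>
     (\<forall>S \<subseteq> carrier L. \<forall>s. is_lub L s S \<longrightarrow> is_lub M (f s) (f ` S))"


section \<open>MV-algebras\<close>

record 'a mv_algebra = "'a partial_object" +
  mv_add :: "'a \<Rightarrow> 'a \<Rightarrow> 'a" (infixl "\<oplus>\<index>" 65)
  mv_neg :: "'a \<Rightarrow> 'a"
  mv_zero :: 'a

definition mv_monoid :: "'a mv_algebra \<Rightarrow> 'a monoid" where
  "mv_monoid A = \<lparr>carrier = carrier A, monoid.mult = mv_add A, one = mv_zero A\<rparr>"

locale mv_algebra = additive: comm_monoid "mv_monoid A"
  for A :: "'a mv_algebra" (structure) +
  assumes neg_closed: "x \<in> carrier A \<Longrightarrow> mv_neg A x \<in> carrier A"
    and neg_neg: "x \<in> carrier A \<Longrightarrow> mv_neg A (mv_neg A x) = x"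
    and add_neg_zero: "x \<in> carrier A \<Longrightarrow> x \<oplus>\<^bsub>A\<^esub> mv_neg A (mv_zero A) = mv_neg A (mv_zero A)"
    and join_comm: "\<lbrakk>x \<in> carrier A; y \<in> carrier A\<rbrakk> \<Longrightarrow>
      mv_neg A (mv_neg A x \<oplus>\<^bsub>A\<^esub> y) \<oplus>\<^bsub>A\<^esub> y = mv_neg A (mv_neg A y \<oplus>\<^bsub>A\<^esub> x) \<oplus>\<^bsub>A\<^esub> x"

text \<open>The natural order: \<open>x \<le> y\<close> iff \<open>\<not>x \<oplus> y = 1\<close>, where \<open>1 = \<not>0\<close>.\<close>

definition mv_order :: "'a mv_algebra \<Rightarrow> 'a gorder" where
  "mv_order A = \<lparr>carrier = carrier A, eq = (=),
     le = (\<lambda>x y. mv_neg A x \<oplus>\<^bsub>A\<^esub> y = mv_neg A (mv_zero A))\<rparr>"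

definition mv_frame :: "'a mv_algebra \<Rightarrow> bool" where
  "mv_frame A \<longleftrightarrow> mv_algebra A \<and> complete_lattice (mv_order A)"

definition mv_hom :: "'a mv_algebra \<Rightarrow> 'a mv_algebra \<Rightarrow> ('a \<Rightarrow> 'a) set" where
  "mv_hom A B = {f \<in> hom (mv_monoid A) (mv_monoid B).
     f (mv_zero A) = mv_zero B \<and> (\<forall>x \<in> carrier A. f (mv_neg A x) = mv_neg B (f x))}"


section \<open>The categories and the functor \<open>\<Gamma>\<close>\<close>

text \<open>Objects are the structures whose carrier is a subset of the type \<open>'a\<close>, which plays the role
  of the universe. An arrow is an extensional function on the carrier of its source, so that
  equality of arrows is equality on that carrier.\<close>

definition lu_Grp :: "('a lu_group, 'a \<Rightarrow> 'a) category" where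
  "lu_Grp = \<lparr>Obj = {G. lu_group G},
     Hom = (\<lambda>G H. lu_hom G H \<inter> extensional (carrier G)),
     Id = (\<lambda>G. restrict (\<lambda>x. x) (carrier G)),
     Comp = (\<lambda>X Y Z g f. compose (carrier X) g f)\<rparr>"

definition lu_Frm :: "('a lu_group, 'a \<Rightarrow> 'a) category" where
  "lu_Frm = subcategory lu_Grp lu_frame preserves_sups"

definition MV_Alg :: "('a mv_algebra, 'a \<Rightarrow> 'a) category" where
  "MV_Alg = \<lparr>Obj = {A. mv_algebra A},
     Hom = (\<lambda>A B. mv_hom A B \<inter> extensional (carrier A)),
     Id = (\<lambda>A. restrict (\<lambda>x. x) (carrier A)),
     Comp = (\<lambda>X Y Z g f. compose (carrier X) g f)\<rparr>"

definition MV_Frm :: "('a mv_algebra, 'a \<Rightarrow> 'a) category" where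
  "MV_Frm = subcategory MV_Alg mv_frame
     (\<lambda>A B. preserves_sups (mv_order A) (mv_order B))"

definition Gamma_obj :: "'a lu_group \<Rightarrow> 'a mv_algebra" where
  "Gamma_obj G = \<lparr>carrier = \<lbrace>lu_zero G..lu_unit G\<rbrace>\<^bsub>G\<^esub>,
     mv_add = (\<lambda>x y. (x \<boxplus>\<^bsub>G\<^esub> y) \<sqinter>\<^bsub>G\<^esub> lu_unit G),
     mv_neg = (\<lambda>x. lu_unit G \<boxplus>\<^bsub>G\<^esub> lu_neg G x),
     mv_zero = lu_zero G\<rparr>"

definition Gamma :: "('a lu_group, 'a \<Rightarrow> 'a, 'a mv_algebra, 'a \<Rightarrow> 'a) cat_map" where
  "Gamma = \<lparr>on_obj = Gamma_obj,
     on_arr = (\<lambda>G H f. restrict f (carrier (Gamma_obj G)))\<rparr>"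

end

theory Submission
  imports Defs
begin

text \<open>
  \<Gamma> is fully faithful on \<open>\<ell>u\<close>-groups and essentially surjective, and completeness passes between
  \<open>G\<close> and \<open>[0,u]\<close>. Everything rests on one observation: if \<open>A \<subseteq> [0,u]\<close> is closed under the
  MV-operations of an abelian \<open>\<ell>\<close>-group \<open>G\<close>, then the subgroup generated by \<open>A\<close> is a sublattice
  meeting \<open>[0,u]\<close> exactly in \<open>A\<close>, since for a sum \<open>x\<close> of elements of \<open>A\<close> the element
  \<open>x \<and> u\<close> lies in \<open>A\<close> and \<open>(x - u)\<^sup>+\<close> is again such a sum.

  Essential surjectivity: by prime ideals, an MV-algebra embeds in a product of MV-chains, each chain
  \<open>C\<close> is the unit interval of the lexicographic group \<open>\<int> \<times> (C - {1})\<close>, and one applies the observation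
  to the image of the algebra in the product of these groups. The generated group consists of finite
  combinations, so it fits into the infinite universe.

  Fullness: for an MV-homomorphism \<open>f : \<Gamma>(G) \<rightarrow> \<Gamma>(H)\<close> the observation applied to
  the graph of \<open>f\<close> in \<open>G \<times> H\<close> yields a subgroup and sublattice which is the graph of an extension
  of \<open>f\<close>. The extension preserves suprema as soon as \<open>f\<close> does: the gaps \<open>s - x\<close> between a
  supremum and the members of the set have infimum \<open>0\<close>, which can be tested on \<open>(s - x) \<and> u\<close>.
\<close>

section \<open>Fully faithful and essentially surjective functors\<close>

text \<open>No group law is ever checked on formal sums or good sequences: groups arise only as
  subgroups of groups already at hand. For fullness the formula
  \<open>f(a1 + ... + an) = f(a1) + ... + f(an)\<close> would require independence of the chosen
  summands. With the graph this becomes the claim that an element \<open>(0, h)\<close> of the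
  generated subgroup is \<open>0\<close>; for \<open>h\<close> nonnegative,
  \<open>(0, h \<sqinter> u)\<close> lies in the graph over \<open>0\<close>, so
  \<open>h \<sqinter> u = 0\<close>, and a strong unit then forces \<open>h = 0\<close>. Infinity of
  the universe is essential. A nontrivial abelian lattice-ordered group is torsion-free, hence
  infinite, so over a finite type the two-element algebra would be no \<open>\<Gamma>(G)\<close>.
  The product over all prime ideals lives on a larger type than the universe, but each element of
  the generated subgroup is named by a finite list of generators and a number of units. Empty
  suprema behave differently on the two sides: in the unit interval the empty set has supremum
  \<open>0\<close>, in a nontrivial group it has none.\<close>

locale ff_functor = cat_functor +
  assumes full: "\<lbrakk>X \<in> Obj C; Y \<in> Obj C; g \<in> Hom D (on_obj F X) (on_obj F Y)\<rbrakk>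
      \<Longrightarrow> \<exists>f \<in> Hom C X Y. on_arr F X Y f = g"
    and faithful: "\<lbrakk>X \<in> Obj C; Y \<in> Obj C; f \<in> Hom C X Y; f' \<in> Hom C X Y;
      on_arr F X Y f = on_arr F X Y f'\<rbrakk> \<Longrightarrow> f = f'"
    and essentially_surjective: "B \<in> Obj D \<Longrightarrow> \<exists>X \<in> Obj C. \<exists>e. is_iso D (on_obj F X) B e"
begin

definition lift where
  "lift X Y g = (SOME f. f \<in> Hom C X Y \<and> on_arr F X Y f = g)"

lemma lift:
  assumes "X \<in> Obj C" "Y \<in> Obj C" "g \<in> Hom D (on_obj F X) (on_obj F Y)"
  shows lift_Hom: "lift X Y g \<in> Hom C X Y" and F_lift: "on_arr F X Y (lift X Y g) = g"
  unfolding lift_def using someI_ex[OF full[OF assms, unfolded Bex_def]] by auto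

definition preimage where
  "preimage B = (SOME X. X \<in> Obj C \<and> (\<exists>e. is_iso D (on_obj F X) B e))"

definition counit where
  "counit B = (SOME e. is_iso D (on_obj F (preimage B)) B e)"

definition counit_inv where
  "counit_inv B = (SOME d. d \<in> Hom D B (on_obj F (preimage B)) \<and>
     Comp D (on_obj F (preimage B)) B (on_obj F (preimage B)) d (counit B)
       = Id D (on_obj F (preimage B)) \<and>
     Comp D B (on_obj F (preimage B)) B (counit B) d = Id D B)"

lemma preimage:
  assumes "B \<in> Obj D"
  shows preimage_Obj: "preimage B \<in> Obj C"
    and counit_iso: "is_iso D (on_obj F (preimage B)) B (counit B)"
proof -
  have *: "preimage B \<in> Obj C \<and> (\<exists>e. is_iso D (on_obj F (preimage B)) B e)"
    unfolding preimage_def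
    using someI_ex[OF essentially_surjective[OF assms, unfolded Bex_def]] .
  then show "preimage B \<in> Obj C" ..
  show "is_iso D (on_obj F (preimage B)) B (counit B)"
    unfolding counit_def using * by (blast intro: someI_ex)
qed

lemma counit:
  assumes "B \<in> Obj D"
  shows counit_Hom: "counit B \<in> Hom D (on_obj F (preimage B)) B"
    and counit_inv_Hom: "counit_inv B \<in> Hom D B (on_obj F (preimage B))"
    and counit_inv_counit: "Comp D (on_obj F (preimage B)) B (on_obj F (preimage B))
      (counit_inv B) (counit B) = Id D (on_obj F (preimage B))"
    and counit_counit_inv: "Comp D B (on_obj F (preimage B)) B
      (counit B) (counit_inv B) = Id D B"
proof -
  have iso: "is_iso D (on_obj F (preimage B)) B (counit B)" by (rule counit_iso[OF assms])
  then show "counit B \<in> Hom D (on_obj F (preimage B)) B" by (simp add: is_iso_def)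
  from iso have "\<exists>d. d \<in> Hom D B (on_obj F (preimage B)) \<and>
     Comp D (on_obj F (preimage B)) B (on_obj F (preimage B)) d (counit B)
       = Id D (on_obj F (preimage B)) \<and>
     Comp D B (on_obj F (preimage B)) B (counit B) d = Id D B"
    by (auto simp: is_iso_def)
  from someI_ex[OF this] show "counit_inv B \<in> Hom D B (on_obj F (preimage B))"
    "Comp D (on_obj F (preimage B)) B (on_obj F (preimage B))
      (counit_inv B) (counit B) = Id D (on_obj F (preimage B))"
    "Comp D B (on_obj F (preimage B)) B (counit B) (counit_inv B) = Id D B"
    by (simp_all add: counit_inv_def)
qed

text \<open>The arrow \<open>g\<close> carried along the chosen isomorphisms at both ends. Lifting
  it gives the quasi-inverse on arrows, and naturality of \<open>counit\<close> then amounts to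
  cancelling \<open>counit_inv\<close> against \<open>counit\<close>.\<close>

definition conjugate where
  "conjugate B B' g = Comp D (on_obj F (preimage B)) B (on_obj F (preimage B'))
     (Comp D B B' (on_obj F (preimage B')) (counit_inv B') g) (counit B)"

lemmas D_closed = obj_closed preimage_Obj counit_Hom counit_inv_Hom target.Comp_in_Hom arr_closed

lemma conjugate_Hom:
  assumes "B \<in> Obj D" "B' \<in> Obj D" "g \<in> Hom D B B'"
  shows "conjugate B B' g \<in> Hom D (on_obj F (preimage B)) (on_obj F (preimage B'))"
  unfolding conjugate_def using assms by (intro D_closed)

lemma counit_conjugate:
  assumes "B \<in> Obj D" "B' \<in> Obj D" "g \<in> Hom D B B'"
  shows "Comp D (on_obj F (preimage B)) (on_obj F (preimage B')) B' (counit B') (conjugate B B' g) =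
    Comp D (on_obj F (preimage B)) B B' g (counit B)"
  unfolding conjugate_def using assms
  by (simp add: target.Comp_assoc D_closed counit_counit_inv target.Comp_Id_left)

lemma conjugate_counit_inv:
  assumes "B \<in> Obj D" "B' \<in> Obj D" "g \<in> Hom D B B'"
  shows "Comp D B (on_obj F (preimage B)) (on_obj F (preimage B')) (conjugate B B' g) (counit_inv B) =
    Comp D B B' (on_obj F (preimage B')) (counit_inv B') g"
proof -
  have "Comp D B (on_obj F (preimage B)) (on_obj F (preimage B')) (conjugate B B' g) (counit_inv B) =
    Comp D B B (on_obj F (preimage B')) (Comp D B B' (on_obj F (preimage B')) (counit_inv B') g)
      (Comp D B (on_obj F (preimage B)) B (counit B) (counit_inv B))"
    unfolding conjugate_def using assms
    by (subst target.Comp_assoc) (auto intro!: D_closed)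
  then show ?thesis
    using assms by (simp add: counit_counit_inv target.Comp_Id_right D_closed)
qed

lemma conjugate_Id:
  assumes "B \<in> Obj D" shows "conjugate B B (Id D B) = Id D (on_obj F (preimage B))"
  unfolding conjugate_def using assms
  by (simp add: D_closed counit_inv_counit target.Comp_Id_right)

lemma conjugate_Comp:
  assumes "B \<in> Obj D" "B' \<in> Obj D" "B'' \<in> Obj D" "g \<in> Hom D B B'" "h \<in> Hom D B' B''"
  shows "conjugate B B'' (Comp D B B' B'' h g) =
    Comp D (on_obj F (preimage B)) (on_obj F (preimage B')) (on_obj F (preimage B''))
      (conjugate B' B'' h) (conjugate B B' g)"
proof -
  let ?P = "on_obj F (preimage B)" and ?P' = "on_obj F (preimage B')"
    and ?P'' = "on_obj F (preimage B'')"
  have "Comp D ?P ?P' ?P'' (conjugate B' B'' h) (conjugate B B' g) =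
    Comp D ?P B' ?P'' (Comp D B' B'' ?P'' (counit_inv B'') h)
      (Comp D ?P ?P' B' (counit B') (conjugate B B' g))"
    unfolding conjugate_def[of B' B''] using assms conjugate_Hom
    by (subst target.Comp_assoc) (auto intro!: D_closed)
  also have "\<dots> = Comp D ?P B' ?P'' (Comp D B' B'' ?P'' (counit_inv B'') h)
      (Comp D ?P B B' g (counit B))"
    using assms by (simp add: counit_conjugate)
  also have "\<dots> = conjugate B B'' (Comp D B B' B'' h g)"
    unfolding conjugate_def using assms by (simp add: target.Comp_assoc D_closed)
  finally show ?thesis by simp
qed

definition inverse_functor where
  "inverse_functor = \<lparr>on_obj = preimage,
     on_arr = (\<lambda>B B' g. lift (preimage B) (preimage B') (conjugate B B' g))\<rparr>"

text \<open>Equations between lifts are tested after applying \<open>F\<close>, where they are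
  \<open>conjugate_Id\<close> and \<open>conjugate_Comp\<close>; \<open>faithful\<close> reflects
  them back.\<close>

lemma inverse_functor: "cat_functor D C inverse_functor"
proof (unfold_locales, unfold inverse_functor_def cat_map.simps)
  fix B assume B: "B \<in> Obj D"
  then show "preimage B \<in> Obj C" by (rule preimage_Obj)
  show "lift (preimage B) (preimage B) (conjugate B B (Id D B)) = Id C (preimage B)"
    using B by (intro faithful[where X = "preimage B" and Y = "preimage B"])
      (auto intro!: lift_Hom conjugate_Hom preimage_Obj target.Id_in_Hom source.Id_in_Hom
        simp: conjugate_Id F_lift preserves_Id preimage_Obj target.Id_in_Hom obj_closed)
next
  fix B B' g assume "B \<in> Obj D" "B' \<in> Obj D" "g \<in> Hom D B B'"
  then show "lift (preimage B) (preimage B') (conjugate B B' g) \<in> Hom C (preimage B) (preimage B')"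
    by (intro lift_Hom preimage_Obj conjugate_Hom)
next
  fix B B' B'' g h
  assume *: "B \<in> Obj D" "B' \<in> Obj D" "B'' \<in> Obj D" "g \<in> Hom D B B'" "h \<in> Hom D B' B''"
  then show "lift (preimage B) (preimage B'') (conjugate B B'' (Comp D B B' B'' h g)) =
    Comp C (preimage B) (preimage B') (preimage B'')
      (lift (preimage B') (preimage B'') (conjugate B' B'' h))
      (lift (preimage B) (preimage B') (conjugate B B' g))"
    by (intro faithful[where X = "preimage B" and Y = "preimage B''"])
      (auto intro!: lift_Hom conjugate_Hom preimage_Obj target.Comp_in_Hom source.Comp_in_Hom
        simp: preserves_Comp F_lift preimage_Obj obj_closed lift_Hom conjugate_Hom target.Comp_in_Hom conjugate_Comp)
qed

text \<open>A fully faithful functor reflects isomorphisms: the two inverse arrows lift by fullness,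
  and the two equations hold by faithfulness.\<close>

lemma iso_lift:
  assumes X: "X \<in> Obj C" and Y: "Y \<in> Obj C"
    and f: "f \<in> Hom D (on_obj F X) (on_obj F Y)" and g: "g \<in> Hom D (on_obj F Y) (on_obj F X)"
    and gf: "Comp D (on_obj F X) (on_obj F Y) (on_obj F X) g f = Id D (on_obj F X)"
    and fg: "Comp D (on_obj F Y) (on_obj F X) (on_obj F Y) f g = Id D (on_obj F Y)"
  shows "is_iso C X Y (lift X Y f)"
  unfolding is_iso_def
proof (intro conjI bexI[of _ "lift Y X g"])
  show "Comp C X Y X (lift Y X g) (lift X Y f) = Id C X"
    using assms by (intro faithful[OF X X])
      (auto intro: source.Comp_in_Hom lift_Hom source.Id_in_Hom
        simp: preserves_Comp preserves_Id F_lift lift_Hom)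
  show "Comp C Y X Y (lift X Y f) (lift Y X g) = Id C Y"
    using assms by (intro faithful[OF Y Y])
      (auto intro: source.Comp_in_Hom lift_Hom source.Id_in_Hom
        simp: preserves_Comp preserves_Id F_lift lift_Hom)
qed (use assms in \<open>auto intro: lift_Hom\<close>)

theorem is_equivalence: "is_equivalence C D F"
  unfolding is_equivalence_def
proof (intro conjI exI)
  show "cat_functor C D F" by (rule cat_functor_axioms)
  show "cat_functor D C inverse_functor" by (rule inverse_functor)
  show "natural_iso D D (comp_map F inverse_functor) id_map counit"
    unfolding natural_iso_def comp_map_def id_map_def inverse_functor_def
    by (auto simp: counit_iso F_lift conjugate_Hom preimage_Obj counit_conjugate)
  let ?P = "\<lambda>X. preimage (on_obj F X)"
  \<comment> \<open>The unit at \<open>X\<close> has to be an arrow of \<open>C\<close>, so it is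
    the lift of the inverse counit at \<open>F X\<close>. Its naturality is the image of
    \<open>conjugate_counit_inv\<close> under faithfulness.\<close>
  show "natural_iso C C id_map (comp_map inverse_functor F)
      (\<lambda>X. lift X (preimage (on_obj F X)) (counit_inv (on_obj F X)))"
    unfolding natural_iso_def
  proof (intro conjI ballI)
    fix X assume X: "X \<in> Obj C"
    then show "is_iso C (on_obj id_map X) (on_obj (comp_map inverse_functor F) X)
        (lift X (?P X) (counit_inv (on_obj F X)))"
      by (auto simp: id_map_def comp_map_def inverse_functor_def counit_inv_counit
          counit_counit_inv obj_closed intro!: iso_lift[where g = "counit (on_obj F X)"] D_closed)
    fix Y f assume Y: "Y \<in> Obj C" and f: "f \<in> Hom C X Y"
    let ?g = "on_arr F X Y f"
    have g: "?g \<in> Hom D (on_obj F X) (on_obj F Y)" using X Y f by (rule arr_closed)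
    note clo = X Y f g obj_closed[OF X] obj_closed[OF Y] preimage_Obj conjugate_Hom counit_inv_Hom lift_Hom
      source.Comp_in_Hom
    have "Comp C X Y (?P Y) (lift Y (?P Y) (counit_inv (on_obj F Y))) f =
      Comp C X (?P X) (?P Y) (lift (?P X) (?P Y) (conjugate (on_obj F X) (on_obj F Y) ?g))
        (lift X (?P X) (counit_inv (on_obj F X)))"
      by (rule faithful[where X = X and Y = "?P Y"])
        (auto intro: clo simp: clo preserves_Comp F_lift conjugate_counit_inv)
    then show "Comp C (on_obj id_map X) (on_obj id_map Y)
          (on_obj (comp_map inverse_functor F) Y) (lift Y (?P Y) (counit_inv (on_obj F Y)))
          (on_arr id_map X Y f) =
        Comp C (on_obj id_map X) (on_obj (comp_map inverse_functor F) X)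
          (on_obj (comp_map inverse_functor F) Y) (on_arr (comp_map inverse_functor F) X Y f)
          (lift X (?P X) (counit_inv (on_obj F X)))"
      by (simp add: id_map_def comp_map_def inverse_functor_def)
  qed
qed

end

section \<open>Abelian lattice-ordered groups\<close>

text \<open>The strong unit axiom is left out on purpose: in an infinite product the constant family
  of units need not dominate an element whose components grow without bound. The axiom is recovered
  later on generated subgroups.\<close>

locale lgroup = lattice G + additive: comm_group "lu_monoid G"
  for G :: "'a lu_group" (structure) +
  assumes add_left_mono: "\<lbrakk>x \<in> carrier G; y \<in> carrier G; z \<in> carrier G; x \<sqsubseteq> y\<rbrakk>
      \<Longrightarrow> z \<boxplus> x \<sqsubseteq> z \<boxplus> y"
    and unit_closed [simp]: "lu_unit G \<in> carrier G"
    and unit_nonneg: "lu_zero G \<sqsubseteq> lu_unit G"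

sublocale lu_group \<subseteq> lgroup
  by (intro lgroup.intro lgroup_axioms.intro lattice_axioms additive.comm_group_axioms
      add_left_mono unit_closed unit_nonneg)

section \<open>Finite sums and the subgroup generated by a subset of the unit interval\<close>

inductive_set sums :: "'a lu_group \<Rightarrow> 'a set \<Rightarrow> 'a set" for G A where
  sums_zero: "lu_zero G \<in> sums G A"
| sums_add: "\<lbrakk>x \<in> sums G A; a \<in> A\<rbrakk> \<Longrightarrow> x \<boxplus>\<^bsub>G\<^esub> a \<in> sums G A"

text \<open>For \<open>A\<close> closed under complements this is the generated subgroup: since
  \<open>u - a\<close> lies in \<open>A\<close>, subtracting \<open>a\<close> is adding an element
  of \<open>A\<close> and removing one unit, so every difference of sums becomes a sum after adding
  a multiple of the unit.\<close>

definition span :: "'a lu_group \<Rightarrow> 'a set \<Rightarrow> 'a set" where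
  "span G A = {x \<in> carrier G. \<exists>n. x \<boxplus>\<^bsub>G\<^esub> lu_mult G n (lu_unit G) \<in> sums G A}"

definition sub_mv :: "'a lu_group \<Rightarrow> 'a set \<Rightarrow> bool" where
  "sub_mv G A \<longleftrightarrow> A \<subseteq> \<lbrace>lu_zero G..lu_unit G\<rbrace>\<^bsub>G\<^esub> \<and> lu_zero G \<in> A \<and>
     (\<forall>a\<in>A. lu_unit G \<boxplus>\<^bsub>G\<^esub> lu_neg G a \<in> A) \<and>
     (\<forall>a\<in>A. \<forall>b\<in>A. (a \<boxplus>\<^bsub>G\<^esub> b) \<sqinter>\<^bsub>G\<^esub> lu_unit G \<in> A)"

context lgroup
begin

abbreviation zero ("\<zero>") where "\<zero> \<equiv> lu_zero G"
abbreviation unit ("\<u>") where "\<u> \<equiv> lu_unit G"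
abbreviation pos where "pos x \<equiv> x \<squnion> \<zero>"
abbreviation diff (infixl "\<boxminus>" 65) where "x \<boxminus> y \<equiv> x \<boxplus> lu_neg G y"

lemma lu_monoid_simps [simp]:
  "carrier (lu_monoid G) = carrier G" "mult (lu_monoid G) = lu_add G" "one (lu_monoid G) = \<zero>"
  by (simp_all add: lu_monoid_def)

lemma add_closed [simp]: "\<lbrakk>x \<in> carrier G; y \<in> carrier G\<rbrakk> \<Longrightarrow> x \<boxplus> y \<in> carrier G"
  and zero_closed [simp]: "\<zero> \<in> carrier G"
  and neg_closed [simp]: "x \<in> carrier G \<Longrightarrow> lu_neg G x \<in> carrier G"
  and mult_closed [simp]: "x \<in> carrier G \<Longrightarrow> lu_mult G n x \<in> carrier G"
  and add_zero [simp]: "x \<in> carrier G \<Longrightarrow> x \<boxplus> \<zero> = x"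
  and zero_add [simp]: "x \<in> carrier G \<Longrightarrow> \<zero> \<boxplus> x = x"
  and add_neg [simp]: "x \<in> carrier G \<Longrightarrow> x \<boxminus> x = \<zero>"
  and neg_add [simp]: "x \<in> carrier G \<Longrightarrow> lu_neg G x \<boxplus> x = \<zero>"
  and neg_neg [simp]: "x \<in> carrier G \<Longrightarrow> lu_neg G (lu_neg G x) = x"
  and neg_zero [simp]: "lu_neg G \<zero> = \<zero>"
  and mult_0 [simp]: "lu_mult G 0 x = \<zero>"
  and mult_Suc [simp]: "lu_mult G (Suc n) x = lu_mult G n x \<boxplus> x"
  using additive.m_closed[of x y] additive.one_closed additive.inv_closed[of x]
    additive.nat_pow_closed[of x n] additive.r_one[of x] additive.l_one[of x]
    additive.r_inv[of x] additive.l_inv[of x] additive.inv_inv[of x] additive.inv_one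
    additive.nat_pow_0[of x] additive.nat_pow_Suc[of x n]
  by (simp_all add: lu_monoid_def)

lemma add_assoc: "\<lbrakk>x \<in> carrier G; y \<in> carrier G; z \<in> carrier G\<rbrakk>
    \<Longrightarrow> x \<boxplus> y \<boxplus> z = x \<boxplus> (y \<boxplus> z)"
  and add_comm: "\<lbrakk>x \<in> carrier G; y \<in> carrier G\<rbrakk> \<Longrightarrow> x \<boxplus> y = y \<boxplus> x"
  and add_lcomm: "\<lbrakk>x \<in> carrier G; y \<in> carrier G; z \<in> carrier G\<rbrakk>
    \<Longrightarrow> x \<boxplus> (y \<boxplus> z) = y \<boxplus> (x \<boxplus> z)"
  and neg_plus: "\<lbrakk>x \<in> carrier G; y \<in> carrier G\<rbrakk> \<Longrightarrow> lu_neg G (x \<boxplus> y) = lu_neg G x \<boxplus> lu_neg G y"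
  using additive.m_assoc[of x y z] additive.m_comm[of x y] additive.m_lcomm[of x y z]
    additive.inv_mult[of x y]
  by (simp_all add: lu_monoid_def)

lemmas add_ac = add_assoc add_comm add_lcomm

lemma add_neg_cancel [simp]: "\<lbrakk>x \<in> carrier G; y \<in> carrier G\<rbrakk> \<Longrightarrow> x \<boxplus> (lu_neg G x \<boxplus> y) = y"
  and neg_add_cancel [simp]: "\<lbrakk>x \<in> carrier G; y \<in> carrier G\<rbrakk> \<Longrightarrow> lu_neg G x \<boxplus> (x \<boxplus> y) = y"
  and add_diff_cancel [simp]: "\<lbrakk>x \<in> carrier G; y \<in> carrier G\<rbrakk> \<Longrightarrow> x \<boxplus> y \<boxminus> y = x"
  and diff_add_cancel [simp]: "\<lbrakk>x \<in> carrier G; y \<in> carrier G\<rbrakk> \<Longrightarrow> x \<boxminus> y \<boxplus> y = x"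
  by (simp_all flip: add_assoc, simp_all add: add_assoc)

lemma add_diff_cancel' [simp]: "\<lbrakk>x \<in> carrier G; y \<in> carrier G\<rbrakk> \<Longrightarrow> x \<boxplus> (y \<boxminus> x) = y"
  by (simp add: add_lcomm[of x])

lemma add_left_cancel: "\<lbrakk>x \<in> carrier G; y \<in> carrier G; z \<in> carrier G\<rbrakk> \<Longrightarrow> z \<boxplus> x = z \<boxplus> y \<longleftrightarrow> x = y"
  by (metis neg_add_cancel)

lemma mult_add: "x \<in> carrier G \<Longrightarrow> lu_mult G (m + n) x = lu_mult G m x \<boxplus> lu_mult G n x"
  using additive.nat_pow_mult[of x m n] by (simp add: lu_monoid_def)

lemma le_add_left_iff: "\<lbrakk>x \<in> carrier G; y \<in> carrier G; z \<in> carrier G\<rbrakk>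
    \<Longrightarrow> z \<boxplus> x \<sqsubseteq> z \<boxplus> y \<longleftrightarrow> x \<sqsubseteq> y"
  by (metis add_closed add_left_mono neg_add_cancel neg_closed)

lemma add_mono: "\<lbrakk>x \<sqsubseteq> x'; y \<sqsubseteq> y'; x \<in> carrier G; y \<in> carrier G; x' \<in> carrier G; y' \<in> carrier G\<rbrakk>
    \<Longrightarrow> x \<boxplus> y \<sqsubseteq> x' \<boxplus> y'"
  by (metis add_closed add_comm add_left_mono le_trans)

lemma diff_le_iff: "\<lbrakk>x \<in> carrier G; y \<in> carrier G; z \<in> carrier G\<rbrakk>
    \<Longrightarrow> x \<boxminus> y \<sqsubseteq> z \<longleftrightarrow> x \<sqsubseteq> z \<boxplus> y"
  using le_add_left_iff[of "x \<boxminus> y" z y] by (simp add: add_comm)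

lemma le_diff_iff: "\<lbrakk>x \<in> carrier G; y \<in> carrier G; z \<in> carrier G\<rbrakk>
    \<Longrightarrow> x \<sqsubseteq> z \<boxminus> y \<longleftrightarrow> x \<boxplus> y \<sqsubseteq> z"
  using le_add_left_iff[of x "z \<boxminus> y" y] by (simp add: add_comm)

lemma neg_le_iff: "\<lbrakk>x \<in> carrier G; y \<in> carrier G\<rbrakk> \<Longrightarrow> lu_neg G x \<sqsubseteq> lu_neg G y \<longleftrightarrow> y \<sqsubseteq> x"
  using diff_le_iff[of \<zero> x "lu_neg G y"] le_add_left_iff[of y x "lu_neg G y"] by simp

lemma neg_le_swap: "\<lbrakk>x \<in> carrier G; y \<in> carrier G\<rbrakk> \<Longrightarrow> lu_neg G x \<sqsubseteq> y \<longleftrightarrow> lu_neg G y \<sqsubseteq> x"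
  using neg_le_iff[of x "lu_neg G y"] by simp

lemma add_nonneg: "\<lbrakk>\<zero> \<sqsubseteq> x; \<zero> \<sqsubseteq> y; x \<in> carrier G; y \<in> carrier G\<rbrakk> \<Longrightarrow> \<zero> \<sqsubseteq> x \<boxplus> y"
  using add_mono[of \<zero> x \<zero> y] by simp

lemma mult_unit_nonneg: "\<zero> \<sqsubseteq> lu_mult G n \<u>"
  by (induction n) (auto intro: add_nonneg unit_nonneg)

lemma joinI_eq:
  "\<lbrakk>x \<sqsubseteq> s; y \<sqsubseteq> s; \<And>z. \<lbrakk>z \<in> carrier G; x \<sqsubseteq> z; y \<sqsubseteq> z\<rbrakk> \<Longrightarrow> s \<sqsubseteq> z;
    x \<in> carrier G; y \<in> carrier G; s \<in> carrier G\<rbrakk> \<Longrightarrow> x \<squnion> y = s"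
  by (simp add: join_left join_le join_right le_antisym)

lemma meetI_eq:
  "\<lbrakk>s \<sqsubseteq> x; s \<sqsubseteq> y; \<And>z. \<lbrakk>z \<in> carrier G; z \<sqsubseteq> x; z \<sqsubseteq> y\<rbrakk> \<Longrightarrow> z \<sqsubseteq> s;
    x \<in> carrier G; y \<in> carrier G; s \<in> carrier G\<rbrakk> \<Longrightarrow> x \<sqinter> y = s"
  by (simp add: meet_left meet_le meet_right le_antisym)

lemma join_le_iff: "\<lbrakk>x \<in> carrier G; y \<in> carrier G; z \<in> carrier G\<rbrakk>
    \<Longrightarrow> x \<squnion> y \<sqsubseteq> z \<longleftrightarrow> x \<sqsubseteq> z \<and> y \<sqsubseteq> z"
  by (meson join_closed join_le join_left join_right le_trans)

lemma le_meet_iff: "\<lbrakk>x \<in> carrier G; y \<in> carrier G; z \<in> carrier G\<rbrakk>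
    \<Longrightarrow> z \<sqsubseteq> x \<sqinter> y \<longleftrightarrow> z \<sqsubseteq> x \<and> z \<sqsubseteq> y"
  by (meson meet_closed meet_le meet_left meet_right le_trans)

lemma add_join: "\<lbrakk>x \<in> carrier G; y \<in> carrier G; z \<in> carrier G\<rbrakk>
    \<Longrightarrow> z \<boxplus> (x \<squnion> y) = (z \<boxplus> x) \<squnion> (z \<boxplus> y)"
  by (rule joinI_eq[symmetric])
    (simp_all add: le_add_left_iff join_left join_right add_comm[of z] join_le_iff flip: le_diff_iff)

lemma add_meet: "\<lbrakk>x \<in> carrier G; y \<in> carrier G; z \<in> carrier G\<rbrakk>
    \<Longrightarrow> z \<boxplus> (x \<sqinter> y) = (z \<boxplus> x) \<sqinter> (z \<boxplus> y)"
  by (rule meetI_eq[symmetric])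
    (simp_all add: le_add_left_iff meet_left meet_right add_comm[of z] le_meet_iff flip: diff_le_iff)

lemma neg_meet: "\<lbrakk>x \<in> carrier G; y \<in> carrier G\<rbrakk>
    \<Longrightarrow> lu_neg G (x \<sqinter> y) = lu_neg G x \<squnion> lu_neg G y"
  by (rule joinI_eq[symmetric])
    (simp_all add: neg_le_iff meet_left meet_right le_meet_iff neg_le_swap)

section \<open>Splitting an element into a truncation and an excess\<close>

lemma join_diff: "\<lbrakk>x \<in> carrier G; y \<in> carrier G\<rbrakk> \<Longrightarrow> x \<squnion> y = pos (x \<boxminus> y) \<boxplus> y"
  using add_join[of "x \<boxminus> y" \<zero> y] by (simp add: add_comm)

text \<open>Negating a meet gives a join of negatives, so \<open>x - (x \<sqinter> v)\<close> is the
  positive part of \<open>x - v\<close>. With \<open>v\<close> the unit this peels off one layer,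
  the step of the inductions in \<open>lub_of_bounded\<close>, \<open>nonneg_sums\<close> and
  \<open>eq_zero_of_truncate_zero\<close>.\<close>

lemma decompose: "\<lbrakk>x \<in> carrier G; v \<in> carrier G\<rbrakk> \<Longrightarrow> (x \<sqinter> v) \<boxplus> pos (x \<boxminus> v) = x"
proof -
  assume [simp]: "x \<in> carrier G" "v \<in> carrier G"
  have "x \<boxminus> (x \<sqinter> v) = pos (x \<boxminus> v)"
    by (simp add: neg_meet add_join join_comm)
  then show ?thesis by (metis \<open>x \<in> carrier G\<close> \<open>v \<in> carrier G\<close> add_diff_cancel' meet_closed)
qed

lemma meet_absorb1: "\<lbrakk>x \<sqsubseteq> y; x \<in> carrier G; y \<in> carrier G\<rbrakk> \<Longrightarrow> x \<sqinter> y = x"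
  by (simp add: meetI_eq)

lemma meet_absorb2: "\<lbrakk>y \<sqsubseteq> x; x \<in> carrier G; y \<in> carrier G\<rbrakk> \<Longrightarrow> x \<sqinter> y = y"
  by (simp add: meetI_eq)

lemma join_absorb1: "\<lbrakk>y \<sqsubseteq> x; x \<in> carrier G; y \<in> carrier G\<rbrakk> \<Longrightarrow> x \<squnion> y = x"
  by (simp add: joinI_eq)

lemma le_add_nonneg: "\<lbrakk>\<zero> \<sqsubseteq> a; x \<in> carrier G; a \<in> carrier G\<rbrakk> \<Longrightarrow> x \<sqsubseteq> x \<boxplus> a"
  using le_add_left_iff[of \<zero> a x] by simp

text \<open>Translation distributes over meets, and \<open>v + a\<close> is already above
  \<open>v\<close>. This is what makes truncated addition associative.\<close>

lemma add_meet_truncate: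
  assumes [simp]: "x \<in> carrier G" "a \<in> carrier G" "v \<in> carrier G" and a: "\<zero> \<sqsubseteq> a"
  shows "((x \<sqinter> v) \<boxplus> a) \<sqinter> v = (x \<boxplus> a) \<sqinter> v"
proof -
  have "(x \<sqinter> v) \<boxplus> a = (x \<boxplus> a) \<sqinter> (v \<boxplus> a)"
    using add_meet[of x v a] by (simp add: add_comm)
  moreover have "(v \<boxplus> a) \<sqinter> v = v" using a by (simp add: meet_absorb2 le_add_nonneg)
  ultimately show ?thesis by (simp add: weak_meet_assoc[simplified eq_is_equal])
qed

text \<open>A carry rule: the excess of \<open>x + a\<close> is the old excess of \<open>x\<close>
  plus the carry produced by adding \<open>a\<close> to the truncated part. After
  \<open>decompose\<close> the right side is a join of \<open>x + a - v\<close> with the old excess,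
  and \<open>x - v\<close> is absorbed because \<open>a\<close> is nonnegative.\<close>

lemma pos_add_diff:
  assumes [simp]: "x \<in> carrier G" "a \<in> carrier G" "v \<in> carrier G" and a: "\<zero> \<sqsubseteq> a"
  shows "pos (x \<boxplus> a \<boxminus> v) = pos (x \<boxminus> v) \<boxplus> pos ((x \<sqinter> v) \<boxplus> a \<boxminus> v)"
proof -
  let ?q = "pos (x \<boxminus> v)"
  have "?q \<boxplus> ((x \<sqinter> v) \<boxplus> a \<boxminus> v) = ((x \<sqinter> v) \<boxplus> ?q) \<boxplus> (a \<boxminus> v)"
    by (simp add: add_ac)
  also have "\<dots> = x \<boxplus> (a \<boxminus> v)" by (simp add: decompose)
  finally have "?q \<boxplus> pos ((x \<sqinter> v) \<boxplus> a \<boxminus> v) = (x \<boxplus> (a \<boxminus> v)) \<squnion> ?q"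
    by (simp add: add_join)
  also have "\<dots> = pos (x \<boxplus> (a \<boxminus> v))"
  proof (rule joinI_eq)
    have "x \<boxminus> v \<sqsubseteq> x \<boxplus> (a \<boxminus> v)"
      using le_add_nonneg[OF a, of "x \<boxminus> v"] by (simp add: add_ac)
    also have "\<dots> \<sqsubseteq> pos (x \<boxplus> (a \<boxminus> v))" by (simp add: join_left)
    finally show "?q \<sqsubseteq> pos (x \<boxplus> (a \<boxminus> v))"
      by (simp add: join_le join_right)
  qed (auto simp: join_left join_le_iff)
  finally show ?thesis by (simp add: add_assoc)
qed

text \<open>Lets the excess over \<open>n\<close> units be computed by removing one unit at a time.
  Nonnegativity of \<open>w\<close> ensures that the inner truncation at \<open>0\<close> adds
  nothing after \<open>w\<close> is subtracted.\<close>

lemma pos_pos_diff: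
  assumes [simp]: "x \<in> carrier G" "v \<in> carrier G" "w \<in> carrier G" and w: "\<zero> \<sqsubseteq> w"
  shows "pos (pos (x \<boxminus> v) \<boxminus> w) = pos (x \<boxminus> (v \<boxplus> w))"
proof (rule joinI_eq)
  show "\<zero> \<sqsubseteq> pos (x \<boxminus> (v \<boxplus> w))" by (simp add: join_right)
  have "x \<boxminus> (v \<boxplus> w) \<boxplus> w = x \<boxminus> v" by (simp add: neg_plus add_assoc)
  moreover have "x \<boxminus> (v \<boxplus> w) \<boxplus> w \<sqsubseteq> pos (x \<boxminus> (v \<boxplus> w)) \<boxplus> w"
    by (intro add_mono) (simp_all add: join_left)
  moreover have "\<zero> \<sqsubseteq> pos (x \<boxminus> (v \<boxplus> w)) \<boxplus> w" by (rule add_nonneg) (simp_all add: join_right w)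
  ultimately show "pos (x \<boxminus> v) \<boxminus> w \<sqsubseteq> pos (x \<boxminus> (v \<boxplus> w))"
    by (simp add: diff_le_iff join_le)
  fix z assume [simp]: "z \<in> carrier G" and z: "pos (x \<boxminus> v) \<boxminus> w \<sqsubseteq> z" "\<zero> \<sqsubseteq> z"
  then have "x \<boxminus> v \<sqsubseteq> z \<boxplus> w" by (simp add: diff_le_iff join_le_iff)
  moreover have "x \<boxminus> (v \<boxplus> w) = x \<boxminus> v \<boxminus> w" by (simp add: neg_plus add_assoc)
  ultimately have "x \<boxminus> (v \<boxplus> w) \<sqsubseteq> z" using diff_le_iff[of "x \<boxminus> v" w z] by simp
  then show "pos (x \<boxminus> (v \<boxplus> w)) \<sqsubseteq> z" using z by (simp add: join_le)
qed simp_all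

end

section \<open>The subgroup generated by a set closed under the MV-operations\<close>

locale sub_mv_lgroup = lgroup +
  fixes A
  assumes sub_mv: "sub_mv G A"
begin

lemma A_carrier: "a \<in> A \<Longrightarrow> a \<in> carrier G"
  and A_nonneg: "a \<in> A \<Longrightarrow> \<zero> \<sqsubseteq> a"
  and A_le: "a \<in> A \<Longrightarrow> a \<sqsubseteq> \<u>"
  and A_zero: "\<zero> \<in> A"
  and A_neg: "a \<in> A \<Longrightarrow> \<u> \<boxminus> a \<in> A"
  and A_add: "\<lbrakk>a \<in> A; b \<in> A\<rbrakk> \<Longrightarrow> (a \<boxplus> b) \<sqinter> \<u> \<in> A"
  using sub_mv by (auto simp: sub_mv_def at_least_at_most_def)

lemma A_unit: "\<u> \<in> A" using A_neg[OF A_zero] by simp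

text \<open>The carry is the MV-product of \<open>a\<close> and \<open>b\<close>: the complement of
  the truncated sum of the complements.\<close>

lemma A_carry: assumes "a \<in> A" "b \<in> A" shows "pos (a \<boxplus> b \<boxminus> \<u>) \<in> A"
proof -
  note [simp] = A_carrier[OF assms(1)] A_carrier[OF assms(2)]
  have "pos (a \<boxplus> b \<boxminus> \<u>) = \<u> \<boxminus> (((\<u> \<boxminus> a) \<boxplus> (\<u> \<boxminus> b)) \<sqinter> \<u>)"
  proof -
    have "(\<u> \<boxminus> a) \<boxplus> (\<u> \<boxminus> b) = \<u> \<boxplus> (\<u> \<boxplus> lu_neg G (a \<boxplus> b))"
      by (simp add: neg_plus add_ac)
    then show ?thesis
      by (simp add: neg_meet add_join neg_plus add_comm)
  qed
  then show ?thesis using assms by (simp add: A_neg A_add)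
qed

lemma sums_carrier: "x \<in> sums G A \<Longrightarrow> x \<in> carrier G"
  by (induction rule: sums.induct) (auto simp: A_carrier)

lemma sums_nonneg: "x \<in> sums G A \<Longrightarrow> \<zero> \<sqsubseteq> x"
  by (induction rule: sums.induct) (auto simp: A_carrier A_nonneg sums_carrier intro: add_nonneg)

lemma A_sums: "a \<in> A \<Longrightarrow> a \<in> sums G A"
  using sums_add[OF sums_zero, of a A G] by (simp add: A_carrier)

lemma sums_add_closed: "\<lbrakk>y \<in> sums G A; x \<in> sums G A\<rbrakk> \<Longrightarrow> x \<boxplus> y \<in> sums G A"
proof (induction rule: sums.induct)
  case sums_zero then show ?case by (simp add: sums_carrier)
next
  case (sums_add y a)
  then have "(x \<boxplus> y) \<boxplus> a \<in> sums G A" by (blast intro: sums.sums_add)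
  then show ?case using sums_add by (simp add: add_assoc sums_carrier A_carrier)
qed

text \<open>The unit is itself a member of \<open>A\<close>, being the complement of zero, so its
  multiples are ordinary sums.\<close>

lemma sums_unit: "lu_mult G n \<u> \<in> sums G A"
  by (induction n) (auto intro: sums_zero sums_add A_unit)

lemma sums_truncate: "x \<in> sums G A \<Longrightarrow> x \<sqinter> \<u> \<in> A"
proof (induction rule: sums.induct)
  case sums_zero then show ?case by (simp add: meet_absorb1 unit_nonneg A_zero)
next
  case (sums_add x a)
  then show ?case
    using A_add[of "x \<sqinter> \<u>" a] by (simp add: add_meet_truncate sums_carrier A_carrier A_nonneg)
qed

lemma sums_excess: "x \<in> sums G A \<Longrightarrow> pos (x \<boxminus> \<u>) \<in> sums G A"
proof (induction rule: sums.induct)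
  case sums_zero
  have "pos (\<zero> \<boxminus> \<u>) = \<zero>"
    using diff_le_iff[of \<zero> \<u> \<zero>] unit_nonneg by (intro joinI_eq) auto
  then show ?case by (simp add: sums.sums_zero)
next
  case (sums_add x a)
  \<comment> \<open>The carry of the last addition involves only the truncation of \<open>x\<close>,
    which is a member of \<open>A\<close>; thus a single new summand accounts for it.\<close>
  have "pos ((x \<sqinter> \<u>) \<boxplus> a \<boxminus> \<u>) \<in> A" using sums_add by (intro A_carry sums_truncate)
  then show ?case
    using sums.sums_add[OF sums_add.IH, of "pos ((x \<sqinter> \<u>) \<boxplus> a \<boxminus> \<u>)"] sums_add
    by (simp add: pos_add_diff sums_carrier A_carrier A_nonneg)
qed

lemma sums_excess_mult: "x \<in> sums G A \<Longrightarrow> pos (x \<boxminus> lu_mult G n \<u>) \<in> sums G A"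
proof (induction n arbitrary: x)
  case 0 then show ?case by (simp add: join_absorb1 sums_carrier sums_nonneg)
next
  case (Suc n)
  have "pos (pos (x \<boxminus> \<u>) \<boxminus> lu_mult G n \<u>) \<in> sums G A" using Suc by (simp add: sums_excess)
  then show ?case
    using Suc.prems by (simp add: pos_pos_diff sums_carrier mult_unit_nonneg add_comm[of _ \<u>])
qed

text \<open>Each summand is replaced by its complement, so the number of units used is the number of
  summands.\<close>

lemma sums_neg: "x \<in> sums G A \<Longrightarrow> \<exists>n. lu_mult G n \<u> \<boxminus> x \<in> sums G A"
proof (induction rule: sums.induct)
  case sums_zero then show ?case using sums.sums_zero by (intro exI[of _ 0]) simp
next
  case (sums_add x a)
  then obtain n where "lu_mult G n \<u> \<boxminus> x \<in> sums G A" by auto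
  then have "(lu_mult G n \<u> \<boxminus> x) \<boxplus> (\<u> \<boxminus> a) \<in> sums G A"
    by (rule sums.sums_add) (rule A_neg[OF sums_add.hyps(2)])
  then have "lu_mult G (Suc n) \<u> \<boxminus> (x \<boxplus> a) \<in> sums G A"
    using sums_add by (simp add: sums_carrier A_carrier neg_plus add_ac)
  then show ?case ..
qed

lemma sums_le_mult: "x \<in> sums G A \<Longrightarrow> \<exists>n. x \<sqsubseteq> lu_mult G n \<u>"
proof (induction rule: sums.induct)
  case sums_zero then show ?case by (intro exI[of _ 0]) simp
next
  case (sums_add x a)
  then obtain n where "x \<sqsubseteq> lu_mult G n \<u>" by auto
  then have "x \<boxplus> a \<sqsubseteq> lu_mult G (Suc n) \<u>"
    using sums_add by (auto simp: sums_carrier A_carrier A_le intro!: add_mono)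
  then show ?case ..
qed

lemma span_carrier: "x \<in> span G A \<Longrightarrow> x \<in> carrier G"
  by (simp add: span_def)

lemma sums_span: "x \<in> sums G A \<Longrightarrow> x \<in> span G A"
  unfolding span_def using sums_carrier by (auto intro!: exI[of _ 0])

lemma A_span: "a \<in> A \<Longrightarrow> a \<in> span G A"
  by (simp add: A_sums sums_span)

lemma span_zero: "\<zero> \<in> span G A" and span_unit: "\<u> \<in> span G A"
  by (simp_all add: A_span A_zero A_unit)

lemma span_add: assumes "x \<in> span G A" "y \<in> span G A" shows "x \<boxplus> y \<in> span G A"
proof -
  obtain m n where "x \<boxplus> lu_mult G m \<u> \<in> sums G A" "y \<boxplus> lu_mult G n \<u> \<in> sums G A"
    using assms by (auto simp: span_def)
  from sums_add_closed[OF this(2,1)] have "(x \<boxplus> y) \<boxplus> lu_mult G (m + n) \<u> \<in> sums G A"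
    using assms by (simp add: span_carrier mult_add add_ac)
  then show ?thesis using assms by (auto simp: span_def)
qed

lemma span_neg: assumes "x \<in> span G A" shows "lu_neg G x \<in> span G A"
proof -
  obtain m where m: "x \<boxplus> lu_mult G m \<u> \<in> sums G A" using assms by (auto simp: span_def)
  then obtain n where "lu_mult G n \<u> \<boxminus> (x \<boxplus> lu_mult G m \<u>) \<in> sums G A" using sums_neg by blast
  from sums_add_closed[OF this sums_unit[of m]]
  have "lu_neg G x \<boxplus> lu_mult G n \<u> \<in> sums G A"
    using assms by (simp add: span_carrier neg_plus add_ac)
  then show ?thesis using assms by (auto simp: span_def)
qed

text \<open>Some \<open>x + m u\<close> is a sum, and the positive part of \<open>x\<close> is the
  excess of that sum over \<open>m u\<close>.\<close>

lemma span_pos: assumes "x \<in> span G A" shows "pos x \<in> sums G A"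
proof -
  obtain m where "x \<boxplus> lu_mult G m \<u> \<in> sums G A" using assms by (auto simp: span_def)
  from sums_excess_mult[OF this, of m] show ?thesis using assms by (simp add: span_carrier)
qed

lemma span_join: assumes "x \<in> span G A" "y \<in> span G A" shows "x \<squnion> y \<in> span G A"
proof -
  have "pos (x \<boxminus> y) \<boxplus> y \<in> span G A" by (intro span_add sums_span[OF span_pos] span_neg assms)
  then show ?thesis using assms by (subst join_diff) (simp_all add: span_carrier)
qed

lemma span_meet: assumes "x \<in> span G A" "y \<in> span G A" shows "x \<sqinter> y \<in> span G A"
proof -
  have "x \<sqinter> y = lu_neg G (lu_neg G x \<squnion> lu_neg G y)"
    using assms by (simp add: span_carrier flip: neg_meet)
  then show ?thesis using assms by (simp add: span_join span_neg)
qed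

lemma span_le_mult: assumes "x \<in> span G A" shows "\<exists>n. x \<sqsubseteq> lu_mult G n \<u>"
proof -
  obtain n where "pos x \<sqsubseteq> lu_mult G n \<u>" using sums_le_mult span_pos assms by blast
  then show ?thesis using assms by (auto simp: span_carrier join_le_iff)
qed

text \<open>A nonnegative element is its own positive part, hence a sum; an element below
  \<open>u\<close> is its own truncation, and truncations of sums stay in \<open>A\<close>.\<close>

lemma span_interval:
  assumes "x \<in> span G A" "\<zero> \<sqsubseteq> x" "x \<sqsubseteq> \<u>" shows "x \<in> A"
  using sums_truncate[OF span_pos[OF assms(1)]] assms
  by (simp add: join_absorb1 meet_absorb1 span_carrier)

end

section \<open>MV-algebras\<close>

context mv_algebra
begin

abbreviation neg ("\<sim> _" [81] 80) where "\<sim> x \<equiv> mv_neg A x"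
abbreviation zero ("\<zero>") where "\<zero> \<equiv> mv_zero A"
abbreviation unity ("\<one>") where "\<one> \<equiv> \<sim> \<zero>"
abbreviation dot (infixl "\<odot>" 70) where "x \<odot> y \<equiv> \<sim> (\<sim> x \<oplus> \<sim> y)"
abbreviation minus (infixl "\<ominus>" 65) where "x \<ominus> y \<equiv> \<sim> (\<sim> x \<oplus> y)"
abbreviation mv_le (infix "\<preceq>" 50) where "x \<preceq> y \<equiv> \<sim> x \<oplus> y = \<one>"
abbreviation join (infixl "\<or>\<or>" 65) where "join x y \<equiv> x \<ominus> y \<oplus> y"
abbreviation meet (infixl "\<and>\<and>" 70) where "meet x y \<equiv> \<sim> (join (\<sim> x) (\<sim> y))"

lemma mv_monoid_simps [simp]:
  "carrier (mv_monoid A) = carrier A" "mult (mv_monoid A) = mv_add A"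
  "monoid.one (mv_monoid A) = \<zero>"
  by (simp_all add: mv_monoid_def)

lemma add_closed [simp]: "\<lbrakk>x \<in> carrier A; y \<in> carrier A\<rbrakk> \<Longrightarrow> x \<oplus> y \<in> carrier A"
  and zero_closed [simp]: "\<zero> \<in> carrier A"
  and add_zero [simp]: "x \<in> carrier A \<Longrightarrow> x \<oplus> \<zero> = x"
  and zero_add [simp]: "x \<in> carrier A \<Longrightarrow> \<zero> \<oplus> x = x"
  and add_assoc: "\<lbrakk>x \<in> carrier A; y \<in> carrier A; z \<in> carrier A\<rbrakk>
    \<Longrightarrow> x \<oplus> y \<oplus> z = x \<oplus> (y \<oplus> z)"
  and add_comm: "\<lbrakk>x \<in> carrier A; y \<in> carrier A\<rbrakk> \<Longrightarrow> x \<oplus> y = y \<oplus> x"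
  and add_lcomm: "\<lbrakk>x \<in> carrier A; y \<in> carrier A; z \<in> carrier A\<rbrakk>
    \<Longrightarrow> x \<oplus> (y \<oplus> z) = y \<oplus> (x \<oplus> z)"
  using additive.m_closed[of x y] additive.one_closed additive.r_one[of x] additive.l_one[of x]
    additive.m_assoc[of x y z] additive.m_comm[of x y] additive.m_lcomm[of x y z]
  by simp_all

lemmas add_ac = add_assoc add_comm add_lcomm

declare neg_closed [simp] neg_neg [simp]

lemma add_one [simp]: "x \<in> carrier A \<Longrightarrow> x \<oplus> \<one> = \<one>"
  and one_add [simp]: "x \<in> carrier A \<Longrightarrow> \<one> \<oplus> x = \<one>"
  using add_neg_zero[of x] add_comm[of \<one> x] by simp_all

lemma add_neg [simp]: "x \<in> carrier A \<Longrightarrow> x \<oplus> \<sim> x = \<one>"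
  and neg_add [simp]: "x \<in> carrier A \<Longrightarrow> \<sim> x \<oplus> x = \<one>"
  using join_comm[of x \<one>] by (simp_all add: add_comm)

lemma neg_add_assoc [simp]:
  "\<lbrakk>x \<in> carrier A; y \<in> carrier A\<rbrakk> \<Longrightarrow> x \<oplus> (\<sim> x \<oplus> y) = \<one>"
  "\<lbrakk>x \<in> carrier A; y \<in> carrier A\<rbrakk> \<Longrightarrow> \<sim> x \<oplus> (x \<oplus> y) = \<one>"
  by (simp_all flip: add_assoc)

lemma join_comm': "\<lbrakk>x \<in> carrier A; y \<in> carrier A\<rbrakk> \<Longrightarrow> join x y = join y x"
  by (rule join_comm)

lemma le_add: "\<lbrakk>x \<in> carrier A; y \<in> carrier A\<rbrakk> \<Longrightarrow> x \<preceq> x \<oplus> y"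
  and le_add': "\<lbrakk>x \<in> carrier A; y \<in> carrier A\<rbrakk> \<Longrightarrow> x \<preceq> y \<oplus> x"
  by (simp_all add: add_comm[of y x])

lemma le_imp_join: "\<lbrakk>x \<preceq> y; x \<in> carrier A; y \<in> carrier A\<rbrakk> \<Longrightarrow> y = join y x"
  using join_comm[of x y] by simp

lemma le_antisym: "\<lbrakk>x \<preceq> y; y \<preceq> x; x \<in> carrier A; y \<in> carrier A\<rbrakk> \<Longrightarrow> x = y"
  using le_imp_join[of x y] by simp

lemma add_mono:
  assumes "x \<preceq> y" and [simp]: "x \<in> carrier A" "y \<in> carrier A" "z \<in> carrier A"
  shows "x \<oplus> z \<preceq> y \<oplus> z"
proof -
  have "y \<oplus> z = (y \<ominus> x) \<oplus> (x \<oplus> z)"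
    by (subst le_imp_join[OF assms(1)]) (simp_all add: add_assoc)
  then show ?thesis by (simp add: le_add')
qed

lemma add_mono2: "\<lbrakk>x \<preceq> y; x \<in> carrier A; y \<in> carrier A; z \<in> carrier A\<rbrakk> \<Longrightarrow> z \<oplus> x \<preceq> z \<oplus> y"
  using add_mono[of x y z] by (simp add: add_comm)

lemma le_trans:
  assumes "x \<preceq> y" "y \<preceq> z" and [simp]: "x \<in> carrier A" "y \<in> carrier A" "z \<in> carrier A"
  shows "x \<preceq> z"
proof -
  have "z = (z \<ominus> y) \<oplus> (y \<ominus> x) \<oplus> x"
    using le_imp_join[OF assms(1)] le_imp_join[OF assms(2)] by (simp add: add_assoc)
  then show ?thesis using le_add'[of x "(z \<ominus> y) \<oplus> (y \<ominus> x)"] by simp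
qed

lemma neg_le_iff: "\<lbrakk>x \<in> carrier A; y \<in> carrier A\<rbrakk> \<Longrightarrow> \<sim> x \<preceq> \<sim> y \<longleftrightarrow> y \<preceq> x"
  by (simp add: add_comm)

lemma neg_le_swap: "\<lbrakk>x \<in> carrier A; y \<in> carrier A\<rbrakk> \<Longrightarrow> \<sim> x \<preceq> y \<longleftrightarrow> \<sim> y \<preceq> x"
  by (simp add: add_comm)

lemma minus_le_iff: "\<lbrakk>x \<in> carrier A; y \<in> carrier A; z \<in> carrier A\<rbrakk>
    \<Longrightarrow> x \<ominus> y \<preceq> z \<longleftrightarrow> x \<preceq> y \<oplus> z"
  by (simp add: add_assoc)

lemma minus_le: "\<lbrakk>x \<in> carrier A; y \<in> carrier A\<rbrakk> \<Longrightarrow> x \<ominus> y \<preceq> x"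
  by (simp add: add_assoc add_comm[of y x])

lemma join_ge2: "\<lbrakk>x \<in> carrier A; y \<in> carrier A\<rbrakk> \<Longrightarrow> y \<preceq> join x y"
  by (simp add: le_add')

lemma join_ge1: "\<lbrakk>x \<in> carrier A; y \<in> carrier A\<rbrakk> \<Longrightarrow> x \<preceq> join x y"
  using join_ge2[of y x] by (simp add: join_comm'[of x y])

lemma minus_mono: "\<lbrakk>x \<preceq> y; x \<in> carrier A; y \<in> carrier A; z \<in> carrier A\<rbrakk> \<Longrightarrow> x \<ominus> z \<preceq> y \<ominus> z"
  using add_mono[of "\<sim> y" "\<sim> x" z] by (simp add: neg_le_iff add_comm)

lemma join_least:
  assumes "x \<preceq> z" "y \<preceq> z" and [simp]: "x \<in> carrier A" "y \<in> carrier A" "z \<in> carrier A"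
  shows "join x y \<preceq> z"
proof -
  have "join x y \<preceq> join z y" by (rule add_mono[OF minus_mono[OF assms(1)]]) simp_all
  then show ?thesis using le_imp_join[OF assms(2)] by simp
qed

lemma meet_le1: "\<lbrakk>x \<in> carrier A; y \<in> carrier A\<rbrakk> \<Longrightarrow> meet x y \<preceq> x"
  using join_ge1[of "\<sim> x" "\<sim> y"] neg_le_swap[of "join (\<sim> x) (\<sim> y)" x]
    by (simp del: neg_add_assoc add: add_comm)

lemma meet_le2: "\<lbrakk>x \<in> carrier A; y \<in> carrier A\<rbrakk> \<Longrightarrow> meet x y \<preceq> y"
  using meet_le1[of y x] join_comm'[of "\<sim> x" "\<sim> y"] by simp

lemma meet_greatest:
  assumes "z \<preceq> x" "z \<preceq> y" and [simp]: "x \<in> carrier A" "y \<in> carrier A" "z \<in> carrier A"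
  shows "z \<preceq> meet x y"
proof -
  have "join (\<sim> x) (\<sim> y) \<preceq> \<sim> z" using assms neg_le_iff[of x z] neg_le_iff[of y z]
    by (intro join_least) simp_all
  then show ?thesis using add_comm[of "\<sim> z" "meet x y"] by simp
qed

lemma minus_eq_zero_iff: "\<lbrakk>x \<in> carrier A; y \<in> carrier A\<rbrakk> \<Longrightarrow> x \<ominus> y = \<zero> \<longleftrightarrow> x \<preceq> y"
  by (metis neg_neg add_closed neg_closed zero_closed)

lemma le_zero: "\<lbrakk>x \<preceq> \<zero>; x \<in> carrier A\<rbrakk> \<Longrightarrow> x = \<zero>"
  by (rule le_antisym) simp_all

lemma minus_minus: "\<lbrakk>x \<in> carrier A; y \<in> carrier A\<rbrakk> \<Longrightarrow> x \<ominus> (x \<ominus> y) = meet x y"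
  using join_comm[of "\<sim> x" "\<sim> y"] by (simp add: add_comm)

text \<open>Write \<open>m\<close> for the meet of \<open>x\<close> and \<open>y\<close>. Adding
  \<open>x \<ominus> y\<close> or \<open>y \<ominus> x\<close> to \<open>m\<close> gives back
  \<open>x\<close> or \<open>y\<close>, so \<open>m \<oplus> t\<close> is below both and equals
  \<open>m\<close>. Since \<open>t\<close> also lies below the complement of \<open>m\<close>, where
  truncated addition to \<open>m\<close> can be cancelled, \<open>t\<close> vanishes.\<close>

lemma prelinear:
  assumes [simp]: "x \<in> carrier A" "y \<in> carrier A" "t \<in> carrier A"
    and t: "t \<preceq> x \<ominus> y" "t \<preceq> y \<ominus> x"
  shows "t = \<zero>"
proof -
  define m where "m = x \<ominus> (x \<ominus> y)"
  have [simp]: "m \<in> carrier A" by (simp add: m_def)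
  have m: "m = y \<ominus> (y \<ominus> x)"
    unfolding m_def using minus_minus[of x y] minus_minus[of y x] join_comm'[of "\<sim> x" "\<sim> y"]
    by simp
  have add: "m \<oplus> (x \<ominus> y) = x"
    unfolding m_def
    using join_comm'[of x "x \<ominus> y"] le_imp_join[of "x \<ominus> y" x] minus_le[of x y] by simp
  have add': "m \<oplus> (y \<ominus> x) = y"
    unfolding m
    using join_comm'[of y "y \<ominus> x"] le_imp_join[of "y \<ominus> x" y] minus_le[of y x] by simp
  have "m \<oplus> t \<preceq> x" "m \<oplus> t \<preceq> y"
    using add_mono2[OF t(1), of m] add_mono2[OF t(2), of m] add add' by simp_all
  then have "m \<oplus> t \<preceq> m" unfolding m_def
    using meet_greatest[of "m \<oplus> t" x y] minus_minus[of x y] m_def by simp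
  then have eq: "m \<oplus> t = m" by (rule le_antisym[OF _ le_add]) simp_all
  have "x \<ominus> y \<preceq> \<sim> m"
  proof -
    have "y \<oplus> \<sim> m = \<one>" using add' le_add[of m "y \<ominus> x"] by (simp add: add_comm)
    then have "\<sim> x \<oplus> (y \<oplus> \<sim> m) = \<one>" by simp
    then show ?thesis by (simp add: add_assoc)
  qed
  with t(1) have t': "t \<preceq> \<sim> m" by (rule le_trans) simp_all
  \<comment> \<open>The meet of \<open>\<sim> m\<close> and \<open>t\<close> is
    \<open>\<sim> m \<ominus> (\<sim> m \<ominus> t)\<close>; here
    \<open>\<sim> m \<ominus> t\<close> is the complement of \<open>m \<oplus> t = m\<close>, so the
    difference is zero.\<close>
  have "t \<preceq> meet (\<sim> m) t" by (rule meet_greatest[OF t']) simp_all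
  then have "t = meet (\<sim> m) t" by (rule le_antisym[OF _ meet_le2]) simp_all
  also have "\<dots> = \<sim> m \<ominus> (\<sim> m \<ominus> t)" by (rule minus_minus[symmetric]) simp_all
  also have "\<dots> = \<zero>" using eq by simp
  finally show ?thesis .
qed

text \<open>The part \<open>t \<ominus> a\<close> of \<open>t\<close> lies below both
  \<open>c\<close> and \<open>b\<close>, so it is zero and \<open>t\<close> already lies below
  \<open>a\<close>. Iterating this makes multiples of disjoint elements disjoint, as the prime ideal
  theorem requires.\<close>

lemma disjoint_add:
  assumes [simp]: "a \<in> carrier A" "b \<in> carrier A" "c \<in> carrier A"
    and "\<And>t. \<lbrakk>t \<in> carrier A; t \<preceq> c; t \<preceq> a\<rbrakk> \<Longrightarrow> t = \<zero>"
    and "\<And>t. \<lbrakk>t \<in> carrier A; t \<preceq> c; t \<preceq> b\<rbrakk> \<Longrightarrow> t = \<zero>"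
    and [simp]: "t \<in> carrier A" and "t \<preceq> c" "t \<preceq> a \<oplus> b"
  shows "t = \<zero>"
proof -
  have "t \<ominus> a = \<zero>"
  proof (rule assms(5))
    show "t \<ominus> a \<preceq> c" using minus_le[of t a] assms(7) le_trans[of "t \<ominus> a" t c] by simp
    show "t \<ominus> a \<preceq> b" using minus_le_iff[of t a b] assms(8) by simp
  qed simp
  then have "t \<preceq> a" using minus_eq_zero_iff[of t a] by simp
  then show ?thesis using assms by blast
qed

end

section \<open>Ideals and the prime ideal theorem\<close>

locale mv_ideal = mv_algebra +
  fixes I
  assumes I_subset: "x \<in> I \<Longrightarrow> x \<in> carrier A"
    and I_zero: "\<zero> \<in> I"
    and I_add: "\<lbrakk>x \<in> I; y \<in> I\<rbrakk> \<Longrightarrow> x \<oplus> y \<in> I"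
    and I_down: "\<lbrakk>x \<in> carrier A; y \<in> I; x \<preceq> y\<rbrakk> \<Longrightarrow> x \<in> I"

text \<open>Primeness is stated through the two differences because this is exactly comparability of
  \<open>x\<close> and \<open>y\<close> in the quotient. Properness keeps \<open>0\<close> and
  \<open>1\<close> apart there.\<close>

locale mv_prime = mv_ideal A P for A :: "'a mv_algebra" (structure) and P +
  assumes prime: "\<lbrakk>x \<in> carrier A; y \<in> carrier A\<rbrakk> \<Longrightarrow> x \<ominus> y \<in> P \<or> y \<ominus> x \<in> P"
    and proper: "\<one> \<notin> P"

context mv_algebra
begin

abbreviation mv_mult where "mv_mult n x \<equiv> x [^]\<^bsub>mv_monoid A\<^esub> (n::nat)"

lemma mv_mult_closed [simp]: "x \<in> carrier A \<Longrightarrow> mv_mult n x \<in> carrier A"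
  using additive.nat_pow_closed[of x n] by simp

lemma mult_disjoint:
  assumes "a \<in> carrier A" "c \<in> carrier A"
    and "\<And>t. \<lbrakk>t \<in> carrier A; t \<preceq> c; t \<preceq> a\<rbrakk> \<Longrightarrow> t = \<zero>"
    and "t \<in> carrier A" "t \<preceq> c" "t \<preceq> mv_mult n a"
  shows "t = \<zero>"
  using assms(4-)
proof (induction n arbitrary: t)
  case 0 then show ?case by (simp add: le_zero)
next
  case (Suc n)
  show ?case
    by (rule disjoint_add[of "mv_mult n a" a c]) (use Suc assms in auto)
qed

lemma mults_disjoint:
  assumes a: "a \<in> carrier A" and b: "b \<in> carrier A"
    and ab: "\<And>t. \<lbrakk>t \<in> carrier A; t \<preceq> a; t \<preceq> b\<rbrakk> \<Longrightarrow> t = \<zero>"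
    and t: "t \<in> carrier A" "t \<preceq> mv_mult m a" "t \<preceq> mv_mult n b"
  shows "t = \<zero>"
proof (rule mult_disjoint[OF b _ _ t])
  fix s assume s: "s \<in> carrier A" "s \<preceq> mv_mult m a" "s \<preceq> b"
  show "s = \<zero>"
    using ab by (intro mult_disjoint[OF a b _ s(1) s(3) s(2)])
qed (simp add: a)

lemma ideal_adjoin:
  assumes "mv_ideal A I" and a: "a \<in> carrier A"
  shows "mv_ideal A {x \<in> carrier A. \<exists>p\<in>I. \<exists>n. x \<preceq> p \<oplus> mv_mult n a}" (is "mv_ideal A ?J")
proof -
  interpret mv_ideal A I by fact
  note [simp] = I_subset a
  show ?thesis
  proof
    show "\<zero> \<in> ?J" using I_zero by auto
    fix x y
    { assume "x \<in> ?J" then show "x \<in> carrier A" by simp }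
    { assume "x \<in> ?J" "y \<in> ?J"
      then obtain p m q n where *: "x \<in> carrier A" "y \<in> carrier A" "p \<in> I" "q \<in> I"
        "x \<preceq> p \<oplus> mv_mult m a" "y \<preceq> q \<oplus> mv_mult n a" by auto
      have "x \<oplus> y \<preceq> (p \<oplus> mv_mult m a) \<oplus> (q \<oplus> mv_mult n a)"
        using le_trans[OF add_mono[OF *(5)] add_mono2[OF *(6)]] * by simp
      also have "(p \<oplus> mv_mult m a) \<oplus> (q \<oplus> mv_mult n a) = (p \<oplus> q) \<oplus> mv_mult (m + n) a"
        using * additive.nat_pow_mult[of a m n] by (simp add: add_ac flip: additive.nat_pow_mult)
      finally show "x \<oplus> y \<in> ?J" using * I_add[OF *(3,4)] by auto }
    { assume *: "x \<in> carrier A" "y \<in> ?J" "x \<preceq> y"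
      then obtain p n where "p \<in> I" "y \<in> carrier A" "y \<preceq> p \<oplus> mv_mult n a" by auto
      then show "x \<in> ?J" using * le_trans[of x y "p \<oplus> mv_mult n a"] by auto }
  qed
qed

text \<open>An ideal maximal among those avoiding \<open>z\<close> is prime: were both differences
  of \<open>x\<close> and \<open>y\<close> missing, adjoining either would capture \<open>z\<close>,
  although the two differences are disjoint by \<open>prelinear\<close>.\<close>

lemma exists_prime:
  assumes z: "z \<in> carrier A" "z \<noteq> \<zero>"
  shows "\<exists>P. mv_prime A P \<and> z \<notin> P"
proof -
  let ?S = "{I. mv_ideal A I \<and> z \<notin> I}"
  have zero: "mv_ideal A {\<zero>}"
    by unfold_locales (auto simp: le_zero)
  have "\<exists>M\<in>?S. \<forall>X\<in>?S. M \<subseteq> X \<longrightarrow> X = M"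
  proof (rule subset_Zorn_nonempty)
    show "?S \<noteq> {}" using zero z by auto
    fix \<C> assume ne: "\<C> \<noteq> {}" and chain: "subset.chain ?S \<C>"
    then have id: "mv_ideal A I" if "I \<in> \<C>" for I
      using that by (auto simp: subset.chain_def)
    have "mv_ideal A (\<Union>\<C>)"
    proof
      show "\<zero> \<in> \<Union>\<C>" using ne mv_ideal.I_zero[OF id] by blast
      fix x y
      { assume "x \<in> \<Union>\<C>" then show "x \<in> carrier A" using mv_ideal.I_subset[OF id] by blast }
      { assume "x \<in> \<Union>\<C>" "y \<in> \<Union>\<C>"
        then obtain I J where IJ: "I \<in> \<C>" "J \<in> \<C>" "x \<in> I" "y \<in> J" by blast
        then have "I \<subseteq> J \<or> J \<subseteq> I" using chain by (auto simp: subset.chain_def)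
        then show "x \<oplus> y \<in> \<Union>\<C>"
          using IJ mv_ideal.I_add[OF id[OF IJ(1)], of x y] mv_ideal.I_add[OF id[OF IJ(2)], of x y]
          by blast }
      { assume "x \<in> carrier A" "y \<in> \<Union>\<C>" "x \<preceq> y"
        then show "x \<in> \<Union>\<C>" using mv_ideal.I_down[OF id] by blast }
    qed
    moreover have "z \<notin> \<Union>\<C>" using chain by (auto simp: subset.chain_def)
    ultimately show "\<Union>\<C> \<in> ?S" by simp
  qed
  then obtain M where M: "mv_ideal A M" "z \<notin> M"
    and max: "\<And>X. \<lbrakk>mv_ideal A X; z \<notin> X; M \<subseteq> X\<rbrakk> \<Longrightarrow> X = M" by auto
  interpret mv_ideal A M by (rule M)
  \<comment> \<open>Maximality in explicit form: the ideal generated by \<open>M\<close> and an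
    outside element \<open>a\<close> must contain \<open>z\<close>.\<close>
  have adjoin: "\<exists>p\<in>M. \<exists>n. z \<preceq> p \<oplus> mv_mult n a" if a: "a \<in> carrier A" "a \<notin> M" for a
  proof (rule ccontr)
    assume not: "\<not> ?thesis"
    let ?J = "{x \<in> carrier A. \<exists>p\<in>M. \<exists>n. x \<preceq> p \<oplus> mv_mult n a}"
    have "M \<subseteq> ?J"
    proof
      fix x assume "x \<in> M"
      then show "x \<in> ?J" using I_subset by (auto intro!: bexI[of _ x] exI[of _ 0])
    qed
    moreover have "a \<in> ?J"
      using a I_zero by (auto intro!: bexI[OF _ I_zero] exI[of _ 1])
    ultimately show False using max[OF ideal_adjoin[OF M(1) a(1)]] not a by blast
  qed
  have "mv_prime A M"
  proof
    show "\<one> \<notin> M" using I_down[of z \<one>] z M by auto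
    fix x y assume [simp]: "x \<in> carrier A" "y \<in> carrier A"
    show "x \<ominus> y \<in> M \<or> y \<ominus> x \<in> M"
    proof (rule ccontr)
      assume "\<not> ?thesis"
      then obtain p m q n where *: "p \<in> M" "q \<in> M"
        "z \<preceq> p \<oplus> mv_mult m (x \<ominus> y)" "z \<preceq> q \<oplus> mv_mult n (y \<ominus> x)"
        using adjoin[of "x \<ominus> y"] adjoin[of "y \<ominus> x"] by auto
      note [simp] = I_subset[OF *(1)] I_subset[OF *(2)] z(1)
      \<comment> \<open>One element of \<open>M\<close> serves both inequalities. Then
        \<open>z \<ominus> ?r\<close> is below a multiple of each difference, hence zero, so
        \<open>z\<close> lies below a member of \<open>M\<close>.\<close>
      let ?r = "p \<oplus> q"
      have zr: "z \<preceq> ?r \<oplus> mv_mult m (x \<ominus> y)"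
        by (rule le_trans[OF *(3) add_mono[OF le_add]]) simp_all
      have zr': "z \<preceq> ?r \<oplus> mv_mult n (y \<ominus> x)"
        by (rule le_trans[OF *(4) add_mono[OF le_add']]) simp_all
      have "z \<ominus> ?r = \<zero>"
      proof (rule mults_disjoint)
        show "z \<ominus> ?r \<preceq> mv_mult m (x \<ominus> y)" "z \<ominus> ?r \<preceq> mv_mult n (y \<ominus> x)"
          using zr zr' minus_le_iff[of z ?r] by simp_all
        fix t assume "t \<in> carrier A" "t \<preceq> x \<ominus> y" "t \<preceq> y \<ominus> x"
        then show "t = \<zero>" by (rule prelinear[rotated 2]) simp_all
      qed simp_all
      then have "z \<preceq> ?r" using minus_eq_zero_iff[of z ?r] by simp
      then have "z \<in> M" using I_down[of z ?r] I_add *(1,2) by simp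
      then show False using M by simp
    qed
  qed
  then show ?thesis using M by blast
qed

end

section \<open>The quotient by an ideal\<close>

context mv_ideal
begin

definition cong (infix "\<sim>\<sim>" 50) where "x \<sim>\<sim> y \<longleftrightarrow> x \<ominus> y \<in> I \<and> y \<ominus> x \<in> I"

lemma cong_refl: "x \<in> carrier A \<Longrightarrow> x \<sim>\<sim> x"
  using minus_eq_zero_iff[of x x] I_zero by (simp add: cong_def)

lemma cong_sym: "x \<sim>\<sim> y \<Longrightarrow> y \<sim>\<sim> x"
  by (simp add: cong_def)

text \<open>A triangle inequality: \<open>x \<ominus> z\<close> is below the sum of
  \<open>y \<ominus> z\<close> and \<open>x \<ominus> y\<close>.\<close>

lemma minus_trans:
  assumes "x \<ominus> y \<in> I" "y \<ominus> z \<in> I"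
    and [simp]: "x \<in> carrier A" "y \<in> carrier A" "z \<in> carrier A"
  shows "x \<ominus> z \<in> I"
proof (rule I_down)
  show "(y \<ominus> z) \<oplus> (x \<ominus> y) \<in> I" by (rule I_add[OF assms(2,1)])
  have "y \<preceq> z \<oplus> (y \<ominus> z)" using join_ge1[of y z] by (simp add: add_comm)
  then have *: "y \<oplus> (x \<ominus> y) \<preceq> (z \<oplus> (y \<ominus> z)) \<oplus> (x \<ominus> y)" by (rule add_mono) simp_all
  have "x \<preceq> y \<oplus> (x \<ominus> y)" using join_ge1[of x y] by (simp add: add_comm)
  then have "x \<preceq> (z \<oplus> (y \<ominus> z)) \<oplus> (x \<ominus> y)" by (rule le_trans[OF _ *]) simp_all
  then show "x \<ominus> z \<preceq> (y \<ominus> z) \<oplus> (x \<ominus> y)"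
    using minus_le_iff[of x z "(y \<ominus> z) \<oplus> (x \<ominus> y)"] by (simp add: add_assoc)
qed simp

lemma cong_trans:
  "\<lbrakk>x \<sim>\<sim> y; y \<sim>\<sim> z; x \<in> carrier A; y \<in> carrier A; z \<in> carrier A\<rbrakk> \<Longrightarrow> x \<sim>\<sim> z"
  using minus_trans[of x y z] minus_trans[of z y x] by (simp add: cong_def)

lemma cong_neg: "\<lbrakk>x \<sim>\<sim> y; x \<in> carrier A; y \<in> carrier A\<rbrakk> \<Longrightarrow> \<sim> x \<sim>\<sim> \<sim> y"
  using add_comm[of x "\<sim> y"] add_comm[of y "\<sim> x"] by (simp add: cong_def)

lemma minus_add:
  assumes "x \<ominus> y \<in> I" and [simp]: "x \<in> carrier A" "y \<in> carrier A" "z \<in> carrier A"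
  shows "(x \<oplus> z) \<ominus> (y \<oplus> z) \<in> I"
proof (rule I_down[OF _ assms(1)])
  have "x \<preceq> y \<oplus> (x \<ominus> y)" using join_ge1[of x y] by (simp add: add_comm)
  then have "x \<oplus> z \<preceq> (y \<oplus> (x \<ominus> y)) \<oplus> z" by (rule add_mono) simp_all
  also have "(y \<oplus> (x \<ominus> y)) \<oplus> z = (y \<oplus> z) \<oplus> (x \<ominus> y)" by (simp add: add_ac)
  finally show "(x \<oplus> z) \<ominus> (y \<oplus> z) \<preceq> x \<ominus> y"
    using minus_le_iff[of "x \<oplus> z" "y \<oplus> z" "x \<ominus> y"] by simp
qed simp

lemma cong_add1: "\<lbrakk>x \<sim>\<sim> y; x \<in> carrier A; y \<in> carrier A; z \<in> carrier A\<rbrakk> \<Longrightarrow> x \<oplus> z \<sim>\<sim> y \<oplus> z"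
  using minus_add[of x y z] minus_add[of y x z] by (simp add: cong_def)

lemma cong_add:
  assumes "x \<sim>\<sim> x'" "y \<sim>\<sim> y'"
    and [simp]: "x \<in> carrier A" "x' \<in> carrier A" "y \<in> carrier A" "y' \<in> carrier A"
  shows "x \<oplus> y \<sim>\<sim> x' \<oplus> y'"
  using cong_trans[OF cong_add1[OF assms(1), of y] cong_add1[OF assms(2), of x', simplified add_comm[of _ x']]]
  by (simp add: add_comm[of _ x'])

text \<open>Classes are represented by chosen elements, so that the quotient stays on the type \<open>'a\<close>.\<close>

definition rep where "rep x = (SOME y. y \<in> carrier A \<and> x \<sim>\<sim> y)"

lemma rep:
  assumes "x \<in> carrier A"
  shows rep_closed [simp]: "rep x \<in> carrier A" and rep_cong: "x \<sim>\<sim> rep x"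
  using someI[of "\<lambda>y. y \<in> carrier A \<and> x \<sim>\<sim> y" x] assms by (auto simp: rep_def cong_refl)

text \<open>Congruent elements have the same class, so the choice operator is applied to equal
  predicates and picks the same element.\<close>

lemma rep_eq_iff:
  assumes [simp]: "x \<in> carrier A" "y \<in> carrier A"
  shows "rep x = rep y \<longleftrightarrow> x \<sim>\<sim> y"
proof
  assume "rep x = rep y"
  then show "x \<sim>\<sim> y"
    using cong_trans[of x "rep x" y] rep_cong[of x] cong_sym[OF rep_cong[of y]] by simp
next
  assume "x \<sim>\<sim> y"
  then have "x \<sim>\<sim> z \<longleftrightarrow> y \<sim>\<sim> z" if "z \<in> carrier A" for z
    using that cong_trans[of x y z] cong_trans[of y x z] cong_sym[of x y] by auto
  then have "(\<lambda>z. z \<in> carrier A \<and> x \<sim>\<sim> z) = (\<lambda>z. z \<in> carrier A \<and> y \<sim>\<sim> z)" by auto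
  then show "rep x = rep y" by (simp add: rep_def)
qed

lemma rep_add_rep [simp]:
  assumes [simp]: "x \<in> carrier A" "y \<in> carrier A"
  shows "rep (rep x \<oplus> y) = rep (x \<oplus> y)" "rep (x \<oplus> rep y) = rep (x \<oplus> y)"
  by (simp_all add: rep_eq_iff cong_add cong_refl rep_cong cong_sym)

lemma rep_neg_rep [simp]: "x \<in> carrier A \<Longrightarrow> rep (\<sim> rep x) = rep (\<sim> x)"
  and rep_rep [simp]: "x \<in> carrier A \<Longrightarrow> rep (rep x) = rep x"
  by (simp_all add: rep_eq_iff cong_neg rep_cong cong_sym)

definition quotient :: "'a mv_algebra" where
  "quotient = \<lparr>carrier = rep ` carrier A, mv_add = (\<lambda>x y. rep (x \<oplus> y)),
     mv_neg = (\<lambda>x. rep (\<sim> x)), mv_zero = rep \<zero>\<rparr>"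

lemma quotient_simps [simp]:
  "carrier quotient = rep ` carrier A"
  "x \<oplus>\<^bsub>quotient\<^esub> y = rep (x \<oplus> y)"
  "mv_neg quotient x = rep (\<sim> x)"
  "mv_zero quotient = rep \<zero>"
  by (simp_all add: quotient_def)

lemma mem_rep_image: "x \<in> rep ` carrier A \<longleftrightarrow> x \<in> carrier A \<and> rep x = x"
  by (auto intro!: image_eqI[of x rep x])

lemma mv_algebra_quotient: "mv_algebra quotient"
proof (intro mv_algebra.intro mv_algebra_axioms.intro)
  show "comm_monoid (mv_monoid quotient)"
    by (rule comm_monoidI) (simp_all add: mv_monoid_def mem_rep_image add_assoc, simp add: add_comm)
qed (simp_all add: mem_rep_image join_comm)

end

lemma (in mv_prime) quotient_total:
  assumes "x \<in> carrier quotient" "y \<in> carrier quotient"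
  shows "mv_neg quotient x \<oplus>\<^bsub>quotient\<^esub> y = mv_neg quotient (mv_zero quotient) \<or>
    mv_neg quotient y \<oplus>\<^bsub>quotient\<^esub> x = mv_neg quotient (mv_zero quotient)"
proof -
  have *: "rep (\<sim> x \<oplus> y) = rep \<one>" if "x \<ominus> y \<in> P" "x \<in> carrier A" "y \<in> carrier A" for x y
    using that I_zero minus_eq_zero_iff[of "\<sim> x \<oplus> y" \<one>] by (simp add: rep_eq_iff cong_def)
  show ?thesis using assms prime[of x y] *[of x y] *[of y x] by (auto simp: mem_rep_image)
qed

lemma (in mv_prime) quotient_nontrivial: "mv_neg quotient (mv_zero quotient) \<noteq> mv_zero quotient"
  using proper by (simp add: rep_eq_iff cong_def)

section \<open>The lattice-ordered group of an MV-chain\<close>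

lemma lgroupI:
  fixes G :: "'a lu_group" (structure)
  assumes "lattice G"
    and "\<And>x y. \<lbrakk>x \<in> carrier G; y \<in> carrier G\<rbrakk> \<Longrightarrow> x \<boxplus> y \<in> carrier G"
    and "lu_zero G \<in> carrier G"
    and "\<And>x y z. \<lbrakk>x \<in> carrier G; y \<in> carrier G; z \<in> carrier G\<rbrakk>
      \<Longrightarrow> x \<boxplus> y \<boxplus> z = x \<boxplus> (y \<boxplus> z)"
    and "\<And>x y. \<lbrakk>x \<in> carrier G; y \<in> carrier G\<rbrakk> \<Longrightarrow> x \<boxplus> y = y \<boxplus> x"
    and "\<And>x. x \<in> carrier G \<Longrightarrow> lu_zero G \<boxplus> x = x"
    and "\<And>x. x \<in> carrier G \<Longrightarrow> \<exists>y\<in>carrier G. y \<boxplus> x = lu_zero G"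
    and "\<And>x y z. \<lbrakk>x \<in> carrier G; y \<in> carrier G; z \<in> carrier G; x \<sqsubseteq> y\<rbrakk> \<Longrightarrow> z \<boxplus> x \<sqsubseteq> z \<boxplus> y"
    and "lu_unit G \<in> carrier G" and "lu_zero G \<sqsubseteq> lu_unit G"
  shows "lgroup G"
proof (intro lgroup.intro lgroup_axioms.intro)
  show "comm_group (lu_monoid G)"
    by (rule comm_groupI) (use assms in \<open>auto simp: lu_monoid_def\<close>)
qed (use assms in auto)

lemma (in lgroup) neg_eqI: "\<lbrakk>x \<boxplus> y = z; x \<in> carrier G; y \<in> carrier G\<rbrakk> \<Longrightarrow> y = z \<boxminus> x"
  by (metis add_comm add_diff_cancel)

locale mv_chain = mv_algebra +
  assumes total: "\<lbrakk>x \<in> carrier A; y \<in> carrier A\<rbrakk> \<Longrightarrow> x \<preceq> y \<or> y \<preceq> x"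
    and nontrivial: "\<one> \<noteq> \<zero>"
begin

section \<open>Carry arithmetic in an MV-chain\<close>

lemma dot_comm: "\<lbrakk>x \<in> carrier A; y \<in> carrier A\<rbrakk> \<Longrightarrow> x \<odot> y = y \<odot> x"
  by (simp add: add_comm)

lemma dot_assoc:
  "\<lbrakk>x \<in> carrier A; y \<in> carrier A; z \<in> carrier A\<rbrakk> \<Longrightarrow> x \<odot> y \<odot> z = x \<odot> (y \<odot> z)"
  by (simp add: add_assoc)

lemma dot_le: "\<lbrakk>x \<in> carrier A; y \<in> carrier A\<rbrakk> \<Longrightarrow> x \<odot> y \<preceq> x"
  using minus_le[of x "\<sim> y"] by simp

lemma eq_one: "\<lbrakk>\<one> \<preceq> x; x \<in> carrier A\<rbrakk> \<Longrightarrow> x = \<one>"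
  by simp

lemma dot_ne_one: "\<lbrakk>x \<noteq> \<one>; x \<in> carrier A; y \<in> carrier A\<rbrakk> \<Longrightarrow> x \<odot> y \<noteq> \<one>"
  by (rule notI) (metis dot_le eq_one)

lemma dot_mono: "\<lbrakk>x \<preceq> y; x \<in> carrier A; y \<in> carrier A; z \<in> carrier A\<rbrakk> \<Longrightarrow> z \<odot> x \<preceq> z \<odot> y"
  using minus_mono[of x y "\<sim> z"] by (simp add: add_comm[of "\<sim> z"])

text \<open>Totality enters here: if \<open>\<sim> x\<close> is not below \<open>y\<close>, then
  \<open>y\<close> is below \<open>\<sim> x\<close>. So at most one of overflow and nonzero
  remainder of \<open>x\<close> and \<open>y\<close> has to be considered.\<close>

lemma dot_eq_zero_of_ne_one:
  assumes "x \<oplus> y \<noteq> \<one>" and [simp]: "x \<in> carrier A" "y \<in> carrier A"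
  shows "x \<odot> y = \<zero>"
  using total[of "\<sim> x" y] assms(1) minus_eq_zero_iff[of x "\<sim> y"]
  by (simp add: add_comm)

lemma dot_add:
  assumes "x \<oplus> y = \<one>" and [simp]: "x \<in> carrier A" "y \<in> carrier A"
  shows "(x \<odot> y) \<oplus> \<sim> y = x"
  using le_imp_join[of "\<sim> y" x] assms(1) by (simp add: add_comm)

text \<open>After recovering \<open>x\<close> and \<open>z\<close> by \<open>dot_add\<close>, both
  sides are the sum of \<open>x \<odot> y\<close>, \<open>y \<odot> z\<close> and
  \<open>\<sim> y\<close>.\<close>

lemma exchange_carry_carry:
  assumes "x \<oplus> y = \<one>" "y \<oplus> z = \<one>" and [simp]: "x \<in> carrier A" "y \<in> carrier A" "z \<in> carrier A"
  shows "(x \<odot> y) \<oplus> z = x \<oplus> (y \<odot> z)"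
proof -
  define p q where "p = x \<odot> y" and "q = y \<odot> z"
  have [simp]: "p \<in> carrier A" "q \<in> carrier A" by (simp_all add: p_def q_def)
  have "x = p \<oplus> \<sim> y" "z = q \<oplus> \<sim> y"
    using dot_add[of x y] dot_add[of z y] assms by (simp_all add: p_def q_def add_comm)
  then have "p \<oplus> z = x \<oplus> q" by (simp add: add_ac)
  then show ?thesis by (simp add: p_def q_def)
qed

text \<open>The preceding identity for the complements: a sum that does not overflow has zero
  product, which says that the complements do overflow. De Morgan translates back.\<close>

lemma exchange_no_carry:
  assumes "x \<oplus> y \<noteq> \<one>" "y \<oplus> z \<noteq> \<one>" and [simp]: "x \<in> carrier A" "y \<in> carrier A" "z \<in> carrier A"
  shows "(x \<oplus> y) \<odot> z = x \<odot> (y \<oplus> z)"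
proof -
  have "(\<sim> x \<odot> \<sim> y) \<oplus> \<sim> z = \<sim> x \<oplus> (\<sim> y \<odot> \<sim> z)"
    using dot_eq_zero_of_ne_one[OF assms(1)] dot_eq_zero_of_ne_one[OF assms(2)]
    by (intro exchange_carry_carry) (metis neg_neg add_closed neg_closed assms(3-))+
  then show ?thesis by simp
qed

text \<open>With \<open>w\<close> the left side and \<open>d = y \<oplus> z\<close> one finds
  \<open>x = w \<oplus> \<sim> d\<close> and \<open>w \<preceq> d\<close>. Under that bound the
  truncated sum determines \<open>w\<close>, namely as \<open>x \<odot> d\<close>.\<close>

lemma exchange_carry_no_carry:
  assumes "x \<oplus> y = \<one>" "y \<oplus> z \<noteq> \<one>" and [simp]: "x \<in> carrier A" "y \<in> carrier A" "z \<in> carrier A"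
  shows "(x \<odot> y) \<oplus> z = x \<odot> (y \<oplus> z)"
proof -
  define w where "w = (x \<odot> y) \<oplus> z"
  define d where "d = y \<oplus> z"
  have [simp]: "w \<in> carrier A" "d \<in> carrier A" by (simp_all add: w_def d_def)
  have "y \<odot> z = \<zero>" by (rule dot_eq_zero_of_ne_one) (use assms in simp_all)
  then have "\<sim> y \<oplus> \<sim> z = \<one>" by (metis neg_neg add_closed neg_closed assms(4,5))
  then have "\<sim> y = \<sim> d \<oplus> z"
    using dot_add[of "\<sim> y" "\<sim> z"] by (simp add: d_def)
  then have "x = w \<oplus> \<sim> d"
    using dot_add[OF assms(1)] by (simp add: w_def add_ac)
  moreover have "w \<preceq> d" unfolding w_def d_def
    using dot_le[of y x] by (intro add_mono) (simp_all add: dot_comm add_comm)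
  ultimately have "\<sim> w = \<sim> x \<oplus> \<sim> d"
    using le_imp_join[of "\<sim> d" "\<sim> w"] neg_le_iff[of d w] by (simp add: add_comm)
  then have "x \<odot> d = \<sim> (\<sim> w)" by (simp only:)
  then show ?thesis by (simp add: w_def d_def)
qed

text \<open>\<open>(m, a)\<close> stands for \<open>m \<cdot> 1 + a\<close>; the value \<open>a = 1\<close> is excluded because \<open>(m, 1)\<close> would be \<open>(m + 1, 0)\<close>.\<close>

definition chain_group :: "(int \<times> 'a) lu_group" where
  "chain_group = \<lparr>carrier = UNIV \<times> (carrier A - {\<one>}), eq = (=),
     le = (\<lambda>(m, a) (n, b). m < n \<or> m = n \<and> a \<preceq> b),
     lu_add = (\<lambda>(m, a) (n, b). if a \<oplus> b = \<one> then (m + n + 1, a \<odot> b) else (m + n, a \<oplus> b)),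
     lu_zero = (0, \<zero>), lu_unit = (1, \<zero>)\<rparr>"

lemma chain_group_simps [simp]:
  "carrier chain_group = UNIV \<times> (carrier A - {\<one>})"
  "eq chain_group = (=)"
  "(m, a) \<sqsubseteq>\<^bsub>chain_group\<^esub> (n, b) \<longleftrightarrow> m < n \<or> m = n \<and> a \<preceq> b"
  "(m, a) \<boxplus>\<^bsub>chain_group\<^esub> (n, b) = (if a \<oplus> b = \<one> then (m + n + 1, a \<odot> b) else (m + n, a \<oplus> b))"
  "lu_zero chain_group = (0, \<zero>)"
  "lu_unit chain_group = (1, \<zero>)"
  by (simp_all add: chain_group_def)

lemma total_order_chain_group: "total_order chain_group"
proof (unfold_locales)
  fix x y z assume "x \<sqsubseteq>\<^bsub>chain_group\<^esub> y" "y \<sqsubseteq>\<^bsub>chain_group\<^esub> z"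
    "x \<in> carrier chain_group" "y \<in> carrier chain_group" "z \<in> carrier chain_group"
  then show "x \<sqsubseteq>\<^bsub>chain_group\<^esub> z"
    using le_trans[of "snd x" "snd y" "snd z"] by (cases x; cases y; cases z) auto
next
  fix x y assume "x \<in> carrier chain_group" "y \<in> carrier chain_group"
  then show "x \<sqsubseteq>\<^bsub>chain_group\<^esub> y \<or> y \<sqsubseteq>\<^bsub>chain_group\<^esub> x"
    using total[of "snd x" "snd y"] by (cases x; cases y) auto
qed (auto intro: le_antisym)

lemma add_eq_one_mono:
  assumes "c \<oplus> a = \<one>" "a \<preceq> b" and [simp]: "a \<in> carrier A" "b \<in> carrier A" "c \<in> carrier A"
  shows "c \<oplus> b = \<one>"
  using add_mono2[OF assms(2), of c] assms(1) by simp

lemma chain_group_assoc: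
  assumes "a \<in> carrier A" "b \<in> carrier A" "c \<in> carrier A" "a \<noteq> \<one>" "b \<noteq> \<one>" "c \<noteq> \<one>"
  shows "(l, a) \<boxplus>\<^bsub>chain_group\<^esub> (m, b) \<boxplus>\<^bsub>chain_group\<^esub> (n, c) =
    (l, a) \<boxplus>\<^bsub>chain_group\<^esub> ((m, b) \<boxplus>\<^bsub>chain_group\<^esub> (n, c))"
proof -
  note [simp] = assms(1-3)
  consider "a \<oplus> b = \<one>" "b \<oplus> c = \<one>" | "a \<oplus> b = \<one>" "b \<oplus> c \<noteq> \<one>"
    | "a \<oplus> b \<noteq> \<one>" "b \<oplus> c = \<one>" | "a \<oplus> b \<noteq> \<one>" "b \<oplus> c \<noteq> \<one>" by blast
  then show ?thesis
  proof cases
    case 1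
    have "a \<odot> b \<odot> c = a \<odot> (b \<odot> c)" by (rule dot_assoc) simp_all
    then show ?thesis using 1 exchange_carry_carry[OF 1] by simp
  next
    case 2
    have "a \<oplus> (b \<oplus> c) = \<one>" using 2 by (simp flip: add_assoc)
    \<comment> \<open>This rules out a second carry on the left, so both bracketings carry exactly
      once and the integer parts agree.\<close>
    moreover have "a \<odot> (b \<oplus> c) \<noteq> \<one>" by (rule dot_ne_one) (use assms in simp_all)
    ultimately show ?thesis using 2 exchange_carry_no_carry[OF 2] by simp
  next
    case 3
    have ab: "a \<oplus> b \<oplus> c = \<one>" using 3 by (simp add: add_assoc)
    \<comment> \<open>The mirror image of the preceding case, obtained from it by
      commutativity.\<close>
    have "(c \<odot> b) \<oplus> a = c \<odot> (b \<oplus> a)"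
      using 3 by (intro exchange_carry_no_carry) (simp_all add: add_comm)
    then have eq: "a \<oplus> (b \<odot> c) = (a \<oplus> b) \<odot> c"
      by (simp add: add_comm)
    have "c \<odot> (a \<oplus> b) \<noteq> \<one>" by (rule dot_ne_one) (use assms in simp_all)
    then have "(a \<oplus> b) \<odot> c \<noteq> \<one>" by (simp add: dot_comm)
    then show ?thesis using 3 eq ab by simp
  next
    case 4
    then show ?thesis using exchange_no_carry[OF 4] by (simp add: add_assoc)
  qed
qed

lemma chain_group_mono:
  assumes "a \<in> carrier A" "b \<in> carrier A" "c \<in> carrier A" "a \<noteq> \<one>" "b \<noteq> \<one>" "c \<noteq> \<one>"
    and le: "(m, a) \<sqsubseteq>\<^bsub>chain_group\<^esub> (n, b)"
  shows "(k, c) \<boxplus>\<^bsub>chain_group\<^esub> (m, a) \<sqsubseteq>\<^bsub>chain_group\<^esub> (k, c) \<boxplus>\<^bsub>chain_group\<^esub> (n, b)"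
proof (cases "m = n")
  case True
  then show ?thesis
    using assms add_mono2[of a b c] dot_mono[of a b c] add_eq_one_mono[of c a b] by auto
next
  case False
  \<comment> \<open>If \<open>m < n\<close>, the smaller element can catch up in the integer part
    only when it alone carries and \<open>m + 1 = n\<close>; then exactly these second components
    are compared.\<close>
  moreover have "c \<odot> a \<preceq> c \<oplus> b"
    by (rule le_trans[OF dot_le le_add]) (use assms in simp_all)
  ultimately show ?thesis using le by auto
qed

lemma lgroup_chain_group: "lgroup chain_group"
proof (rule lgroupI)
  interpret C: total_order chain_group by (rule total_order_chain_group)
  show "lattice chain_group" by unfold_locales
  fix x y z assume xyz: "x \<in> carrier chain_group" "y \<in> carrier chain_group" "z \<in> carrier chain_group"
  then show "x \<boxplus>\<^bsub>chain_group\<^esub> y \<boxplus>\<^bsub>chain_group\<^esub> z = x \<boxplus>\<^bsub>chain_group\<^esub> (y \<boxplus>\<^bsub>chain_group\<^esub> z)"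
    by (cases x; cases y; cases z) (simp add: chain_group_assoc del: chain_group_simps(4))
  show "z \<boxplus>\<^bsub>chain_group\<^esub> x \<sqsubseteq>\<^bsub>chain_group\<^esub> z \<boxplus>\<^bsub>chain_group\<^esub> y" if "x \<sqsubseteq>\<^bsub>chain_group\<^esub> y"
    using xyz that chain_group_mono[of "snd x" "snd y" "snd z" "fst x" "fst y" "fst z"]
    by (cases x; cases y; cases z) (simp del: chain_group_simps(3,4))
next
  fix x y assume xy: "x \<in> carrier chain_group" "y \<in> carrier chain_group"
  then show "x \<boxplus>\<^bsub>chain_group\<^esub> y = y \<boxplus>\<^bsub>chain_group\<^esub> x"
    by (cases x; cases y) (simp add: add_comm)
  show "x \<boxplus>\<^bsub>chain_group\<^esub> y \<in> carrier chain_group"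
    using xy dot_ne_one[of "snd x" "snd y"] by (cases x; cases y) auto
next
  fix x assume x: "x \<in> carrier chain_group"
  then show "lu_zero chain_group \<boxplus>\<^bsub>chain_group\<^esub> x = x" by (cases x) auto
  obtain m a where *: "x = (m, a)" "a \<in> carrier A" "a \<noteq> \<one>" using x by (cases x) auto
  \<comment> \<open>Adding \<open>\<sim> a\<close> to \<open>a\<close> overflows and raises the
    integer part by one, hence \<open>- m - 1\<close>. For \<open>a = 0\<close> the complement would
    be the excluded value \<open>1\<close>, so that case needs its own witness.\<close>
  show "\<exists>y\<in>carrier chain_group. y \<boxplus>\<^bsub>chain_group\<^esub> x = lu_zero chain_group"
  proof (cases "a = \<zero>")
    case True
    then show ?thesis using * nontrivial by (intro bexI[of _ "(- m, \<zero>)"]) auto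
  next
    case False
    then have "\<sim> a \<noteq> \<one>" using *(2) neg_neg[of a] neg_neg[of \<zero>] zero_closed by metis
    then show ?thesis using * by (intro bexI[of _ "(- m - 1, \<sim> a)"]) auto
  qed
qed (use nontrivial in auto)

section \<open>The chain as the unit interval of its group\<close>

definition chain_emb :: "'a \<Rightarrow> int \<times> 'a" where
  "chain_emb a = (if a = \<one> then (1, \<zero>) else (0, a))"

lemma chain_emb_interval:
  "a \<in> carrier A \<Longrightarrow> chain_emb a \<in> \<lbrace>lu_zero chain_group..lu_unit chain_group\<rbrace>\<^bsub>chain_group\<^esub>"
  using nontrivial by (auto simp: chain_emb_def at_least_at_most_def)

lemma inj_chain_emb: "chain_emb a = chain_emb b \<Longrightarrow> a = b"
  by (auto simp: chain_emb_def split: if_splits)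

lemma chain_emb_zero: "chain_emb \<zero> = lu_zero chain_group"
  using nontrivial by (auto simp: chain_emb_def)

lemma chain_emb_add:
  assumes [simp]: "a \<in> carrier A" "b \<in> carrier A"
  shows "chain_emb (a \<oplus> b) =
    (chain_emb a \<boxplus>\<^bsub>chain_group\<^esub> chain_emb b) \<sqinter>\<^bsub>chain_group\<^esub> lu_unit chain_group"
proof -
  interpret C: lgroup chain_group by (rule lgroup_chain_group)
  have clo: "chain_emb x \<in> carrier chain_group" if "x \<in> carrier A" for x
    using that nontrivial by (auto simp: chain_emb_def)
  show ?thesis
  proof (cases "a \<oplus> b = \<one>")
    case True
    then have "lu_unit chain_group \<sqsubseteq>\<^bsub>chain_group\<^esub> chain_emb a \<boxplus>\<^bsub>chain_group\<^esub> chain_emb b"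
      by (auto simp: chain_emb_def)
    moreover have "chain_emb (a \<oplus> b) = lu_unit chain_group" using True by (simp add: chain_emb_def)
    ultimately show ?thesis using clo by (simp add: C.meet_absorb2 del: chain_group_simps)
  next
    case False
    then have "a \<noteq> \<one>" "b \<noteq> \<one>" by auto
    then have "chain_emb a \<boxplus>\<^bsub>chain_group\<^esub> chain_emb b = chain_emb (a \<oplus> b)"
      using False by (auto simp: chain_emb_def)
    moreover have "chain_emb (a \<oplus> b) \<sqsubseteq>\<^bsub>chain_group\<^esub> lu_unit chain_group"
      using False by (auto simp: chain_emb_def)
    ultimately show ?thesis using clo by (simp add: C.meet_absorb1 del: chain_group_simps)
  qed
qed

lemma chain_emb_neg:
  assumes [simp]: "a \<in> carrier A"
  shows "chain_emb (\<sim> a) =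
    lu_unit chain_group \<boxplus>\<^bsub>chain_group\<^esub> lu_neg chain_group (chain_emb a)"
proof -
  interpret C: lgroup chain_group by (rule lgroup_chain_group)
  have "\<sim> a = \<one> \<longleftrightarrow> a = \<zero>" by (metis assms neg_neg zero_closed)
  then have "chain_emb a \<boxplus>\<^bsub>chain_group\<^esub> chain_emb (\<sim> a) = lu_unit chain_group"
    using nontrivial by (auto simp: chain_emb_def)
  then show ?thesis
    using chain_emb_interval[of a] chain_emb_interval[of "\<sim> a"]
    by (intro C.neg_eqI) (auto simp: at_least_at_most_def simp del: chain_group_simps)
qed

end

section \<open>Products\<close>

lemma latticeI:
  fixes G (structure)
  assumes "partial_order G"
    and "\<And>x y. \<lbrakk>x \<in> carrier G; y \<in> carrier G\<rbrakk> \<Longrightarrow>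
      \<exists>s\<in>carrier G. x \<sqsubseteq> s \<and> y \<sqsubseteq> s \<and> (\<forall>z\<in>carrier G. x \<sqsubseteq> z \<and> y \<sqsubseteq> z \<longrightarrow> s \<sqsubseteq> z)"
    and "\<And>x y. \<lbrakk>x \<in> carrier G; y \<in> carrier G\<rbrakk> \<Longrightarrow>
      \<exists>s\<in>carrier G. s \<sqsubseteq> x \<and> s \<sqsubseteq> y \<and> (\<forall>z\<in>carrier G. z \<sqsubseteq> x \<and> z \<sqsubseteq> y \<longrightarrow> z \<sqsubseteq> s)"
  shows "lattice G"
proof -
  interpret partial_order G by fact
  show ?thesis
  proof
    fix x y assume xy: "x \<in> carrier G" "y \<in> carrier G"
    show "\<exists>s. least G s (Upper G {x, y})"
      using assms(2)[OF xy] xy by (auto simp: least_def Upper_def)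
    show "\<exists>s. greatest G s (Lower G {x, y})"
      using assms(3)[OF xy] xy by (auto simp: greatest_def Lower_def)
  qed
qed

definition prod_lgroup :: "'i set \<Rightarrow> ('i \<Rightarrow> 'b lu_group) \<Rightarrow> ('i \<Rightarrow> 'b) lu_group" where
  "prod_lgroup I L = \<lparr>carrier = (\<Pi>\<^sub>E i\<in>I. carrier (L i)), eq = (=),
     le = (\<lambda>x y. \<forall>i\<in>I. x i \<sqsubseteq>\<^bsub>L i\<^esub> y i),
     lu_add = (\<lambda>x y. \<lambda>i\<in>I. x i \<boxplus>\<^bsub>L i\<^esub> y i),
     lu_zero = (\<lambda>i\<in>I. lu_zero (L i)), lu_unit = (\<lambda>i\<in>I. lu_unit (L i))\<rparr>"

lemma prod_lgroup_simps [simp]: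
  "carrier (prod_lgroup I L) = (\<Pi>\<^sub>E i\<in>I. carrier (L i))"
  "eq (prod_lgroup I L) = (=)"
  "x \<sqsubseteq>\<^bsub>prod_lgroup I L\<^esub> y \<longleftrightarrow> (\<forall>i\<in>I. x i \<sqsubseteq>\<^bsub>L i\<^esub> y i)"
  "x \<boxplus>\<^bsub>prod_lgroup I L\<^esub> y = (\<lambda>i\<in>I. x i \<boxplus>\<^bsub>L i\<^esub> y i)"
  "lu_zero (prod_lgroup I L) = (\<lambda>i\<in>I. lu_zero (L i))"
  "lu_unit (prod_lgroup I L) = (\<lambda>i\<in>I. lu_unit (L i))"
  by (simp_all add: prod_lgroup_def)

locale lgroup_family =
  fixes I :: "'i set" and L :: "'i \<Rightarrow> 'b lu_group"
  assumes lgroup: "i \<in> I \<Longrightarrow> lgroup (L i)"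
begin

abbreviation P where "P \<equiv> prod_lgroup I L"

lemma component_closed: "\<lbrakk>x \<in> carrier P; i \<in> I\<rbrakk> \<Longrightarrow> x i \<in> carrier (L i)"
  by auto

lemma eqI: "\<lbrakk>x \<in> carrier P; y \<in> carrier P; \<And>i. i \<in> I \<Longrightarrow> x i = y i\<rbrakk> \<Longrightarrow> x = y"
  by (auto intro: PiE_ext)

lemma partial_order_prod: "partial_order P"
proof -
  have po: "partial_order (L i)" if "i \<in> I" for i
  proof -
    interpret Li: lgroup "L i" by (rule lgroup[OF that])
    show ?thesis by unfold_locales
  qed
  show ?thesis
  proof
    fix x assume "x \<in> carrier P"
    then show "x \<sqsubseteq>\<^bsub>P\<^esub> x"
      using weak_partial_order.le_refl[OF partial_order.axioms(1)[OF po]] by auto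
  next
    fix x y assume "x \<sqsubseteq>\<^bsub>P\<^esub> y" "y \<sqsubseteq>\<^bsub>P\<^esub> x" "x \<in> carrier P" "y \<in> carrier P"
    then have "x = y" using partial_order.le_antisym[OF po] by (intro eqI) (auto simp: PiE_iff)
    then show "x .=\<^bsub>P\<^esub> y" by simp
  next
    fix x y z assume "x \<sqsubseteq>\<^bsub>P\<^esub> y" "y \<sqsubseteq>\<^bsub>P\<^esub> z" "x \<in> carrier P" "y \<in> carrier P" "z \<in> carrier P"
    then show "x \<sqsubseteq>\<^bsub>P\<^esub> z"
      using weak_partial_order.le_trans[OF partial_order.axioms(1)[OF po]]
      by (simp add: PiE_iff) blast
  qed auto
qed

definition joins where "joins x y = (\<lambda>i\<in>I. x i \<squnion>\<^bsub>L i\<^esub> y i)"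
definition meets where "meets x y = (\<lambda>i\<in>I. x i \<sqinter>\<^bsub>L i\<^esub> y i)"
definition negs where "negs x = (\<lambda>i\<in>I. lu_neg (L i) (x i))"

lemma joins:
  assumes xy: "x \<in> carrier P" "y \<in> carrier P"
  shows "joins x y \<in> carrier P" "x \<sqsubseteq>\<^bsub>P\<^esub> joins x y" "y \<sqsubseteq>\<^bsub>P\<^esub> joins x y"
    "\<lbrakk>z \<in> carrier P; x \<sqsubseteq>\<^bsub>P\<^esub> z; y \<sqsubseteq>\<^bsub>P\<^esub> z\<rbrakk> \<Longrightarrow> joins x y \<sqsubseteq>\<^bsub>P\<^esub> z"
proof -
  have *: "x i \<squnion>\<^bsub>L i\<^esub> y i \<in> carrier (L i) \<and> x i \<sqsubseteq>\<^bsub>L i\<^esub> x i \<squnion>\<^bsub>L i\<^esub> y i \<and> y i \<sqsubseteq>\<^bsub>L i\<^esub> x i \<squnion>\<^bsub>L i\<^esub> y i \<and>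
    (\<forall>z\<in>carrier (L i). x i \<sqsubseteq>\<^bsub>L i\<^esub> z \<and> y i \<sqsubseteq>\<^bsub>L i\<^esub> z \<longrightarrow> x i \<squnion>\<^bsub>L i\<^esub> y i \<sqsubseteq>\<^bsub>L i\<^esub> z)" if i: "i \<in> I" for i
  proof -
    interpret Li: lgroup "L i" by (rule lgroup[OF i])
    show ?thesis
      using component_closed[OF xy(1) i] component_closed[OF xy(2) i]
      by (simp add: Li.join_left Li.join_right Li.join_le)
  qed
  then show "joins x y \<in> carrier P" "x \<sqsubseteq>\<^bsub>P\<^esub> joins x y" "y \<sqsubseteq>\<^bsub>P\<^esub> joins x y"
    "\<lbrakk>z \<in> carrier P; x \<sqsubseteq>\<^bsub>P\<^esub> z; y \<sqsubseteq>\<^bsub>P\<^esub> z\<rbrakk> \<Longrightarrow> joins x y \<sqsubseteq>\<^bsub>P\<^esub> z"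
    using component_closed[of z] unfolding joins_def by auto
qed

lemma meets:
  assumes xy: "x \<in> carrier P" "y \<in> carrier P"
  shows "meets x y \<in> carrier P" "meets x y \<sqsubseteq>\<^bsub>P\<^esub> x" "meets x y \<sqsubseteq>\<^bsub>P\<^esub> y"
    "\<lbrakk>z \<in> carrier P; z \<sqsubseteq>\<^bsub>P\<^esub> x; z \<sqsubseteq>\<^bsub>P\<^esub> y\<rbrakk> \<Longrightarrow> z \<sqsubseteq>\<^bsub>P\<^esub> meets x y"
proof -
  have *: "x i \<sqinter>\<^bsub>L i\<^esub> y i \<in> carrier (L i) \<and> x i \<sqinter>\<^bsub>L i\<^esub> y i \<sqsubseteq>\<^bsub>L i\<^esub> x i \<and> x i \<sqinter>\<^bsub>L i\<^esub> y i \<sqsubseteq>\<^bsub>L i\<^esub> y i \<and>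
    (\<forall>z\<in>carrier (L i). z \<sqsubseteq>\<^bsub>L i\<^esub> x i \<and> z \<sqsubseteq>\<^bsub>L i\<^esub> y i \<longrightarrow> z \<sqsubseteq>\<^bsub>L i\<^esub> x i \<sqinter>\<^bsub>L i\<^esub> y i)" if i: "i \<in> I" for i
  proof -
    interpret Li: lgroup "L i" by (rule lgroup[OF i])
    show ?thesis
      using component_closed[OF xy(1) i] component_closed[OF xy(2) i]
      by (simp add: Li.meet_left Li.meet_right Li.meet_le)
  qed
  then show "meets x y \<in> carrier P" "meets x y \<sqsubseteq>\<^bsub>P\<^esub> x" "meets x y \<sqsubseteq>\<^bsub>P\<^esub> y"
    "\<lbrakk>z \<in> carrier P; z \<sqsubseteq>\<^bsub>P\<^esub> x; z \<sqsubseteq>\<^bsub>P\<^esub> y\<rbrakk> \<Longrightarrow> z \<sqsubseteq>\<^bsub>P\<^esub> meets x y"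
    using component_closed[of z] unfolding meets_def by auto
qed

lemma negs: "x \<in> carrier P \<Longrightarrow> negs x \<in> carrier P"
  "x \<in> carrier P \<Longrightarrow> negs x \<boxplus>\<^bsub>P\<^esub> x = lu_zero P"
  using lgroup.neg_closed[OF lgroup] lgroup.neg_add[OF lgroup]
  by (auto simp: negs_def PiE_iff intro!: restrict_ext)

sublocale prod: lgroup P
proof (rule lgroupI)
  show "lattice P"
  proof (rule latticeI[OF partial_order_prod])
    fix x y assume xy: "x \<in> carrier P" "y \<in> carrier P"
    show "\<exists>s\<in>carrier P. x \<sqsubseteq>\<^bsub>P\<^esub> s \<and> y \<sqsubseteq>\<^bsub>P\<^esub> s \<and>
        (\<forall>z\<in>carrier P. x \<sqsubseteq>\<^bsub>P\<^esub> z \<and> y \<sqsubseteq>\<^bsub>P\<^esub> z \<longrightarrow> s \<sqsubseteq>\<^bsub>P\<^esub> z)"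
      using joins[OF xy] by (intro bexI[of _ "joins x y"]) (simp_all del: prod_lgroup_simps)
    show "\<exists>s\<in>carrier P. s \<sqsubseteq>\<^bsub>P\<^esub> x \<and> s \<sqsubseteq>\<^bsub>P\<^esub> y \<and>
        (\<forall>z\<in>carrier P. z \<sqsubseteq>\<^bsub>P\<^esub> x \<and> z \<sqsubseteq>\<^bsub>P\<^esub> y \<longrightarrow> z \<sqsubseteq>\<^bsub>P\<^esub> s)"
      using meets[OF xy] by (intro bexI[of _ "meets x y"]) (simp_all del: prod_lgroup_simps)
  qed
  fix x assume x: "x \<in> carrier P"
  then show "\<exists>y\<in>carrier P. y \<boxplus>\<^bsub>P\<^esub> x = lu_zero P" using negs by blast
  show "lu_zero P \<boxplus>\<^bsub>P\<^esub> x = x"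
    by (rule eqI) (use x lgroup.zero_add[OF lgroup] lgroup.zero_closed[OF lgroup]
        lgroup.add_closed[OF lgroup] in \<open>auto simp: PiE_iff\<close>)
  fix y assume y: "y \<in> carrier P"
  show "x \<boxplus>\<^bsub>P\<^esub> y \<in> carrier P" using x y lgroup.add_closed[OF lgroup] by (auto simp: PiE_iff)
  show "x \<boxplus>\<^bsub>P\<^esub> y = y \<boxplus>\<^bsub>P\<^esub> x"
    using x y lgroup.add_comm[OF lgroup] by (auto simp: PiE_iff intro!: restrict_ext)
  fix z assume z: "z \<in> carrier P"
  show "x \<boxplus>\<^bsub>P\<^esub> y \<boxplus>\<^bsub>P\<^esub> z = x \<boxplus>\<^bsub>P\<^esub> (y \<boxplus>\<^bsub>P\<^esub> z)"
    using x y z lgroup.add_assoc[OF lgroup] by (auto simp: PiE_iff intro!: restrict_ext)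
  show "z \<boxplus>\<^bsub>P\<^esub> x \<sqsubseteq>\<^bsub>P\<^esub> z \<boxplus>\<^bsub>P\<^esub> y" if "x \<sqsubseteq>\<^bsub>P\<^esub> y"
    using x y z that lgroup.add_left_mono[OF lgroup] by (auto simp: PiE_iff)
qed (use lgroup.zero_closed[OF lgroup] lgroup.unit_closed[OF lgroup]
    lgroup.unit_nonneg[OF lgroup] in auto)

lemma prod_meet:
  assumes "x \<in> carrier P" "y \<in> carrier P"
  shows "x \<sqinter>\<^bsub>P\<^esub> y = (\<lambda>i\<in>I. x i \<sqinter>\<^bsub>L i\<^esub> y i)"
  using prod.meetI_eq[of "meets x y" x y] meets[OF assms] assms by (metis meets_def)

lemma prod_join:
  assumes "x \<in> carrier P" "y \<in> carrier P"
  shows "x \<squnion>\<^bsub>P\<^esub> y = (\<lambda>i\<in>I. x i \<squnion>\<^bsub>L i\<^esub> y i)"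
  using prod.joinI_eq[of x "joins x y" y] joins[OF assms] assms by (metis joins_def)

lemma prod_neg:
  assumes x: "x \<in> carrier P"
  shows "lu_neg P x = (\<lambda>i\<in>I. lu_neg (L i) (x i))"
proof -
  have "negs x \<boxplus>\<^bsub>P\<^esub> x = lu_neg P x \<boxplus>\<^bsub>P\<^esub> x"
    using negs(2)[OF x] prod.neg_add[OF x] by simp
  then have "negs x = lu_neg P x"
    using prod.add_diff_cancel[OF negs(1)[OF x] x] prod.add_diff_cancel[OF prod.neg_closed[OF x] x]
    by simp
  then show ?thesis by (simp add: negs_def)
qed

end

section \<open>Embedding an MV-algebra into a lattice-ordered group\<close>

text \<open>Despite the name, an MV-homomorphism into the unit interval of \<open>L\<close>, without
  injectivity: the components at single primes need not be injective. It is spelled out by equations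
  because \<open>mv_hom\<close> relates algebras over one type only, while \<open>L\<close> lives
  over another.\<close>

definition mv_embedding :: "'a mv_algebra \<Rightarrow> 'b lu_group \<Rightarrow> ('a \<Rightarrow> 'b) \<Rightarrow> bool" where
  "mv_embedding A L f \<longleftrightarrow> lgroup L \<and>
     (\<forall>a\<in>carrier A. f a \<in> \<lbrace>lu_zero L..lu_unit L\<rbrace>\<^bsub>L\<^esub>) \<and> f (mv_zero A) = lu_zero L \<and>
     (\<forall>a\<in>carrier A. f (mv_neg A a) = lu_unit L \<boxplus>\<^bsub>L\<^esub> lu_neg L (f a)) \<and>
     (\<forall>a\<in>carrier A. \<forall>b\<in>carrier A. f (a \<oplus>\<^bsub>A\<^esub> b) = (f a \<boxplus>\<^bsub>L\<^esub> f b) \<sqinter>\<^bsub>L\<^esub> lu_unit L)"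

lemma mv_embedding_prod:
  assumes emb: "\<And>i. i \<in> I \<Longrightarrow> mv_embedding A (L i) (f i)" and "mv_algebra A"
  shows "mv_embedding A (prod_lgroup I L) (\<lambda>a. \<lambda>i\<in>I. f i a)"
proof -
  interpret mv_algebra A by fact
  interpret lgroup_family I L by (rule lgroup_family.intro) (use emb in \<open>simp add: mv_embedding_def\<close>)
  have clo: "f i a \<in> carrier (L i)" if "a \<in> carrier A" "i \<in> I" for a i
    using emb[OF that(2)] that(1) by (auto simp: mv_embedding_def at_least_at_most_def)
  then have cloP: "(\<lambda>i\<in>I. f i a) \<in> carrier P" if "a \<in> carrier A" for a using that by auto
  show ?thesis
    unfolding mv_embedding_def
  proof (intro conjI ballI)
    show "lgroup P" by unfold_locales
    fix a assume a: "a \<in> carrier A"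
    show "(\<lambda>i\<in>I. f i a) \<in> \<lbrace>lu_zero P..lu_unit P\<rbrace>\<^bsub>P\<^esub>"
      using emb a by (auto simp: mv_embedding_def at_least_at_most_def)
    show "(\<lambda>i\<in>I. f i (mv_neg A a)) = lu_unit P \<boxplus>\<^bsub>P\<^esub> lu_neg P (\<lambda>i\<in>I. f i a)"
      using emb a by (subst prod_neg[OF cloP[OF a]]) (auto simp: mv_embedding_def intro!: restrict_ext)
    fix b assume b: "b \<in> carrier A"
    have "(\<lambda>i\<in>I. f i a) \<boxplus>\<^bsub>P\<^esub> (\<lambda>i\<in>I. f i b) \<in> carrier P"
      using cloP[OF a] cloP[OF b] by (rule prod.add_closed)
    then show "(\<lambda>i\<in>I. f i (a \<oplus>\<^bsub>A\<^esub> b)) =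
        ((\<lambda>i\<in>I. f i a) \<boxplus>\<^bsub>P\<^esub> (\<lambda>i\<in>I. f i b)) \<sqinter>\<^bsub>P\<^esub> lu_unit P"
      using emb a b prod.unit_closed
      by (subst prod_meet) (auto simp: mv_embedding_def intro!: restrict_ext)
  qed (use emb in \<open>auto simp: mv_embedding_def intro!: restrict_ext\<close>)
qed

lemma (in mv_prime) mv_embedding_quotient:
  "mv_embedding A (mv_chain.chain_group quotient) (\<lambda>a. mv_chain.chain_emb quotient (rep a))"
proof -
  interpret Q: mv_chain quotient
    using mv_algebra_quotient quotient_total quotient_nontrivial
    by (intro mv_chain.intro mv_chain_axioms.intro)
  show ?thesis
    unfolding mv_embedding_def
  proof (intro conjI ballI)
    fix a assume a: "a \<in> carrier A"
    have "rep (\<sim> a) = mv_neg quotient (rep a)" using a by simp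
    then show "Q.chain_emb (rep (\<sim> a)) =
        lu_unit Q.chain_group \<boxplus>\<^bsub>Q.chain_group\<^esub> lu_neg Q.chain_group (Q.chain_emb (rep a))"
      using a Q.chain_emb_neg[of "rep a"] by simp
    fix b assume b: "b \<in> carrier A"
    have "rep (a \<oplus> b) = rep a \<oplus>\<^bsub>quotient\<^esub> rep b" using a b by simp
    then show "Q.chain_emb (rep (a \<oplus> b)) =
        (Q.chain_emb (rep a) \<boxplus>\<^bsub>Q.chain_group\<^esub> Q.chain_emb (rep b)) \<sqinter>\<^bsub>Q.chain_group\<^esub> lu_unit Q.chain_group"
      using a b Q.chain_emb_add[of "rep a" "rep b"] by simp
  qed (use Q.lgroup_chain_group Q.chain_emb_interval Q.chain_emb_zero in auto)
qed

lemma (in mv_prime) inj_chain_emb_rep: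
  assumes "mv_chain.chain_emb quotient (rep a) = mv_chain.chain_emb quotient (rep b)"
    and "a \<in> carrier A" "b \<in> carrier A"
  shows "a \<ominus> b \<in> P"
proof -
  interpret Q: mv_chain quotient
    using mv_algebra_quotient quotient_total quotient_nontrivial
    by (intro mv_chain.intro mv_chain_axioms.intro)
  have "rep a = rep b" using assms(1) by (rule Q.inj_chain_emb)
  then show ?thesis using assms(2,3) by (simp add: rep_eq_iff cong_def)
qed

text \<open>If \<open>a\<close> and \<open>b\<close> agree in every component, both of their
  differences lie in every prime ideal and hence vanish by \<open>exists_prime\<close>. The
  one-element algebra has no prime ideal and is sent to the empty product.\<close>

theorem mv_embedding_exists:
  fixes A :: "'a mv_algebra"
  assumes "mv_algebra A"
  shows "\<exists>(L :: ('a set \<Rightarrow> int \<times> 'a) lu_group) f. mv_embedding A L f \<and> inj_on f (carrier A)"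
proof -
  interpret mv_algebra A by fact
  let ?I = "{P. mv_prime A P}"
  let ?L = "\<lambda>P. mv_chain.chain_group (mv_ideal.quotient A P)"
  let ?f = "\<lambda>P a. mv_chain.chain_emb (mv_ideal.quotient A P) (mv_ideal.rep A P a)"
  have "mv_embedding A (prod_lgroup ?I ?L) (\<lambda>a. \<lambda>P\<in>?I. ?f P a)"
    by (rule mv_embedding_prod) (auto intro: mv_prime.mv_embedding_quotient assms)
  moreover have "inj_on (\<lambda>a. \<lambda>P\<in>?I. ?f P a) (carrier A)"
  proof (rule inj_onI)
    fix a b assume a: "a \<in> carrier A" and b: "b \<in> carrier A"
      and eq: "(\<lambda>P\<in>?I. ?f P a) = (\<lambda>P\<in>?I. ?f P b)"
    have f: "?f P a = ?f P b" if "mv_prime A P" for P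
      using fun_cong[OF eq, of P] that by simp
    have *: "a \<ominus> b \<in> P \<and> b \<ominus> a \<in> P" if P: "mv_prime A P" for P
      using mv_prime.inj_chain_emb_rep[OF P f[OF P] a b]
        mv_prime.inj_chain_emb_rep[OF P f[OF P, symmetric] b a] by simp
    have "a \<ominus> b = \<zero>" "b \<ominus> a = \<zero>"
      using exists_prime[of "a \<ominus> b"] exists_prime[of "b \<ominus> a"] * a b by auto
    then have "a \<preceq> b" "b \<preceq> a" using a b minus_eq_zero_iff by blast+
    then show "a = b" using a b by (rule le_antisym)
  qed
  ultimately show ?thesis by blast
qed

lemma sub_mv_image:
  assumes "mv_algebra A" and emb: "mv_embedding A L f"
  shows "sub_mv L (f ` carrier A)"
proof -
  interpret mv_algebra A by fact
  from emb have f: "f a \<in> \<lbrace>lu_zero L..lu_unit L\<rbrace>\<^bsub>L\<^esub>" "f \<zero> = lu_zero L"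
      "f (\<sim> a) = lu_unit L \<boxplus>\<^bsub>L\<^esub> lu_neg L (f a)"
      "f (a \<oplus>\<^bsub>A\<^esub> b) = (f a \<boxplus>\<^bsub>L\<^esub> f b) \<sqinter>\<^bsub>L\<^esub> lu_unit L"
    if "a \<in> carrier A" "b \<in> carrier A" for a b
    using that by (simp_all add: mv_embedding_def)
  show ?thesis
    unfolding sub_mv_def
  proof (intro conjI ballI)
    show "f ` carrier A \<subseteq> \<lbrace>lu_zero L..lu_unit L\<rbrace>\<^bsub>L\<^esub>" using f(1) by blast
    show "lu_zero L \<in> f ` carrier A" using f(2)[OF zero_closed zero_closed] by (intro image_eqI[of _ _ \<zero>]) simp_all
    fix x assume "x \<in> f ` carrier A"
    then obtain a where a: "a \<in> carrier A" "x = f a" by blast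
    then show "lu_unit L \<boxplus>\<^bsub>L\<^esub> lu_neg L x \<in> f ` carrier A"
      using f(3) by (intro image_eqI[of _ _ "\<sim> a"]) simp_all
    fix y assume "y \<in> f ` carrier A"
    then obtain b where "b \<in> carrier A" "y = f b" by blast
    then show "(x \<boxplus>\<^bsub>L\<^esub> y) \<sqinter>\<^bsub>L\<^esub> lu_unit L \<in> f ` carrier A"
      using a f(4) by (intro image_eqI[of _ _ "a \<oplus>\<^bsub>A\<^esub> b"]) simp_all
  qed
qed

text \<open>Objects of the categories must have their carrier in the fixed universe, but the
  generated group sits inside a product over another type. Its structure is therefore moved along a
  bijection with a set \<open>K\<close> in the universe.\<close>

locale pullback = sub_mv_lgroup G A for G :: "'b lu_group" (structure) and A +
  fixes K :: "'a set" and \<psi> :: "'a \<Rightarrow> 'b"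
  assumes bij: "bij_betw \<psi> K (span G A)"
begin

abbreviation \<phi> where "\<phi> \<equiv> inv_into K \<psi>"

lemma psi_span: "x \<in> K \<Longrightarrow> \<psi> x \<in> span G A"
  and psi_carrier [simp]: "x \<in> K \<Longrightarrow> \<psi> x \<in> carrier G"
  and phi_closed [simp]: "y \<in> span G A \<Longrightarrow> \<phi> y \<in> K"
  and psi_phi [simp]: "y \<in> span G A \<Longrightarrow> \<psi> (\<phi> y) = y"
  and phi_psi [simp]: "x \<in> K \<Longrightarrow> \<phi> (\<psi> x) = x"
  and psi_inj: "\<lbrakk>\<psi> x = \<psi> x'; x \<in> K; x' \<in> K\<rbrakk> \<Longrightarrow> x = x'"
  using bij span_carrier
  by (auto simp: bij_betw_def inj_on_eq_iff inv_into_into f_inv_into_f)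

lemmas span_simps [simp] = psi_span span_zero span_unit span_add span_neg span_join span_meet

definition pull :: "'a lu_group" where
  "pull = \<lparr>carrier = K, eq = (=), le = (\<lambda>x y. \<psi> x \<sqsubseteq> \<psi> y),
     lu_add = (\<lambda>x y. \<phi> (\<psi> x \<boxplus> \<psi> y)), lu_zero = \<phi> \<zero>, lu_unit = \<phi> \<u>\<rparr>"

lemma pull_simps [simp]:
  "carrier pull = K" "eq pull = (=)" "x \<sqsubseteq>\<^bsub>pull\<^esub> y \<longleftrightarrow> \<psi> x \<sqsubseteq> \<psi> y"
  "x \<boxplus>\<^bsub>pull\<^esub> y = \<phi> (\<psi> x \<boxplus> \<psi> y)" "lu_zero pull = \<phi> \<zero>" "lu_unit pull = \<phi> \<u>"
  by (simp_all add: pull_def)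

lemma partial_order_pull: "partial_order pull"
proof
  fix x y assume "x \<sqsubseteq>\<^bsub>pull\<^esub> y" "y \<sqsubseteq>\<^bsub>pull\<^esub> x" "x \<in> carrier pull" "y \<in> carrier pull"
  then show "x .=\<^bsub>pull\<^esub> y" using psi_inj le_antisym[of "\<psi> x" "\<psi> y"] by simp
next
  fix x y z assume "x \<sqsubseteq>\<^bsub>pull\<^esub> y" "y \<sqsubseteq>\<^bsub>pull\<^esub> z" "x \<in> carrier pull" "y \<in> carrier pull" "z \<in> carrier pull"
  then show "x \<sqsubseteq>\<^bsub>pull\<^esub> z" using le_trans[of "\<psi> x" "\<psi> y" "\<psi> z"] by simp
qed auto

lemma lgroup_pull: "lgroup pull"
proof (rule lgroupI)
  show "lattice pull"
  proof (rule latticeI[OF partial_order_pull])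
    fix x y assume xy: "x \<in> carrier pull" "y \<in> carrier pull"
    then show "\<exists>s\<in>carrier pull. x \<sqsubseteq>\<^bsub>pull\<^esub> s \<and> y \<sqsubseteq>\<^bsub>pull\<^esub> s \<and>
        (\<forall>z\<in>carrier pull. x \<sqsubseteq>\<^bsub>pull\<^esub> z \<and> y \<sqsubseteq>\<^bsub>pull\<^esub> z \<longrightarrow> s \<sqsubseteq>\<^bsub>pull\<^esub> z)"
      by (intro bexI[of _ "\<phi> (\<psi> x \<squnion> \<psi> y)"]) (simp_all add: join_left join_right join_le)
    show "\<exists>s\<in>carrier pull. s \<sqsubseteq>\<^bsub>pull\<^esub> x \<and> s \<sqsubseteq>\<^bsub>pull\<^esub> y \<and>
        (\<forall>z\<in>carrier pull. z \<sqsubseteq>\<^bsub>pull\<^esub> x \<and> z \<sqsubseteq>\<^bsub>pull\<^esub> y \<longrightarrow> z \<sqsubseteq>\<^bsub>pull\<^esub> s)"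
      using xy by (intro bexI[of _ "\<phi> (\<psi> x \<sqinter> \<psi> y)"]) (simp_all add: meet_left meet_right meet_le)
  qed
  fix x assume x: "x \<in> carrier pull"
  then show "\<exists>y\<in>carrier pull. y \<boxplus>\<^bsub>pull\<^esub> x = lu_zero pull"
    by (intro bexI[of _ "\<phi> (lu_neg G (\<psi> x))"]) simp_all
  fix y assume y: "y \<in> carrier pull"
  show "x \<boxplus>\<^bsub>pull\<^esub> y = y \<boxplus>\<^bsub>pull\<^esub> x" using x y by (simp add: add_comm)
  fix z assume z: "z \<in> carrier pull"
  show "x \<boxplus>\<^bsub>pull\<^esub> y \<boxplus>\<^bsub>pull\<^esub> z = x \<boxplus>\<^bsub>pull\<^esub> (y \<boxplus>\<^bsub>pull\<^esub> z)" using x y z by (simp add: add_assoc)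
  show "z \<boxplus>\<^bsub>pull\<^esub> x \<sqsubseteq>\<^bsub>pull\<^esub> z \<boxplus>\<^bsub>pull\<^esub> y" if "x \<sqsubseteq>\<^bsub>pull\<^esub> y"
    using x y z that by (simp add: add_left_mono)
qed (simp_all add: unit_nonneg)

lemma psi_meet:
  assumes "x \<in> K" "y \<in> K" shows "\<psi> (x \<sqinter>\<^bsub>pull\<^esub> y) = \<psi> x \<sqinter> \<psi> y"
proof -
  interpret H: lgroup pull by (rule lgroup_pull)
  have "x \<sqinter>\<^bsub>pull\<^esub> y = \<phi> (\<psi> x \<sqinter> \<psi> y)"
    using assms by (intro H.meetI_eq) (simp_all add: meet_left meet_right meet_le)
  then show ?thesis using assms by simp
qed

lemma psi_neg:
  assumes x: "x \<in> K" shows "\<psi> (lu_neg pull x) = lu_neg G (\<psi> x)"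
proof -
  interpret H: lgroup pull by (rule lgroup_pull)
  have "\<phi> (lu_neg G (\<psi> x)) = lu_zero pull \<boxplus>\<^bsub>pull\<^esub> lu_neg pull x"
    using x by (intro H.neg_eqI) simp_all
  then have "\<phi> (lu_neg G (\<psi> x)) = lu_neg pull x" using H.zero_add[OF H.neg_closed[of x]] x by (simp only: pull_simps)
  then show ?thesis using psi_phi[OF span_neg[OF psi_span[OF x]]] by simp
qed

lemma psi_mult_unit: "\<psi> (lu_mult pull n (lu_unit pull)) = lu_mult G n \<u>"
proof (induction n)
  case (Suc n)
  interpret H: lgroup pull by (rule lgroup_pull)
  have "lu_mult pull n (lu_unit pull) \<in> K" using H.mult_closed[OF H.unit_closed] by simp
  moreover have "lu_mult G n \<u> \<boxplus> \<u> \<in> span G A" by (intro span_add sums_span[OF sums_unit] span_unit)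
  ultimately show ?case using Suc by (simp only: H.mult_Suc mult_Suc pull_simps) simp
qed (simp add: lgroup.lu_monoid_simps[OF lgroup_pull])

text \<open>The strong unit axiom, which may fail in the ambient group, holds on the generated
  subgroup: a finite sum of elements below the unit is below a multiple of it.\<close>

lemma lu_group_pull: "lu_group pull"
proof -
  interpret H: lgroup pull by (rule lgroup_pull)
  show ?thesis
  proof (intro lu_group.intro lu_group_axioms.intro)
    fix x assume "x \<in> carrier pull"
    then have x: "x \<in> K" by simp
    then obtain n where n: "\<psi> (x \<squnion>\<^bsub>pull\<^esub> lu_neg pull x) \<sqsubseteq> lu_mult G n \<u>"
      using span_le_mult[OF psi_span] H.join_closed[OF _ H.neg_closed] by (metis pull_simps(1))
    \<comment> \<open>The bound from \<open>span_le_mult\<close> may have \<open>n = 0\<close>,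
      whereas the axiom asks for \<open>n \<ge> 1\<close>; one more unit is harmless.\<close>
    also have "\<dots> \<sqsubseteq> lu_mult G (Suc n) \<u>"
      by (simp add: le_add_nonneg unit_nonneg)
    finally have "\<psi> (x \<squnion>\<^bsub>pull\<^esub> lu_neg pull x) \<sqsubseteq> lu_mult G (Suc n) \<u>"
      using H.join_closed[OF _ H.neg_closed] x by simp
    then show "\<exists>n\<ge>1. x \<squnion>\<^bsub>pull\<^esub> lu_neg pull x \<sqsubseteq>\<^bsub>pull\<^esub> lu_mult pull n (lu_unit pull)"
      unfolding pull_simps(3) psi_mult_unit by (intro exI[of _ "Suc n"]) simp
  qed (use H.lattice_axioms H.additive.comm_group_axioms H.add_left_mono H.unit_closed H.unit_nonneg in auto)
qed

end

section \<open>The functor \<Gamma> on objects\<close>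

lemma Gamma_obj_simps [simp]:
  "carrier (Gamma_obj G) = \<lbrace>lu_zero G..lu_unit G\<rbrace>\<^bsub>G\<^esub>"
  "x \<oplus>\<^bsub>Gamma_obj G\<^esub> y = (x \<boxplus>\<^bsub>G\<^esub> y) \<sqinter>\<^bsub>G\<^esub> lu_unit G"
  "mv_neg (Gamma_obj G) x = lu_unit G \<boxplus>\<^bsub>G\<^esub> lu_neg G x"
  "mv_zero (Gamma_obj G) = lu_zero G"
  by (simp_all add: Gamma_obj_def)

context lgroup
begin

abbreviation unit_interval ("\<I>") where "\<I> \<equiv> \<lbrace>\<zero>..\<u>\<rbrace>"

lemma mem_interval: "x \<in> \<I> \<longleftrightarrow> x \<in> carrier G \<and> \<zero> \<sqsubseteq> x \<and> x \<sqsubseteq> \<u>"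
  by (auto simp: at_least_at_most_def)

lemma interval_carrier: "x \<in> \<I> \<Longrightarrow> x \<in> carrier G"
  by (simp add: mem_interval)

lemma zero_interval [simp]: "\<zero> \<in> \<I>" and unit_interval [simp]: "\<u> \<in> \<I>"
  by (simp_all add: mem_interval unit_nonneg)

lemma truncated_add_interval: "\<lbrakk>x \<in> \<I>; y \<in> \<I>\<rbrakk> \<Longrightarrow> (x \<boxplus> y) \<sqinter> \<u> \<in> \<I>"
  by (simp add: mem_interval le_meet_iff add_nonneg unit_nonneg meet_right)

lemma complement_interval: "x \<in> \<I> \<Longrightarrow> \<u> \<boxminus> x \<in> \<I>"
  using le_diff_iff[of \<zero> x \<u>] diff_le_iff[of \<u> x \<u>] le_add_nonneg[of x \<u>]
  by (simp add: mem_interval)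

lemma sub_mv_interval: "sub_mv G \<I>"
  by (simp add: sub_mv_def truncated_add_interval complement_interval)

sublocale interval: sub_mv_lgroup G \<I>
  by unfold_locales (rule sub_mv_interval)

text \<open>The inner complement is the positive part of \<open>x - y\<close>, so the MV-expression
  computes the lattice join. Its symmetry is the one nontrivial MV-axiom.\<close>

lemma truncated_join:
  assumes "x \<in> \<I>" "y \<in> \<I>"
  shows "(\<u> \<boxminus> ((\<u> \<boxminus> x \<boxplus> y) \<sqinter> \<u>) \<boxplus> y) \<sqinter> \<u> = x \<squnion> y"
proof -
  note [simp] = interval_carrier[OF assms(1)] interval_carrier[OF assms(2)]
  have "\<u> \<boxminus> (\<u> \<boxminus> x \<boxplus> y) = x \<boxminus> y" by (simp add: neg_plus add_assoc)
  then have "\<u> \<boxminus> ((\<u> \<boxminus> x \<boxplus> y) \<sqinter> \<u>) = pos (x \<boxminus> y)" by (simp add: neg_meet add_join)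
  then have "\<u> \<boxminus> ((\<u> \<boxminus> x \<boxplus> y) \<sqinter> \<u>) \<boxplus> y = x \<squnion> y" by (simp add: join_diff[of x y])
  moreover have "x \<squnion> y \<sqsubseteq> \<u>" using assms by (simp add: mem_interval join_le)
  ultimately show ?thesis by (simp add: meet_absorb1)
qed

lemma mv_algebra_Gamma: "mv_algebra (Gamma_obj G)"
proof (intro mv_algebra.intro mv_algebra_axioms.intro)
  show "comm_monoid (mv_monoid (Gamma_obj G))"
  proof (rule comm_monoidI)
    fix x y z assume "x \<in> carrier (mv_monoid (Gamma_obj G))"
      "y \<in> carrier (mv_monoid (Gamma_obj G))" "z \<in> carrier (mv_monoid (Gamma_obj G))"
    then have xyz: "x \<in> \<I>" "y \<in> \<I>" "z \<in> \<I>" by (simp_all add: mv_monoid_def)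
    then have "((x \<boxplus> y) \<sqinter> \<u> \<boxplus> z) \<sqinter> \<u> = (x \<boxplus> y \<boxplus> z) \<sqinter> \<u>"
      by (intro add_meet_truncate) (simp_all add: mem_interval)
    moreover have "((y \<boxplus> z) \<sqinter> \<u> \<boxplus> x) \<sqinter> \<u> = (y \<boxplus> z \<boxplus> x) \<sqinter> \<u>"
      using xyz by (intro add_meet_truncate) (simp_all add: mem_interval)
    ultimately have "((x \<boxplus> y) \<sqinter> \<u> \<boxplus> z) \<sqinter> \<u> = (x \<boxplus> ((y \<boxplus> z) \<sqinter> \<u>)) \<sqinter> \<u>"
      using xyz by (simp add: interval_carrier add_comm[of x] add_assoc add_lcomm[of x])
    then show "x \<otimes>\<^bsub>mv_monoid (Gamma_obj G)\<^esub> y \<otimes>\<^bsub>mv_monoid (Gamma_obj G)\<^esub> z =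
        x \<otimes>\<^bsub>mv_monoid (Gamma_obj G)\<^esub> (y \<otimes>\<^bsub>mv_monoid (Gamma_obj G)\<^esub> z)"
      by (simp add: mv_monoid_def)
  qed (simp_all add: mv_monoid_def truncated_add_interval interval_carrier add_comm,
      simp add: mem_interval meet_absorb1)
next
  fix x y assume xy: "x \<in> carrier (Gamma_obj G)" "y \<in> carrier (Gamma_obj G)"
  then show "mv_neg (Gamma_obj G) (mv_neg (Gamma_obj G) x \<oplus>\<^bsub>Gamma_obj G\<^esub> y) \<oplus>\<^bsub>Gamma_obj G\<^esub> y =
      mv_neg (Gamma_obj G) (mv_neg (Gamma_obj G) y \<oplus>\<^bsub>Gamma_obj G\<^esub> x) \<oplus>\<^bsub>Gamma_obj G\<^esub> x"
    using truncated_join[of x y] truncated_join[of y x] by (simp add: join_comm)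
qed (simp_all add: complement_interval, simp_all add: mem_interval neg_plus
  meet_absorb2 le_add_nonneg add_comm[of _ \<u>])

lemma mv_order_Gamma:
  assumes "x \<in> \<I>" "y \<in> \<I>"
  shows "x \<sqsubseteq>\<^bsub>mv_order (Gamma_obj G)\<^esub> y \<longleftrightarrow> x \<sqsubseteq> y"
proof -
  note [simp] = interval_carrier[OF assms(1)] interval_carrier[OF assms(2)]
  have "(\<u> \<boxminus> x \<boxplus> y) \<sqinter> \<u> = \<u> \<longleftrightarrow> \<u> \<sqsubseteq> \<u> \<boxminus> x \<boxplus> y"
    using meet_left[of "\<u> \<boxminus> x \<boxplus> y" \<u>] meet_absorb2[of \<u> "\<u> \<boxminus> x \<boxplus> y"] by auto
  also have "\<dots> \<longleftrightarrow> \<u> \<boxplus> x \<sqsubseteq> \<u> \<boxplus> y"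
    using le_diff_iff[of \<u> x "\<u> \<boxplus> y"] by (simp add: add_assoc add_comm[of "lu_neg G x"])
  finally show ?thesis by (simp add: mv_order_def le_add_left_iff)
qed

end

lemma mv_order_simps [simp]: "carrier (mv_order A) = carrier A" "eq (mv_order A) = (=)"
  by (simp_all add: mv_order_def)

lemma (in mv_algebra) le_mv_order [simp]: "x \<sqsubseteq>\<^bsub>mv_order A\<^esub> y \<longleftrightarrow> x \<preceq> y"
  by (simp add: mv_order_def)

lemma (in mv_algebra) partial_order_mv_order: "partial_order (mv_order A)"
  by unfold_locales (auto intro: le_antisym le_trans)

lemma is_lub_iff: "S \<subseteq> carrier L \<Longrightarrow> is_lub L s S \<longleftrightarrow> s \<in> carrier L \<and> (\<forall>x\<in>S. x \<sqsubseteq>\<^bsub>L\<^esub> s) \<and>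
    (\<forall>z\<in>carrier L. (\<forall>x\<in>S. x \<sqsubseteq>\<^bsub>L\<^esub> z) \<longrightarrow> s \<sqsubseteq>\<^bsub>L\<^esub> z)"
  unfolding least_def Upper_def by (simp add: subset_iff) blast

lemma is_glb_iff: "S \<subseteq> carrier L \<Longrightarrow> is_glb L s S \<longleftrightarrow> s \<in> carrier L \<and> (\<forall>x\<in>S. s \<sqsubseteq>\<^bsub>L\<^esub> x) \<and>
    (\<forall>z\<in>carrier L. (\<forall>x\<in>S. z \<sqsubseteq>\<^bsub>L\<^esub> x) \<longrightarrow> z \<sqsubseteq>\<^bsub>L\<^esub> s)"
  unfolding greatest_def Lower_def by (simp add: subset_iff) blast

context lgroup
begin

lemma is_lub_Gamma_iff:
  assumes "S \<subseteq> \<I>"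
  shows "is_lub (mv_order (Gamma_obj G)) s S \<longleftrightarrow> s \<in> \<I> \<and> (\<forall>x\<in>S. x \<sqsubseteq> s) \<and>
    (\<forall>z\<in>\<I>. (\<forall>x\<in>S. x \<sqsubseteq> z) \<longrightarrow> s \<sqsubseteq> z)"
  using assms by (subst is_lub_iff) (auto simp: mv_order_Gamma subset_iff)

lemma is_glb_Gamma_iff:
  assumes "S \<subseteq> \<I>"
  shows "is_glb (mv_order (Gamma_obj G)) s S \<longleftrightarrow> s \<in> \<I> \<and> (\<forall>x\<in>S. s \<sqsubseteq> x) \<and>
    (\<forall>z\<in>\<I>. (\<forall>x\<in>S. z \<sqsubseteq> x) \<longrightarrow> z \<sqsubseteq> s)"
  using assms by (subst is_glb_iff) (auto simp: mv_order_Gamma subset_iff)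

end

section \<open>Completeness of the group and of its unit interval\<close>

lemma (in lu_group) mv_frame_Gamma:
  assumes "lu_frame G" shows "mv_frame (Gamma_obj G)"
proof -
  interpret Gamma: mv_algebra "Gamma_obj G" by (rule mv_algebra_Gamma)
  interpret Gamma_order: partial_order "mv_order (Gamma_obj G)" by (rule Gamma.partial_order_mv_order)
  \<comment> \<open>A top element and infima of nonempty sets suffice for completeness. This fits
    the hypothesis on \<open>G\<close>, which speaks of nonempty bounded sets only.\<close>
  have "complete_lattice (mv_order (Gamma_obj G))"
  proof (rule Gamma_order.complete_lattice_criterion1)
    show "\<exists>g. greatest (mv_order (Gamma_obj G)) g (carrier (mv_order (Gamma_obj G)))"
      using mv_order_Gamma by (intro exI[of _ \<u>]) (auto simp: greatest_def mem_interval unit_nonneg)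
    fix S assume "S \<subseteq> carrier (mv_order (Gamma_obj G))" and ne: "S \<noteq> {}"
    then have S: "S \<subseteq> \<I>" by simp
    have "\<zero> \<in> Lower G S" "\<u> \<in> Upper G S" "S \<subseteq> carrier G"
      using S by (auto simp: Lower_def Upper_def mem_interval)
    then obtain i where "is_glb G i S" using assms ne unfolding lu_frame_def by blast
    then have i: "i \<in> carrier G" "\<And>x. x \<in> S \<Longrightarrow> i \<sqsubseteq> x"
      "\<And>z. \<lbrakk>z \<in> carrier G; \<And>x. x \<in> S \<Longrightarrow> z \<sqsubseteq> x\<rbrakk> \<Longrightarrow> z \<sqsubseteq> i"
      using is_glb_iff[OF \<open>S \<subseteq> carrier G\<close>] by auto
    obtain x where "x \<in> S" using ne by auto
    then have "i \<sqsubseteq> \<u>" using i(2)[of x] i(1) le_trans[of i x \<u>] S by (auto simp: mem_interval)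
    moreover have "\<zero> \<sqsubseteq> i" using S by (intro i(3)) (auto simp: mem_interval)
    ultimately have "is_glb (mv_order (Gamma_obj G)) i S"
      using i by (auto simp: is_glb_Gamma_iff[OF S] mem_interval)
    then show "\<exists>i. is_glb (mv_order (Gamma_obj G)) i S" ..
  qed
  then show ?thesis by (simp add: mv_frame_def mv_algebra_Gamma)
qed

context lu_group
begin

lemma le_mult_unit: assumes [simp]: "x \<in> carrier G" shows "\<exists>n. x \<sqsubseteq> lu_mult G n \<u>"
  using strong_unit[of x] by (auto simp: join_le_iff)

text \<open>Every member of \<open>S\<close> splits into a part in the unit interval and an excess
  bounded by one unit less. The sum of the two suprema is the supremum of \<open>S\<close>, because
  any upper bound \<open>z\<close> splits in the same way and dominates each half
  separately.\<close>

lemma lub_of_bounded: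
  assumes complete: "complete_lattice (mv_order (Gamma_obj G))"
  shows "\<lbrakk>S \<subseteq> carrier G; S \<noteq> {}; \<And>x. x \<in> S \<Longrightarrow> \<zero> \<sqsubseteq> x; \<And>x. x \<in> S \<Longrightarrow> x \<sqsubseteq> lu_mult G n \<u>\<rbrakk>
    \<Longrightarrow> \<exists>s. is_lub G s S"
proof (induction n arbitrary: S)
  case 0
  have "x = \<zero>" if "x \<in> S" for x
    using 0(1,3,4) that by (intro le_antisym) auto
  then have "S = {\<zero>}" using 0(2) by blast
  then show ?case by (auto simp: is_lub_iff intro!: exI[of _ \<zero>])
next
  case (Suc n)
  note S = Suc.prems
  have [simp]: "x \<in> carrier G" if "x \<in> S" for x using S that by auto
  let ?T = "(\<lambda>x. x \<sqinter> \<u>) ` S" and ?R = "(\<lambda>x. pos (x \<boxminus> \<u>)) ` S"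
  have T: "?T \<subseteq> \<I>" using S(3) by (auto simp: mem_interval le_meet_iff unit_nonneg meet_right)
  then obtain t where t: "is_lub (mv_order (Gamma_obj G)) t ?T"
    using complete_lattice.sup_exists[OF complete, of ?T] by auto
  have "\<exists>r. is_lub G r ?R"
  proof (rule Suc.IH)
    fix y assume "y \<in> ?R"
    then obtain x where x: "x \<in> S" "y = pos (x \<boxminus> \<u>)" by auto
    then show "\<zero> \<sqsubseteq> y" by (simp add: join_right)
    show "y \<sqsubseteq> lu_mult G n \<u>"
      using x S(4)[of x] by (simp add: join_le_iff diff_le_iff mult_unit_nonneg)
  qed (use S(2) in auto)
  then obtain r where "is_lub G r ?R" ..
  then have r: "r \<in> carrier G" "\<And>x. x \<in> S \<Longrightarrow> pos (x \<boxminus> \<u>) \<sqsubseteq> r"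
    "\<And>z. \<lbrakk>z \<in> carrier G; \<And>x. x \<in> S \<Longrightarrow> pos (x \<boxminus> \<u>) \<sqsubseteq> z\<rbrakk> \<Longrightarrow> r \<sqsubseteq> z"
    by (subst (asm) is_lub_iff, auto)+
  from t have t: "t \<in> \<I>" "\<And>x. x \<in> S \<Longrightarrow> x \<sqinter> \<u> \<sqsubseteq> t"
    "\<And>z. \<lbrakk>z \<in> \<I>; \<And>x. x \<in> S \<Longrightarrow> x \<sqinter> \<u> \<sqsubseteq> z\<rbrakk> \<Longrightarrow> t \<sqsubseteq> z"
    by (simp_all add: is_lub_Gamma_iff[OF T])
  note [simp] = r(1) interval_carrier[OF t(1)]
  have "is_lub G (t \<boxplus> r) S"
    unfolding is_lub_iff[OF S(1)]
  proof (intro conjI ballI impI)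
    fix x assume [simp]: "x \<in> S"
    have "(x \<sqinter> \<u>) \<boxplus> pos (x \<boxminus> \<u>) \<sqsubseteq> t \<boxplus> r" by (rule add_mono) (simp_all add: t r)
    then show "x \<sqsubseteq> t \<boxplus> r" by (simp add: decompose)
  next
    fix z assume [simp]: "z \<in> carrier G" and z: "\<forall>x\<in>S. x \<sqsubseteq> z"
    obtain x where x: "x \<in> S" using S(2) by auto
    then have "\<zero> \<sqsubseteq> z" using S(3)[OF x] z le_trans[of \<zero> x z] by simp
    then have "t \<sqsubseteq> z \<sqinter> \<u>"
      using z by (intro t(3)) (auto simp: mem_interval le_meet_iff unit_nonneg meet_right
          intro: le_trans[OF meet_left])
    moreover have "r \<sqsubseteq> pos (z \<boxminus> \<u>)"
    proof (rule r(3))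
      fix x assume [simp]: "x \<in> S"
      have "x \<boxminus> \<u> \<sqsubseteq> z \<boxminus> \<u>" using z by (intro add_mono) auto
      then have "x \<boxminus> \<u> \<sqsubseteq> pos (z \<boxminus> \<u>)" by (rule le_trans[OF _ join_left]) simp_all
      then show "pos (x \<boxminus> \<u>) \<sqsubseteq> pos (z \<boxminus> \<u>)" by (simp add: join_le join_right)
    qed simp
    ultimately have "t \<boxplus> r \<sqsubseteq> (z \<sqinter> \<u>) \<boxplus> pos (z \<boxminus> \<u>)" by (intro add_mono) simp_all
    then show "t \<boxplus> r \<sqsubseteq> z" by (simp add: decompose)
  qed simp
  then show ?case ..
qed

text \<open>Translating by the lower bound \<open>w\<close> makes the set nonnegative, and the
  strong unit bounds the translated set by a multiple of \<open>u\<close>.\<close>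

lemma lub_exists:
  assumes complete: "complete_lattice (mv_order (Gamma_obj G))"
    and S: "S \<subseteq> carrier G" "S \<noteq> {}" and w: "w \<in> carrier G" "\<And>x. x \<in> S \<Longrightarrow> w \<sqsubseteq> x"
    and v: "v \<in> carrier G" "\<And>x. x \<in> S \<Longrightarrow> x \<sqsubseteq> v"
  shows "\<exists>s. is_lub G s S"
proof -
  note [simp] = w(1) v(1)
  have [simp]: "x \<in> carrier G" if "x \<in> S" for x using S that by auto
  let ?S = "(\<lambda>x. x \<boxminus> w) ` S"
  obtain n where n: "v \<boxminus> w \<sqsubseteq> lu_mult G n \<u>" using le_mult_unit[of "v \<boxminus> w"] by auto
  have "\<exists>s. is_lub G s ?S"
  proof (rule lub_of_bounded[OF complete])
    fix y assume "y \<in> ?S"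
    then obtain x where x: "x \<in> S" "y = x \<boxminus> w" by auto
    then show "\<zero> \<sqsubseteq> y" using w(2)[of x] by (simp add: le_diff_iff)
    have "x \<boxminus> w \<sqsubseteq> v \<boxminus> w" using x v by (intro add_mono) auto
    then show "y \<sqsubseteq> lu_mult G n \<u>" using le_trans[OF _ n] x by simp
  qed (use S in auto)
  then obtain s where "is_lub G s ?S" ..
  then have s: "s \<in> carrier G" "\<And>x. x \<in> S \<Longrightarrow> x \<boxminus> w \<sqsubseteq> s"
    "\<And>z. \<lbrakk>z \<in> carrier G; \<And>x. x \<in> S \<Longrightarrow> x \<boxminus> w \<sqsubseteq> z\<rbrakk> \<Longrightarrow> s \<sqsubseteq> z"
    by (subst (asm) is_lub_iff, auto)+
  have "is_lub G (s \<boxplus> w) S"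
    unfolding is_lub_iff[OF S(1)]
  proof (intro conjI ballI impI)
    fix z assume z: "z \<in> carrier G" "\<forall>x\<in>S. x \<sqsubseteq> z"
    then have "s \<sqsubseteq> z \<boxminus> w" by (intro s(3)) (auto intro!: add_mono)
    then show "s \<boxplus> w \<sqsubseteq> z" using z s(1) by (simp add: le_diff_iff)
  qed (use s diff_le_iff in auto)
  then show ?thesis ..
qed

lemma lu_frame_of_complete:
  assumes complete: "complete_lattice (mv_order (Gamma_obj G))"
  shows "lu_frame G"
  unfolding lu_frame_def
proof (intro conjI allI impI)
  show "lu_group G" by (rule lu_group_axioms)
  fix S assume S: "S \<subseteq> carrier G" and bounded: "S \<noteq> {} \<and> Upper G S \<noteq> {} \<and> Lower G S \<noteq> {}"
  then have ne: "S \<noteq> {}" by simp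
  obtain v w where "v \<in> Upper G S" "w \<in> Lower G S" using bounded by blast
  then have w: "w \<in> carrier G" "\<And>x. x \<in> S \<Longrightarrow> w \<sqsubseteq> x"
    and v: "v \<in> carrier G" "\<And>x. x \<in> S \<Longrightarrow> x \<sqsubseteq> v"
    using S by (simp_all add: Upper_def Lower_def subset_iff)
  have [simp]: "x \<in> carrier G" if "x \<in> S" for x using S that by auto
  show "\<exists>s. is_lub G s S" by (rule lub_exists[OF complete S ne w v])
  let ?S = "lu_neg G ` S"
  have "\<exists>s. is_lub G s ?S"
    by (rule lub_exists[OF complete, where v = "lu_neg G w" and w = "lu_neg G v"])
      (use ne v w in \<open>auto simp: neg_le_iff\<close>)
  then obtain s where "is_lub G s ?S" ..
  then have s: "s \<in> carrier G" "\<And>x. x \<in> S \<Longrightarrow> lu_neg G x \<sqsubseteq> s"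
    "\<And>z. \<lbrakk>z \<in> carrier G; \<And>x. x \<in> S \<Longrightarrow> lu_neg G x \<sqsubseteq> z\<rbrakk> \<Longrightarrow> s \<sqsubseteq> z"
    by (subst (asm) is_lub_iff, auto)+
  have "is_glb G (lu_neg G s) S"
    unfolding is_glb_iff[OF S]
  proof (intro conjI ballI impI)
    fix x assume "x \<in> S" then show "lu_neg G s \<sqsubseteq> x" using s neg_le_swap[of s x] by simp
  next
    fix z assume z: "z \<in> carrier G" "\<forall>x\<in>S. z \<sqsubseteq> x"
    then have "s \<sqsubseteq> lu_neg G z" by (intro s(3)) (auto simp: neg_le_iff)
    then show "z \<sqsubseteq> lu_neg G s" using z s(1) neg_le_iff[of "lu_neg G z" s] by simp
  qed (simp add: s)
  then show "\<exists>i. is_glb G i S" ..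
qed

end

section \<open>Morphisms\<close>

context lu_group
begin

lemma nonneg_sums:
  "\<lbrakk>x \<in> carrier G; \<zero> \<sqsubseteq> x; x \<sqsubseteq> lu_mult G n \<u>\<rbrakk> \<Longrightarrow> x \<in> sums G \<I>"
proof (induction n arbitrary: x)
  case 0
  then have "x = \<zero>" by (intro le_antisym) simp_all
  then show ?case by (simp add: sums_zero)
next
  case (Suc n)
  note [simp] = Suc.prems(1)
  have "pos (x \<boxminus> \<u>) \<in> sums G \<I>"
    using Suc.prems by (intro Suc.IH) (simp_all add: join_right join_le_iff diff_le_iff mult_unit_nonneg)
  moreover have "x \<sqinter> \<u> \<in> \<I>"
    using Suc.prems by (simp add: mem_interval le_meet_iff unit_nonneg meet_right)
  ultimately have "pos (x \<boxminus> \<u>) \<boxplus> (x \<sqinter> \<u>) \<in> sums G \<I>" by (rule sums_add)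
  then show ?case using decompose[of x \<u>] by (simp add: add_comm)
qed

text \<open>The strong unit is used twice: to make \<open>x\<close> nonnegative by adding units, and
  to bound the result so that \<open>nonneg_sums\<close> peels it into elements of the
  interval.\<close>

lemma mem_span: assumes [simp]: "x \<in> carrier G" shows "x \<in> span G \<I>"
proof -
  obtain m where m: "lu_neg G x \<sqsubseteq> lu_mult G m \<u>" using le_mult_unit[of "lu_neg G x"] by auto
  obtain n where n: "x \<boxplus> lu_mult G m \<u> \<sqsubseteq> lu_mult G n \<u>"
    using le_mult_unit[of "x \<boxplus> lu_mult G m \<u>"] by auto
  have "\<zero> \<sqsubseteq> x \<boxplus> lu_mult G m \<u>"
    using add_mono[OF m, of x x] by (simp add: add_comm)
  then have "x \<boxplus> lu_mult G m \<u> \<in> sums G \<I>" using n by (intro nonneg_sums) simp_all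
  then show ?thesis by (auto simp: span_def)
qed

text \<open>If the truncation vanishes, \<open>x\<close> equals its own excess over
  \<open>u\<close>, so a bound by \<open>n + 1\<close> units improves to a bound by \<open>n\<close>
  units, down to zero.\<close>

lemma eq_zero_of_truncate_zero:
  assumes [simp]: "x \<in> carrier G" and nonneg: "\<zero> \<sqsubseteq> x" and zero: "x \<sqinter> \<u> = \<zero>"
  shows "x = \<zero>"
proof -
  have pos: "pos (x \<boxminus> \<u>) = x" using decompose[of x \<u>] zero by simp
  have "x \<sqsubseteq> \<zero>" if "x \<sqsubseteq> lu_mult G n \<u>" for n
    using that
  proof (induction n)
    case (Suc n)
    have "pos (x \<boxminus> \<u>) \<sqsubseteq> lu_mult G n \<u>"
      using Suc.prems by (simp add: join_le_iff diff_le_iff mult_unit_nonneg)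
    then show ?case using Suc.IH pos by simp
  qed simp
  then show ?thesis using le_mult_unit[of x] nonneg by (auto intro: le_antisym)
qed

end

lemma lu_hom_closed:
  "\<lbrakk>f \<in> lu_hom G H; x \<in> carrier G\<rbrakk> \<Longrightarrow> f x \<in> carrier H"
  by (auto simp: lu_hom_def hom_def lu_monoid_def)

lemma lu_hom_add:
  "\<lbrakk>f \<in> lu_hom G H; x \<in> carrier G; y \<in> carrier G\<rbrakk> \<Longrightarrow> f (x \<boxplus>\<^bsub>G\<^esub> y) = f x \<boxplus>\<^bsub>H\<^esub> f y"
  by (auto simp: lu_hom_def hom_def lu_monoid_def)

lemma lu_hom_join:
  "\<lbrakk>f \<in> lu_hom G H; x \<in> carrier G; y \<in> carrier G\<rbrakk> \<Longrightarrow> f (x \<squnion>\<^bsub>G\<^esub> y) = f x \<squnion>\<^bsub>H\<^esub> f y"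
  by (simp add: lu_hom_def join_pres_def)

lemma lu_hom_meet:
  "\<lbrakk>f \<in> lu_hom G H; x \<in> carrier G; y \<in> carrier G\<rbrakk> \<Longrightarrow> f (x \<sqinter>\<^bsub>G\<^esub> y) = f x \<sqinter>\<^bsub>H\<^esub> f y"
  by (simp add: lu_hom_def meet_pres_def)

lemma lu_hom_unit: "f \<in> lu_hom G H \<Longrightarrow> f (lu_unit G) = lu_unit H"
  by (simp add: lu_hom_def)

lemma lu_hom_le:
  assumes "f \<in> lu_hom G H" "x \<in> carrier G" "y \<in> carrier G" "x \<sqsubseteq>\<^bsub>G\<^esub> y"
  shows "f x \<sqsubseteq>\<^bsub>H\<^esub> f y"
proof -
  have "isotone G H f"
    using assms(1) by (intro join_pres_isotone) (auto simp: lu_hom_def hom_def lu_monoid_def)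
  then show ?thesis using assms by (simp add: isotone_def)
qed

lemma lu_homI:
  assumes "lu_group G" "lu_group H"
    and "\<And>x. x \<in> carrier G \<Longrightarrow> f x \<in> carrier H"
    and "\<And>x y. \<lbrakk>x \<in> carrier G; y \<in> carrier G\<rbrakk> \<Longrightarrow> f (x \<boxplus>\<^bsub>G\<^esub> y) = f x \<boxplus>\<^bsub>H\<^esub> f y"
    and "\<And>x y. \<lbrakk>x \<in> carrier G; y \<in> carrier G\<rbrakk> \<Longrightarrow> f (x \<squnion>\<^bsub>G\<^esub> y) = f x \<squnion>\<^bsub>H\<^esub> f y"
    and "\<And>x y. \<lbrakk>x \<in> carrier G; y \<in> carrier G\<rbrakk> \<Longrightarrow> f (x \<sqinter>\<^bsub>G\<^esub> y) = f x \<sqinter>\<^bsub>H\<^esub> f y"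
    and "f (lu_unit G) = lu_unit H"
  shows "f \<in> lu_hom G H"
  using assms lu_group.axioms(1)
  by (auto simp: lu_hom_def hom_def lu_monoid_def join_pres_def meet_pres_def)

section \<open>Homomorphisms of groups and their restrictions to the unit intervals\<close>

context
  fixes G H :: "'a lu_group" and f
  assumes G: "lu_group G" and H: "lu_group H" and f: "f \<in> lu_hom G H"
begin

interpretation G: lu_group G by (rule G)
interpretation H: lu_group H by (rule H)

lemma lu_hom_zero: "f G.zero = H.zero"
proof -
  have "f G.zero \<boxplus>\<^bsub>H\<^esub> f G.zero = f G.zero \<boxplus>\<^bsub>H\<^esub> H.zero"
    using lu_hom_add[OF f G.zero_closed G.zero_closed] lu_hom_closed[OF f G.zero_closed] by simp
  then show ?thesis
    using lu_hom_closed[OF f G.zero_closed] by (subst (asm) H.add_left_cancel) simp_all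
qed

lemma lu_hom_neg: assumes x: "x \<in> carrier G" shows "f (lu_neg G x) = lu_neg H (f x)"
proof -
  have "f x \<boxplus>\<^bsub>H\<^esub> f (lu_neg G x) = H.zero"
    using x lu_hom_add[OF f x, of "lu_neg G x"] by (simp add: lu_hom_zero)
  then have "f (lu_neg G x) = H.zero \<boxplus>\<^bsub>H\<^esub> lu_neg H (f x)"
    using x by (intro H.neg_eqI) (simp_all add: lu_hom_closed[OF f])
  then show ?thesis using x by (simp add: lu_hom_closed[OF f])
qed

lemma lu_hom_interval: "x \<in> G.unit_interval \<Longrightarrow> f x \<in> H.unit_interval"
  using lu_hom_le[OF f, of G.zero x] lu_hom_le[OF f, of x G.unit]
  by (simp add: G.mem_interval H.mem_interval lu_hom_zero lu_hom_unit[OF f] lu_hom_closed[OF f])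

lemma Gamma_mv_hom: "restrict f (carrier (Gamma_obj G)) \<in> mv_hom (Gamma_obj G) (Gamma_obj H)"
  using lu_hom_interval
  by (auto simp: mv_hom_def hom_def mv_monoid_def lu_hom_zero lu_hom_neg lu_hom_add[OF f]
      lu_hom_meet[OF f] lu_hom_unit[OF f] G.interval_carrier
      G.truncated_add_interval G.complement_interval)

lemma Gamma_preserves_sups:
  assumes sups: "preserves_sups G H f"
  shows "preserves_sups (mv_order (Gamma_obj G)) (mv_order (Gamma_obj H))
    (restrict f (carrier (Gamma_obj G)))"
  unfolding preserves_sups_def
proof (intro allI impI)
  fix S s assume "S \<subseteq> carrier (mv_order (Gamma_obj G))" and lub: "is_lub (mv_order (Gamma_obj G)) s S"
  then have S: "S \<subseteq> G.unit_interval" by simp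
  from lub have s: "s \<in> G.unit_interval" "\<And>x. x \<in> S \<Longrightarrow> x \<sqsubseteq>\<^bsub>G\<^esub> s"
    "\<And>z. \<lbrakk>z \<in> G.unit_interval; \<And>x. x \<in> S \<Longrightarrow> x \<sqsubseteq>\<^bsub>G\<^esub> z\<rbrakk> \<Longrightarrow> s \<sqsubseteq>\<^bsub>G\<^esub> z"
    by (simp_all add: G.is_lub_Gamma_iff[OF S])
  have im: "restrict f G.unit_interval ` S = f ` S" using S by auto
  have fS: "f ` S \<subseteq> H.unit_interval" using S lu_hom_interval by auto
  have SG: "S \<subseteq> carrier G" using S G.interval_carrier by auto
  \<comment> \<open>For empty \<open>S\<close> the supremum in the interval is \<open>0\<close>,
    which need not be a supremum in \<open>G\<close>, so \<open>f 0 = 0\<close> is used directly.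
    For nonempty \<open>S\<close> an upper bound \<open>z\<close> in \<open>G\<close> is
    nonnegative, so \<open>z \<sqinter> u\<close> is an upper bound in the interval and the two
    suprema agree.\<close>
  show "is_lub (mv_order (Gamma_obj H)) (restrict f (carrier (Gamma_obj G)) s)
      (restrict f (carrier (Gamma_obj G)) ` S)"
  proof (cases "S = {}")
    case True
    then have "s \<sqsubseteq>\<^bsub>G\<^esub> G.zero" by (intro s(3)) simp_all
    then have "s = G.zero" using s(1) by (intro G.le_antisym) (auto simp: G.mem_interval)
    then have "f s = H.zero" by (simp add: lu_hom_zero)
    then show ?thesis using True s(1) H.is_lub_Gamma_iff[of "{}" H.zero]
      by (simp add: H.mem_interval H.unit_nonneg)
  next
    case False
    then obtain x0 where x0: "x0 \<in> S" by blast
    have "is_lub G s S"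
      unfolding is_lub_iff[OF SG]
    proof (intro conjI ballI impI)
      show "s \<in> carrier G" using s by (simp add: G.mem_interval)
      fix z assume z: "z \<in> carrier G" "\<forall>x\<in>S. x \<sqsubseteq>\<^bsub>G\<^esub> z"
      have [simp]: "x0 \<in> G.unit_interval" using S x0 by auto
      then have "G.zero \<sqsubseteq>\<^bsub>G\<^esub> z"
        using z x0 G.le_trans[of G.zero x0 z] by (simp add: G.mem_interval)
      then have "s \<sqsubseteq>\<^bsub>G\<^esub> z \<sqinter>\<^bsub>G\<^esub> G.unit"
        using z S by (intro s(3)) (auto simp: G.mem_interval G.le_meet_iff G.unit_nonneg G.meet_right)
      then show "s \<sqsubseteq>\<^bsub>G\<^esub> z" using z s(1) by (simp add: G.le_meet_iff G.mem_interval)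
    qed (use s in auto)
    then have "is_lub H (f s) (f ` S)" using sups SG by (auto simp: preserves_sups_def)
    moreover have "f ` S \<subseteq> carrier H" using SG lu_hom_closed[OF f] by auto
    ultimately have "is_lub (mv_order (Gamma_obj H)) (f s) (f ` S)"
      using lu_hom_interval[OF s(1)]
      by (simp add: is_lub_iff H.is_lub_Gamma_iff[OF fS] H.mem_interval)
    then show ?thesis using s(1) im by simp
  qed
qed

lemma preserves_sups_of_Gamma:
  assumes sups: "preserves_sups (mv_order (Gamma_obj G)) (mv_order (Gamma_obj H))
    (restrict f (carrier (Gamma_obj G)))"
  shows "preserves_sups G H f"
  unfolding preserves_sups_def
proof (intro allI impI)
  fix S s assume SG: "S \<subseteq> carrier G" and "is_lub G s S"
  then have s: "s \<in> carrier G" "\<And>x. x \<in> S \<Longrightarrow> x \<sqsubseteq>\<^bsub>G\<^esub> s"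
    "\<And>z. \<lbrakk>z \<in> carrier G; \<And>x. x \<in> S \<Longrightarrow> x \<sqsubseteq>\<^bsub>G\<^esub> z\<rbrakk> \<Longrightarrow> s \<sqsubseteq>\<^bsub>G\<^esub> z"
    by (simp_all add: is_lub_iff[OF SG])
  have [simp]: "x \<in> carrier G" if "x \<in> S" for x using that SG by auto
  note [simp] = s(1) lu_hom_closed[OF f]
  \<comment> \<open>The complement of the truncated gap between \<open>s\<close> and
    \<open>x\<close>. Complements are taken because the hypothesis concerns suprema: gaps with
    infimum \<open>0\<close> become elements with supremum \<open>u\<close>.\<close>
  define t where "t x = G.unit \<boxplus>\<^bsub>G\<^esub> lu_neg G ((s \<boxplus>\<^bsub>G\<^esub> lu_neg G x) \<sqinter>\<^bsub>G\<^esub> G.unit)" for x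
  have gap: "G.zero \<sqsubseteq>\<^bsub>G\<^esub> s \<boxplus>\<^bsub>G\<^esub> lu_neg G x" if "x \<in> S" for x
    using s(2)[OF that] that by (simp add: G.le_diff_iff)
  have gap': "(s \<boxplus>\<^bsub>G\<^esub> lu_neg G x) \<sqinter>\<^bsub>G\<^esub> G.unit \<in> G.unit_interval" if "x \<in> S" for x
    using that gap by (simp add: G.mem_interval G.le_meet_iff G.unit_nonneg G.meet_right)
  have t: "t ` S \<subseteq> G.unit_interval"
    using G.complement_interval[OF gap'] by (auto simp: t_def)
  have "is_lub (mv_order (Gamma_obj G)) G.unit (t ` S)"
    unfolding G.is_lub_Gamma_iff[OF t]
  proof (intro conjI ballI impI)
    fix x assume "x \<in> t ` S" then show "x \<sqsubseteq>\<^bsub>G\<^esub> G.unit" using t by (auto simp: G.mem_interval)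
  next
    fix z assume z: "z \<in> G.unit_interval" "\<forall>x\<in>t ` S. x \<sqsubseteq>\<^bsub>G\<^esub> z"
    note [simp] = G.interval_carrier[OF z(1)]
    \<comment> \<open>An upper bound \<open>z\<close> of the \<open>t x\<close> makes
      \<open>u - z\<close> a lower bound of all gaps, so \<open>s - (u - z)\<close> still bounds
      \<open>S\<close>. As \<open>s\<close> is least, \<open>u - z\<close> cannot exceed
      zero.\<close>
    have "s \<sqsubseteq>\<^bsub>G\<^esub> s \<boxplus>\<^bsub>G\<^esub> lu_neg G (G.unit \<boxplus>\<^bsub>G\<^esub> lu_neg G z)"
    proof (rule s(3))
      fix x assume x [simp]: "x \<in> S"
      let ?d = "s \<boxplus>\<^bsub>G\<^esub> lu_neg G x"
      have "G.unit \<sqsubseteq>\<^bsub>G\<^esub> z \<boxplus>\<^bsub>G\<^esub> (?d \<sqinter>\<^bsub>G\<^esub> G.unit)"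
        using z(2) x by (auto simp: t_def G.diff_le_iff)
      then have "G.unit \<boxplus>\<^bsub>G\<^esub> lu_neg G z \<sqsubseteq>\<^bsub>G\<^esub> ?d \<sqinter>\<^bsub>G\<^esub> G.unit"
        by (simp add: G.diff_le_iff G.add_comm[of z])
      then have "G.unit \<boxplus>\<^bsub>G\<^esub> lu_neg G z \<sqsubseteq>\<^bsub>G\<^esub> ?d" by (simp add: G.le_meet_iff)
      then show "x \<sqsubseteq>\<^bsub>G\<^esub> s \<boxplus>\<^bsub>G\<^esub> lu_neg G (G.unit \<boxplus>\<^bsub>G\<^esub> lu_neg G z)"
        using G.le_diff_iff[of "G.unit \<boxplus>\<^bsub>G\<^esub> lu_neg G z" x s]
          G.le_diff_iff[of x "G.unit \<boxplus>\<^bsub>G\<^esub> lu_neg G z" s]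
        by (simp add: G.add_comm[of x])
    qed simp
    then have "s \<boxplus>\<^bsub>G\<^esub> (G.unit \<boxplus>\<^bsub>G\<^esub> lu_neg G z) \<sqsubseteq>\<^bsub>G\<^esub> s \<boxplus>\<^bsub>G\<^esub> G.zero"
      using G.le_diff_iff[of s "G.unit \<boxplus>\<^bsub>G\<^esub> lu_neg G z" s] by simp
    then have "G.unit \<boxplus>\<^bsub>G\<^esub> lu_neg G z \<sqsubseteq>\<^bsub>G\<^esub> G.zero"
      by (subst (asm) G.le_add_left_iff) simp_all
    then show "G.unit \<sqsubseteq>\<^bsub>G\<^esub> z" by (simp add: G.diff_le_iff)
  qed simp
  moreover have im: "restrict f G.unit_interval ` t ` S = f ` t ` S" using t by (intro image_cong) auto
  ultimately have "is_lub (mv_order (Gamma_obj H)) (restrict f G.unit_interval G.unit) (f ` t ` S)"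
    using sups t unfolding preserves_sups_def Gamma_obj_simps(1) mv_order_simps(1) by metis
  then have lub: "is_lub (mv_order (Gamma_obj H)) H.unit (f ` t ` S)"
    by (simp add: lu_hom_unit[OF f])
  have ft: "f ` t ` S \<subseteq> H.unit_interval" using t lu_hom_interval by auto
  have f_t: "f (t x) = H.unit \<boxplus>\<^bsub>H\<^esub> lu_neg H ((f s \<boxplus>\<^bsub>H\<^esub> lu_neg H (f x)) \<sqinter>\<^bsub>H\<^esub> H.unit)"
    if "x \<in> S" for x
    using that by (simp add: t_def lu_hom_add[OF f] lu_hom_neg lu_hom_meet[OF f] lu_hom_unit[OF f])
  have fS: "f ` S \<subseteq> carrier H" by auto
  show "is_lub H (f s) (f ` S)"
    unfolding is_lub_iff[OF fS]
  proof (intro conjI ballI impI)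
    fix y assume "y \<in> f ` S" then show "y \<sqsubseteq>\<^bsub>H\<^esub> f s" using s(2) by (auto intro: lu_hom_le[OF f])
  next
    fix h assume [simp]: "h \<in> carrier H" and h: "\<forall>y\<in>f ` S. y \<sqsubseteq>\<^bsub>H\<^esub> h"
    \<comment> \<open>The amount by which \<open>f s\<close> exceeds the bound \<open>h\<close>. It
      lies below every gap between \<open>f s\<close> and \<open>f x\<close>, so its truncation is
      zero by the preserved supremum, and then it is zero itself.\<close>
    let ?k = "H.pos (f s \<boxplus>\<^bsub>H\<^esub> lu_neg H h)"
    have k: "?k \<sqinter>\<^bsub>H\<^esub> H.unit \<in> H.unit_interval"
      by (simp add: H.mem_interval H.le_meet_iff H.join_right H.unit_nonneg H.meet_right)
    have "H.unit \<sqsubseteq>\<^bsub>H\<^esub> H.unit \<boxplus>\<^bsub>H\<^esub> lu_neg H (?k \<sqinter>\<^bsub>H\<^esub> H.unit)"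
    proof -
      have "y \<sqsubseteq>\<^bsub>H\<^esub> H.unit \<boxplus>\<^bsub>H\<^esub> lu_neg H (?k \<sqinter>\<^bsub>H\<^esub> H.unit)" if "y \<in> f ` t ` S" for y
      proof -
        obtain x where x [simp]: "x \<in> S" and y: "y = f (t x)" using \<open>y \<in> f ` t ` S\<close> by auto
        let ?d = "f s \<boxplus>\<^bsub>H\<^esub> lu_neg H (f x)"
        have "f s \<boxplus>\<^bsub>H\<^esub> lu_neg H h \<sqsubseteq>\<^bsub>H\<^esub> ?d"
          using h by (intro H.add_mono) (simp_all add: H.neg_le_iff)
        moreover have "H.zero \<sqsubseteq>\<^bsub>H\<^esub> ?d"
          using lu_hom_le[OF f _ _ s(2)[OF x]] by (simp add: H.le_diff_iff)
        ultimately have "?k \<sqsubseteq>\<^bsub>H\<^esub> ?d" by (simp add: H.join_le)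
        then have "?k \<sqinter>\<^bsub>H\<^esub> H.unit \<sqsubseteq>\<^bsub>H\<^esub> ?d \<sqinter>\<^bsub>H\<^esub> H.unit"
          using H.le_trans[OF H.meet_left[of ?k H.unit], of ?d]
          by (simp add: H.le_meet_iff H.meet_right)
        then show ?thesis
          unfolding y f_t[OF x] by (intro H.add_mono) (simp_all add: H.neg_le_iff)
      qed
      then show ?thesis
        using lub H.complement_interval[OF k] by (simp add: H.is_lub_Gamma_iff[OF ft])
    qed
    then have "H.unit \<boxplus>\<^bsub>H\<^esub> (?k \<sqinter>\<^bsub>H\<^esub> H.unit) \<sqsubseteq>\<^bsub>H\<^esub> H.unit \<boxplus>\<^bsub>H\<^esub> H.zero"
      using H.le_diff_iff[of H.unit "?k \<sqinter>\<^bsub>H\<^esub> H.unit" H.unit] by simp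
    then have "?k \<sqinter>\<^bsub>H\<^esub> H.unit \<sqsubseteq>\<^bsub>H\<^esub> H.zero"
      by (subst (asm) H.le_add_left_iff) simp_all
    then have "?k \<sqinter>\<^bsub>H\<^esub> H.unit = H.zero" using k by (intro H.le_antisym) (simp_all add: H.mem_interval)
    then have "?k = H.zero" by (rule H.eq_zero_of_truncate_zero[rotated 2]) (simp_all add: H.join_right)
    then have "f s \<boxplus>\<^bsub>H\<^esub> lu_neg H h \<sqsubseteq>\<^bsub>H\<^esub> H.zero"
      using H.join_left[of "f s \<boxplus>\<^bsub>H\<^esub> lu_neg H h" H.zero] by simp
    then show "f s \<sqsubseteq>\<^bsub>H\<^esub> h" by (simp add: H.diff_le_iff)
  qed simp
qed

text \<open>Faithfulness: two homomorphisms agreeing on the interval agree on sums of its elements,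
  and by \<open>mem_span\<close> every element is such a sum minus a multiple of the unit.\<close>

lemma lu_hom_eq_on_carrier:
  assumes g: "g \<in> lu_hom G H" and eq: "\<And>a. a \<in> G.unit_interval \<Longrightarrow> f a = g a"
    and x: "x \<in> carrier G"
  shows "f x = g x"
proof -
  have sums: "f y = g y" if "y \<in> sums G G.unit_interval" for y
    using that
  proof (induction rule: sums.induct)
    case (sums_add y a)
    then have "y \<in> carrier G" "a \<in> carrier G"
      by (simp_all add: G.interval_carrier G.interval.sums_carrier)
    then show ?case using sums_add by (simp add: lu_hom_add[OF f] lu_hom_add[OF g] eq)
  qed (simp add: eq)
  obtain n where n: "x \<boxplus>\<^bsub>G\<^esub> lu_mult G n G.unit \<in> sums G G.unit_interval"
    using G.mem_span[OF x] by (auto simp: span_def)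
  have "f x \<boxplus>\<^bsub>H\<^esub> f (lu_mult G n G.unit) = g x \<boxplus>\<^bsub>H\<^esub> f (lu_mult G n G.unit)"
    using sums[OF n] sums[OF G.interval.sums_unit[of n]] x
    by (simp add: lu_hom_add[OF f] lu_hom_add[OF g])
  moreover have "f (lu_mult G n G.unit) \<in> carrier H" by (intro lu_hom_closed[OF f]) simp
  ultimately show ?thesis
    using H.add_diff_cancel lu_hom_closed[OF f x] lu_hom_closed[OF g x] by metis
qed

end

section \<open>Extending MV-homomorphisms\<close>

lemma mv_homD:
  assumes "f \<in> mv_hom A B"
  shows "x \<in> carrier A \<Longrightarrow> f x \<in> carrier B"
    and "\<lbrakk>x \<in> carrier A; y \<in> carrier A\<rbrakk> \<Longrightarrow> f (x \<oplus>\<^bsub>A\<^esub> y) = f x \<oplus>\<^bsub>B\<^esub> f y"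
    and "f (mv_zero A) = mv_zero B"
    and "x \<in> carrier A \<Longrightarrow> f (mv_neg A x) = mv_neg B (f x)"
  using assms by (auto simp: mv_hom_def hom_def mv_monoid_def)

lemma mv_embedding_of_hom:
  "\<lbrakk>lgroup H; f \<in> mv_hom A (Gamma_obj H)\<rbrakk> \<Longrightarrow> mv_embedding A H f"
  using mv_homD[of f A "Gamma_obj H"] by (simp add: mv_embedding_def)

locale mv_hom_extension = G: lu_group G + H: lu_group H
  for G H :: "'a lu_group" +
  fixes f
  assumes f: "f \<in> mv_hom (Gamma_obj G) (Gamma_obj H)"
begin

text \<open>The product of \<open>G\<close> and \<open>H\<close> is coded as a product over
  \<open>bool\<close>, with \<open>True\<close> for \<open>G\<close>, so that the results on
  products of families apply unchanged.\<close>

definition family where "family = (\<lambda>i. if i then G else H)"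

sublocale lgroup_family UNIV family
  by (rule lgroup_family.intro) (simp add: family_def G.lgroup_axioms H.lgroup_axioms)

definition graph where "graph a = (\<lambda>i. if i then a else f a)"

lemma family_simps [simp]: "family True = G" "family False = H"
  by (simp_all add: family_def)

lemma embedding: "mv_embedding (Gamma_obj G) P graph"
proof -
  have "mv_embedding (Gamma_obj G) (family i) (if i then \<lambda>a. a else f)" for i
    using f
    by (auto simp: family_def G.lgroup_axioms H.lgroup_axioms mv_hom_def hom_def mv_monoid_def
        intro!: mv_embedding_of_hom G.truncated_add_interval)
  then have "mv_embedding (Gamma_obj G) P (\<lambda>a. \<lambda>i\<in>UNIV. (if i then \<lambda>a. a else f) a)"
    by (intro mv_embedding_prod G.mv_algebra_Gamma)
  also have "(\<lambda>a. \<lambda>i\<in>UNIV. (if i then \<lambda>a. a else f) a) = graph"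
    by (auto simp: graph_def fun_eq_iff)
  finally show ?thesis .
qed

sublocale graph: sub_mv_lgroup P "graph ` G.unit_interval"
  using sub_mv_image[OF G.mv_algebra_Gamma embedding] by unfold_locales simp

abbreviation N where "N \<equiv> span P (graph ` G.unit_interval)"

lemma N_carrier: "z \<in> N \<Longrightarrow> z \<in> carrier P"
  by (rule graph.span_carrier)

lemma N_closed: assumes "z \<in> N" shows "z True \<in> carrier G" "z False \<in> carrier H"
  using component_closed[OF N_carrier[OF assms], of True]
    component_closed[OF N_carrier[OF assms], of False] by simp_all

lemma components:
  assumes "z \<in> N" "w \<in> N"
  shows "(z \<boxplus>\<^bsub>P\<^esub> w) True = z True \<boxplus>\<^bsub>G\<^esub> w True" "(z \<boxplus>\<^bsub>P\<^esub> w) False = z False \<boxplus>\<^bsub>H\<^esub> w False"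
    "(z \<squnion>\<^bsub>P\<^esub> w) True = z True \<squnion>\<^bsub>G\<^esub> w True" "(z \<squnion>\<^bsub>P\<^esub> w) False = z False \<squnion>\<^bsub>H\<^esub> w False"
    "(z \<sqinter>\<^bsub>P\<^esub> w) True = z True \<sqinter>\<^bsub>G\<^esub> w True" "(z \<sqinter>\<^bsub>P\<^esub> w) False = z False \<sqinter>\<^bsub>H\<^esub> w False"
    "lu_neg P z True = lu_neg G (z True)" "lu_neg P z False = lu_neg H (z False)"
  using N_carrier[OF assms(1)] N_carrier[OF assms(2)]
  by (simp_all add: prod_join prod_meet prod_neg del: prod_lgroup_simps(1))

lemma const_components:
  "lu_zero P True = G.zero" "lu_zero P False = H.zero"
  "lu_unit P True = G.unit" "lu_unit P False = H.unit"
  by simp_all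

text \<open>The first coordinates of \<open>N\<close> form a subgroup containing the unit interval
  of \<open>G\<close>, which generates \<open>G\<close>.\<close>

lemma N_total: assumes x: "x \<in> carrier G" shows "\<exists>z\<in>N. z True = x"
proof -
  have sums: "\<exists>z\<in>N. z True = y" if "y \<in> sums G G.unit_interval" for y
    using that
  proof (induction rule: sums.induct)
    case sums_zero
    show ?case
      using const_components(1) graph.span_zero by (intro bexI[where x = "lu_zero P"])
  next
    case (sums_add y a)
    then obtain z where z: "z \<in> N" "z True = y" by auto
    have a: "graph a \<in> N" using sums_add by (intro graph.A_span) simp
    show ?case
      using z a by (intro bexI[of _ "z \<boxplus>\<^bsub>P\<^esub> graph a"] graph.span_add)
        (simp_all only: components, simp add: graph_def)
  qed
  obtain n where "x \<boxplus>\<^bsub>G\<^esub> lu_mult G n G.unit \<in> sums G G.unit_interval"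
    using G.mem_span[OF x] by (auto simp: span_def)
  then obtain z w where "z \<in> N" "w \<in> N" and z: "z True = x \<boxplus>\<^bsub>G\<^esub> lu_mult G n G.unit"
    and w: "w True = lu_mult G n G.unit"
    using sums G.interval.sums_unit[of n] by meson
  moreover from this have "(z \<boxplus>\<^bsub>P\<^esub> lu_neg P w) True = x"
    using x by (simp only: components graph.span_neg) simp
  ultimately show ?thesis
    by (intro bexI[of _ "z \<boxplus>\<^bsub>P\<^esub> lu_neg P w"] graph.span_add graph.span_neg)
qed

text \<open>The truncation of \<open>z\<close> lies in the generated subgroup and in the unit
  interval, so by \<open>span_interval\<close> it is a point \<open>(a, f a)\<close>. Its first
  coordinate gives \<open>a = 0\<close>, hence the second is \<open>f 0 = 0\<close>, and
  \<open>eq_zero_of_truncate_zero\<close> removes the truncation.\<close>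

lemma N_nonneg_zero:
  assumes z: "z \<in> N" "z True = G.zero" "H.zero \<sqsubseteq>\<^bsub>H\<^esub> z False"
  shows "z False = H.zero"
proof -
  let ?t = "z \<sqinter>\<^bsub>P\<^esub> lu_unit P"
  have t: "?t \<in> N" by (rule graph.span_meet[OF z(1) graph.span_unit])
  have tT: "?t True = G.zero" and tF: "?t False = z False \<sqinter>\<^bsub>H\<^esub> H.unit"
    using z by (simp_all only: components graph.span_unit const_components G.meet_absorb1
        G.unit_nonneg G.zero_closed G.unit_closed)
  have "lu_zero P \<sqsubseteq>\<^bsub>P\<^esub> ?t"
  proof -
    have "lu_zero P \<sqsubseteq>\<^bsub>P\<^esub> z"
      unfolding prod_lgroup_simps(3)
    proof
      fix i show "lu_zero P i \<sqsubseteq>\<^bsub>family i\<^esub> z i" by (cases i) (simp_all add: z)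
    qed
    then show ?thesis
      by (rule prod.meet_le[OF _ prod.unit_nonneg N_carrier[OF z(1)] prod.unit_closed prod.zero_closed])
  qed
  moreover have "?t \<sqsubseteq>\<^bsub>P\<^esub> lu_unit P"
    using z N_carrier by (intro prod.meet_right prod.unit_closed)
  ultimately have "?t \<in> graph ` G.unit_interval" by (rule graph.span_interval[OF t])
  then obtain a where "?t = graph a" by blast
  then have "?t True = a" "?t False = f a" by (simp_all add: graph_def)
  then have "z False \<sqinter>\<^bsub>H\<^esub> H.unit = H.zero"
    using tT tF mv_homD(3)[OF f] by simp
  then show ?thesis by (rule H.eq_zero_of_truncate_zero[OF N_closed(2)[OF z(1)] z(3)])
qed

text \<open>The sign condition is removed by passing to the positive parts of \<open>z\<close> and
  of its negative, which again lie in the sublattice \<open>N\<close> over zero.\<close>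

lemma N_zero:
  assumes z: "z \<in> N" "z True = G.zero"
  shows "z False = H.zero"
proof -
  note [simp] = N_closed[OF z(1)]
  have pos: "H.pos (w False) = H.zero" if w: "w \<in> N" "w True = G.zero" for w
  proof -
    let ?p = "w \<squnion>\<^bsub>P\<^esub> lu_zero P"
    have "?p \<in> N" by (rule graph.span_join[OF w(1) graph.span_zero])
    moreover have "?p True = G.zero" and p: "?p False = H.pos (w False)"
      using w by (simp_all only: components graph.span_zero const_components G.join_absorb1
          G.le_refl G.zero_closed)
    moreover have "H.zero \<sqsubseteq>\<^bsub>H\<^esub> ?p False"
      unfolding p using N_closed(2)[OF w(1)] by (intro H.join_right) simp_all
    ultimately show ?thesis using N_nonneg_zero[of ?p] by (simp only:)
  qed
  have "lu_neg P z True = G.zero" "lu_neg P z False = lu_neg H (z False)"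
    using z by (simp_all only: components G.neg_zero)
  then have "H.pos (lu_neg H (z False)) = H.zero"
    using pos[OF graph.span_neg[OF z(1)]] by (simp only:)
  then have "lu_neg H (z False) \<sqsubseteq>\<^bsub>H\<^esub> H.zero"
    using H.join_left[of "lu_neg H (z False)" H.zero] by simp
  then have "H.zero \<sqsubseteq>\<^bsub>H\<^esub> z False" using H.neg_le_swap[of "z False" H.zero] by simp
  moreover have "z False \<sqsubseteq>\<^bsub>H\<^esub> H.zero"
    using pos[OF z] H.join_left[of "z False" H.zero] by simp
  ultimately show ?thesis by (intro H.le_antisym) simp_all
qed

lemma N_functional:
  assumes z: "z \<in> N" and w: "w \<in> N" and eq: "z True = w True"
  shows "z False = w False"
proof -
  note [simp] = N_closed[OF z] N_closed[OF w]
  have "(z \<boxplus>\<^bsub>P\<^esub> lu_neg P w) False = H.zero"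
    using z w graph.span_neg[OF w] by (intro N_zero graph.span_add)
      (simp_all only: components eq G.add_neg N_closed)
  then have "z False \<boxplus>\<^bsub>H\<^esub> lu_neg H (w False) = H.zero"
    using z w graph.span_neg[OF w] by (simp only: components)
  then show ?thesis using H.diff_add_cancel[of "z False" "w False"] by simp
qed

definition extension where
  "extension x = (SOME z. z \<in> N \<and> z True = x) False"

lemma extension_eq: assumes z: "z \<in> N" shows "extension (z True) = z False"
proof -
  have "(SOME z'. z' \<in> N \<and> z' True = z True) \<in> N \<and>
      (SOME z'. z' \<in> N \<and> z' True = z True) True = z True"
    by (rule someI[of _ z]) (simp add: z)
  then show ?thesis unfolding extension_def by (intro N_functional[OF _ z]) simp_all
qed

lemma extension_on_interval: assumes "a \<in> G.unit_interval" shows "extension a = f a"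
  using extension_eq[OF graph.A_span[OF imageI[OF assms]]] by (simp add: graph_def)

lemma extension_lu_hom: "extension \<in> lu_hom G H"
proof (rule lu_homI[OF G.lu_group_axioms H.lu_group_axioms])
  fix x assume "x \<in> carrier G"
  then obtain z where z: "z \<in> N" "z True = x" using N_total by blast
  then show "extension x \<in> carrier H" using extension_eq[of z] N_closed(2)[of z] by simp
  fix y assume "y \<in> carrier G"
  then obtain w where w: "w \<in> N" "w True = y" using N_total by blast
  show "extension (x \<boxplus>\<^bsub>G\<^esub> y) = extension x \<boxplus>\<^bsub>H\<^esub> extension y"
    using extension_eq[OF z(1)] extension_eq[OF w(1)] extension_eq[OF graph.span_add[OF z(1) w(1)]] z w
    by (simp only: components)
  show "extension (x \<squnion>\<^bsub>G\<^esub> y) = extension x \<squnion>\<^bsub>H\<^esub> extension y"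
    using extension_eq[OF z(1)] extension_eq[OF w(1)] extension_eq[OF graph.span_join[OF z(1) w(1)]] z w
    by (simp only: components)
  show "extension (x \<sqinter>\<^bsub>G\<^esub> y) = extension x \<sqinter>\<^bsub>H\<^esub> extension y"
    using extension_eq[OF z(1)] extension_eq[OF w(1)] extension_eq[OF graph.span_meet[OF z(1) w(1)]] z w
    by (simp only: components)
next
  show "extension G.unit = H.unit"
    using extension_eq[OF graph.span_unit] by (simp only: const_components)
qed

end

section \<open>The categories of frames\<close>

lemma preserves_sups_cong:
  assumes "\<And>x. x \<in> carrier L \<Longrightarrow> f x = g x"
  shows "preserves_sups L M f \<longleftrightarrow> preserves_sups L M g"
proof -
  have "f ` S = g ` S" if "S \<subseteq> carrier L" for S using that assms by (intro image_cong) auto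
  moreover have "f s = g s" if "is_lub L s S" for s S
    using that assms by (auto simp: least_def Upper_def)
  ultimately show ?thesis unfolding preserves_sups_def by metis
qed

lemma preserves_sups_comp:
  assumes f: "preserves_sups L M f" and g: "preserves_sups M N g"
    and clo: "\<And>x. x \<in> carrier L \<Longrightarrow> f x \<in> carrier M"
  shows "preserves_sups L N (\<lambda>x. g (f x))"
  unfolding preserves_sups_def
proof (intro allI impI)
  fix S s assume S: "S \<subseteq> carrier L" and "is_lub L s S"
  then have "is_lub M (f s) (f ` S)" using f by (simp add: preserves_sups_def)
  moreover have "f ` S \<subseteq> carrier M" using S clo by auto
  ultimately have "is_lub N (g (f s)) (g ` f ` S)" using g by (simp add: preserves_sups_def)
  then show "is_lub N (g (f s)) ((\<lambda>x. g (f x)) ` S)" by (simp add: image_image)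
qed

lemma lu_Frm_simps [simp]:
  "Obj lu_Frm = {G. lu_frame G}"
  "Hom lu_Frm G H = {f \<in> lu_hom G H \<inter> extensional (carrier G). preserves_sups G H f}"
  "Id lu_Frm G = restrict (\<lambda>x. x) (carrier G)"
  "Comp lu_Frm X Y Z g f = compose (carrier X) g f"
  by (auto simp: lu_Frm_def lu_Grp_def subcategory_def lu_frame_def)

lemma MV_Frm_simps [simp]:
  "Obj MV_Frm = {A. mv_frame A}"
  "Hom MV_Frm A B = {f \<in> mv_hom A B \<inter> extensional (carrier A).
     preserves_sups (mv_order A) (mv_order B) f}"
  "Id MV_Frm A = restrict (\<lambda>x. x) (carrier A)"
  "Comp MV_Frm X Y Z g f = compose (carrier X) g f"
  by (auto simp: MV_Frm_def MV_Alg_def subcategory_def mv_frame_def)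

lemma lu_frame_lu_group: "lu_frame G \<Longrightarrow> lu_group G"
  by (simp add: lu_frame_def)

lemma lu_hom_Id: "lu_group G \<Longrightarrow> restrict (\<lambda>x. x) (carrier G) \<in> lu_hom G G"
proof -
  assume G: "lu_group G"
  interpret lu_group G by (rule G)
  show ?thesis by (rule lu_homI[OF G G]) simp_all
qed

lemma lu_hom_compose:
  assumes G: "lu_group G" and K: "lu_group K" and f: "f \<in> lu_hom G H" and g: "g \<in> lu_hom H K"
  shows "compose (carrier G) g f \<in> lu_hom G K"
proof -
  interpret lu_group G by (rule G)
  show ?thesis
    by (rule lu_homI[OF G K])
      (simp_all add: compose_def lu_hom_closed[OF f] lu_hom_closed[OF g] lu_hom_add[OF f]
        lu_hom_add[OF g] lu_hom_join[OF f] lu_hom_join[OF g] lu_hom_meet[OF f] lu_hom_meet[OF g]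
        lu_hom_unit[OF f] lu_hom_unit[OF g])
qed

lemma compose_restrict_id:
  "f \<in> extensional A \<Longrightarrow> compose A f (restrict (\<lambda>x. x) A) = f"
  by (auto simp: compose_def extensional_def fun_eq_iff)

lemma compose_id_restrict:
  "\<lbrakk>f \<in> extensional A; \<And>x. x \<in> A \<Longrightarrow> f x \<in> B\<rbrakk> \<Longrightarrow> compose A (restrict (\<lambda>x. x) B) f = f"
  by (auto simp: compose_def extensional_def fun_eq_iff)

lemma compose_compose:
  "(\<And>x. x \<in> A \<Longrightarrow> f x \<in> B) \<Longrightarrow> compose A h (compose A g f) = compose A (compose B h g) f"
  by (auto simp: compose_def fun_eq_iff)

lemma preserves_sups_id: "preserves_sups L L (restrict (\<lambda>x. x) (carrier L))"
  by (subst preserves_sups_cong[of _ _ "\<lambda>x. x"]) (auto simp: preserves_sups_def)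

lemma preserves_sups_compose:
  assumes "preserves_sups L M f" "preserves_sups M N g"
    and "\<And>x. x \<in> carrier L \<Longrightarrow> f x \<in> carrier M"
  shows "preserves_sups L N (compose (carrier L) g f)"
  using preserves_sups_comp[OF assms]
  by (subst preserves_sups_cong[of _ _ "\<lambda>x. g (f x)"]) (auto simp: compose_def)

lemma category_lu_Frm: "category (lu_Frm :: ('a lu_group, 'a \<Rightarrow> 'a) category)"
  by unfold_locales
    (auto simp: lu_frame_lu_group lu_hom_Id preserves_sups_id lu_hom_compose
      compose_restrict_id lu_hom_closed intro: preserves_sups_compose
      intro!: compose_id_restrict compose_compose)

lemma mv_hom_Id: "mv_algebra A \<Longrightarrow> restrict (\<lambda>x. x) (carrier A) \<in> mv_hom A A"
proof -
  assume "mv_algebra A"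
  then interpret mv_algebra A .
  show ?thesis by (auto simp: mv_hom_def hom_def mv_monoid_def)
qed

lemma mv_hom_compose:
  assumes "mv_algebra A" and f: "f \<in> mv_hom A B" and g: "g \<in> mv_hom B C"
  shows "compose (carrier A) g f \<in> mv_hom A C"
proof -
  interpret mv_algebra A by fact
  show ?thesis
    using mv_homD[OF f] mv_homD[OF g]
    by (auto simp: mv_hom_def hom_def mv_monoid_def compose_def)
qed

lemma mv_frame_mv_algebra: "mv_frame A \<Longrightarrow> mv_algebra A"
  by (simp add: mv_frame_def)

lemma category_MV_Frm: "category (MV_Frm :: ('a mv_algebra, 'a \<Rightarrow> 'a) category)"
  by unfold_locales
    (auto simp: mv_frame_mv_algebra mv_hom_Id mv_hom_compose
      compose_restrict_id mv_homD(1) intro: preserves_sups_compose[of "mv_order _", simplified]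
      preserves_sups_id[of "mv_order _", simplified]
      intro!: compose_id_restrict compose_compose)

lemma Gamma_simps [simp]:
  "on_obj Gamma G = Gamma_obj G"
  "on_arr Gamma G H f = restrict f (carrier (Gamma_obj G))"
  by (simp_all add: Gamma_def)

lemma Gamma_functor:
  "cat_functor (lu_Frm :: ('a lu_group, 'a \<Rightarrow> 'a) category) MV_Frm Gamma"
proof (intro cat_functor.intro category_lu_Frm category_MV_Frm cat_functor_axioms.intro)
  fix G :: "'a lu_group" assume "G \<in> Obj lu_Frm"
  then have G: "lu_frame G" "lu_group G" by (simp_all add: lu_frame_lu_group)
  interpret G: lu_group G by (rule G)
  show "on_obj Gamma G \<in> Obj MV_Frm" using G.mv_frame_Gamma G by simp
  show "on_arr Gamma G G (Id lu_Frm G) = Id MV_Frm (on_obj Gamma G)"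
    by (auto simp: fun_eq_iff G.mem_interval)
  fix H :: "'a lu_group" and f assume "H \<in> Obj lu_Frm" and f: "f \<in> Hom lu_Frm G H"
  then have H: "lu_frame H" "lu_group H" by (simp_all add: lu_frame_lu_group)
  have f: "f \<in> lu_hom G H" "preserves_sups G H f" using f by simp_all
  show "on_arr Gamma G H f \<in> Hom MV_Frm (on_obj Gamma G) (on_obj Gamma H)"
    using Gamma_mv_hom[OF G(2) H(2) f(1)] Gamma_preserves_sups[OF G(2) H(2) f] by simp
  fix K g
  show "on_arr Gamma G K (Comp lu_Frm G H K g f) = Comp MV_Frm (on_obj Gamma G)
      (on_obj Gamma H) (on_obj Gamma K) (on_arr Gamma H K g) (on_arr Gamma G H f)"
    using lu_hom_interval[OF G(2) H(2) f(1)]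
    by (auto simp: fun_eq_iff compose_def G.interval_carrier)
qed

section \<open>Essential surjectivity\<close>

lemma inj_lists:
  assumes "infinite (UNIV :: 'a set)"
  shows "\<exists>j :: 'a list \<times> nat \<Rightarrow> 'a. inj j"
proof -
  obtain p :: "'a \<times> 'a \<Rightarrow> 'a" where "bij_betw p (UNIV \<times> UNIV) UNIV"
    using card_of_ordIso[THEN iffD2, OF card_of_Times_same_infinite[OF assms]] by blast
  then have p: "inj p" by (simp add: bij_betw_def)
  obtain e :: "nat \<Rightarrow> 'a" where e: "inj e" using infinite_countable_subset[OF assms] by blast
  define enc where "enc xs = foldr (\<lambda>x y. p (x, y)) xs undefined" for xs
  have enc: "\<lbrakk>length xs = length ys; enc xs = enc ys\<rbrakk> \<Longrightarrow> xs = ys" for xs ys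
    by (induction xs ys rule: list_induct2) (auto simp: enc_def dest!: injD[OF p])
  \<comment> \<open>The iterated pairing ends in an arbitrary value, so codes of lists of different
    lengths may coincide; storing the length makes decoding unambiguous.\<close>
  have "inj (\<lambda>(xs, n). p (e (length xs), p (e n, enc xs)))"
    by (auto simp: inj_def dest!: injD[OF p] injD[OF e] intro: enc)
  then show ?thesis by blast
qed

text \<open>A cardinality bound: an element of the span is determined by a finite list of generator
  names and a number of units to subtract. With \<open>inj_lists\<close> this fits into an infinite
  type.\<close>

lemma span_subset_image:
  fixes L :: "'b lu_group" (structure)
  assumes "lgroup L" "f ` C \<subseteq> carrier L"
  shows "span L (f ` C) \<subseteq> range (\<lambda>(xs, n).
    foldr (\<lambda>x y. y \<boxplus>\<^bsub>L\<^esub> f x) xs (lu_zero L) \<boxplus>\<^bsub>L\<^esub> lu_neg L (lu_mult L n (lu_unit L)))"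
proof
  interpret lgroup L by fact
  have sums: "\<exists>xs. y = foldr (\<lambda>x y. y \<boxplus>\<^bsub>L\<^esub> f x) xs (lu_zero L)" if "y \<in> sums L (f ` C)" for y
    using that
  proof (induction rule: sums.induct)
    case sums_zero
    show ?case by (rule exI[of _ "[]"]) simp
  next
    case (sums_add y a)
    then obtain xs x where "y = foldr (\<lambda>x y. y \<boxplus>\<^bsub>L\<^esub> f x) xs (lu_zero L)" "a = f x" by blast
    then show ?case by (intro exI[of _ "x # xs"]) simp
  qed
  fix z assume "z \<in> span L (f ` C)"
  then obtain n where z: "z \<in> carrier L" "z \<boxplus> lu_mult L n (lu_unit L) \<in> sums L (f ` C)"
    by (auto simp: span_def)
  then obtain xs where "z \<boxplus> lu_mult L n (lu_unit L) = foldr (\<lambda>x y. y \<boxplus>\<^bsub>L\<^esub> f x) xs (lu_zero L)"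
    using sums by blast
  then have "z = foldr (\<lambda>x y. y \<boxplus>\<^bsub>L\<^esub> f x) xs (lu_zero L) \<boxplus>\<^bsub>L\<^esub> lu_neg L (lu_mult L n (lu_unit L))"
    using z(1) add_diff_cancel[of z "lu_mult L n (lu_unit L)"] by simp
  then show "z \<in> range (\<lambda>(xs, n).
    foldr (\<lambda>x y. y \<boxplus>\<^bsub>L\<^esub> f x) xs (lu_zero L) \<boxplus>\<^bsub>L\<^esub> lu_neg L (lu_mult L n (lu_unit L)))"
    by (intro image_eqI[of _ _ "(xs, n)"]) simp_all
qed

lemma mv_algebra_eq_Gamma:
  fixes B :: "'a mv_algebra"
  assumes inf: "infinite (UNIV :: 'a set)" and B: "mv_algebra B"
  shows "\<exists>G :: 'a lu_group. lu_group G \<and>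
    (\<exists>h \<in> mv_hom B (Gamma_obj G). bij_betw h (carrier B) (carrier (Gamma_obj G)))"
proof -
  obtain L :: "('a set \<Rightarrow> int \<times> 'a) lu_group" and f
    where emb: "mv_embedding B L f" and inj: "inj_on f (carrier B)"
    using mv_embedding_exists[OF B] by blast
  have L: "lgroup L" using emb by (simp add: mv_embedding_def)
  let ?A = "f ` carrier B"
  interpret L: sub_mv_lgroup L ?A
    using L sub_mv_image[OF B emb] by (intro sub_mv_lgroup.intro sub_mv_lgroup_axioms.intro)
  obtain j :: "'a list \<times> nat \<Rightarrow> 'a" where j: "inj j" using inj_lists[OF inf] by blast
  obtain s :: "'a list \<times> nat \<Rightarrow> _" where s: "span L ?A \<subseteq> range s"
    using span_subset_image[OF L, of f "carrier B"] L.A_carrier by blast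
  have s_inv: "s (inv_into UNIV s y) = y" if "y \<in> span L ?A" for y
    using that s by (intro f_inv_into_f) auto
  \<comment> \<open>An element of the span is named by the code of one chosen description of it. The
    description determines the element, so \<open>r\<close> is injective on the span.\<close>
  define r where "r y = j (inv_into UNIV s y)" for y
  have r: "inj_on r (span L ?A)"
    by (rule inj_onI) (metis r_def s_inv j injD)
  define K where "K = r ` span L ?A"
  define \<psi> where "\<psi> = inv_into (span L ?A) r"
  have bij: "bij_betw \<psi> K (span L ?A)"
    unfolding K_def \<psi>_def by (rule bij_betw_inv_into[OF inj_on_imp_bij_betw[OF r]])
  interpret pullback L ?A K \<psi> by unfold_locales (rule bij)
  interpret H: lu_group pull by (rule lu_group_pull)
  interpret B: mv_algebra B by (rule B)
  have f: "f b \<in> span L ?A" if "b \<in> carrier B" for b using that by (intro L.A_span) simp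
  have f': "f (B.zero) = L.zero" "f (mv_neg B a) = L.diff L.unit (f a)"
      "f (a \<oplus>\<^bsub>B\<^esub> b) = (f a \<boxplus>\<^bsub>L\<^esub> f b) \<sqinter>\<^bsub>L\<^esub> L.unit" "L.zero \<sqsubseteq>\<^bsub>L\<^esub> f a" "f a \<sqsubseteq>\<^bsub>L\<^esub> L.unit"
    if "a \<in> carrier B" "b \<in> carrier B" for a b
    using emb that by (auto simp: mv_embedding_def at_least_at_most_def)
  have "(\<lambda>b. \<phi> (f b)) \<in> mv_hom B (Gamma_obj pull)"
  proof -
    have "\<phi> (f (a \<oplus>\<^bsub>B\<^esub> b)) = (\<phi> (f a) \<boxplus>\<^bsub>pull\<^esub> \<phi> (f b)) \<sqinter>\<^bsub>pull\<^esub> H.unit"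
      if "a \<in> carrier B" "b \<in> carrier B" for a b
      using that f H.meet_closed[of "\<phi> (f a) \<boxplus>\<^bsub>pull\<^esub> \<phi> (f b)" H.unit]
      by (intro psi_inj) (simp_all add: psi_meet f'(3))
    moreover have "\<phi> (f (mv_neg B a)) = H.unit \<boxplus>\<^bsub>pull\<^esub> lu_neg pull (\<phi> (f a))" if "a \<in> carrier B" for a
      using that f H.neg_closed[of "\<phi> (f a)"]
      by (intro psi_inj) (simp_all add: psi_neg f'(2))
    moreover have "\<phi> (f a) \<in> H.unit_interval" if "a \<in> carrier B" for a
      using that f f'(4,5)[OF that that] by (simp add: at_least_at_most_def)
    ultimately show ?thesis
      using f'(1)[of B.zero B.zero] by (simp add: mv_hom_def hom_def mv_monoid_def)
  qed
  moreover have "bij_betw (\<lambda>b. \<phi> (f b)) (carrier B) (carrier (Gamma_obj pull))"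
  proof (rule bij_betw_imageI)
    show "inj_on (\<lambda>b. \<phi> (f b)) (carrier B)"
      using inj f by (intro inj_onI) (metis psi_phi inj_onD)
    show "(\<lambda>b. \<phi> (f b)) ` carrier B = carrier (Gamma_obj pull)"
    proof (intro equalityI subsetI)
      fix x assume "x \<in> carrier (Gamma_obj pull)"
      then have x: "x \<in> K" "L.zero \<sqsubseteq>\<^bsub>L\<^esub> \<psi> x" "\<psi> x \<sqsubseteq>\<^bsub>L\<^esub> L.unit" by (simp_all add: at_least_at_most_def)
      \<comment> \<open>Surjectivity rests on \<open>span_interval\<close>: the generated group has
        acquired no new elements between \<open>0\<close> and \<open>u\<close>.\<close>
      then have "\<psi> x \<in> ?A" by (intro L.span_interval) simp_all
      then obtain b where "b \<in> carrier B" "\<psi> x = f b" by blast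
      then show "x \<in> (\<lambda>b. \<phi> (f b)) ` carrier B"
        using x(1) phi_psi[of x] by (intro image_eqI[of _ _ b]) simp_all
    qed (use f f'(4,5) in \<open>auto simp: at_least_at_most_def\<close>)
  qed
  ultimately show ?thesis using lu_group_pull by blast
qed

section \<open>Bijective MV-homomorphisms\<close>

context
  fixes A B :: "'a mv_algebra" and h
  assumes A: "mv_algebra A" and B: "mv_algebra B" and h: "h \<in> mv_hom A B"
    and bij: "bij_betw h (carrier A) (carrier B)"
begin

interpretation A: mv_algebra A by (rule A)
interpretation B: mv_algebra B by (rule B)

lemma bij_mv_hom_le_iff:
  assumes "x \<in> carrier A" "y \<in> carrier A"
  shows "h x \<sqsubseteq>\<^bsub>mv_order B\<^esub> h y \<longleftrightarrow> x \<sqsubseteq>\<^bsub>mv_order A\<^esub> y"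
proof -
  have "h (mv_neg A x \<oplus>\<^bsub>A\<^esub> y) = mv_neg B (h x) \<oplus>\<^bsub>B\<^esub> h y" "h (mv_neg A (mv_zero A)) = mv_neg B (mv_zero B)"
    using assms mv_homD[OF h] by simp_all
  moreover have "h (mv_neg A x \<oplus>\<^bsub>A\<^esub> y) = h (mv_neg A (mv_zero A)) \<longleftrightarrow>
      mv_neg A x \<oplus>\<^bsub>A\<^esub> y = mv_neg A (mv_zero A)"
    using assms bij by (intro inj_on_eq_iff[of h "carrier A"]) (auto simp: bij_betw_def)
  ultimately show ?thesis by simp
qed

text \<open>The order is defined by an equation in the MV-operations, so a bijective homomorphism is
  an order isomorphism and carries every existing supremum along.\<close>

lemma bij_mv_hom_is_lub:
  assumes S: "S \<subseteq> carrier A" and s: "is_lub (mv_order A) s S"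
  shows "is_lub (mv_order B) (h s) (h ` S)"
proof -
  have im: "h ` carrier A = carrier B" using bij by (simp add: bij_betw_def)
  have hS: "h ` S \<subseteq> carrier (mv_order B)" using S im by auto
  have S': "S \<subseteq> carrier (mv_order A)" using S by simp
  from s have s: "s \<in> carrier A" "\<And>x. x \<in> S \<Longrightarrow> x \<sqsubseteq>\<^bsub>mv_order A\<^esub> s"
    "\<And>z. \<lbrakk>z \<in> carrier A; \<And>x. x \<in> S \<Longrightarrow> x \<sqsubseteq>\<^bsub>mv_order A\<^esub> z\<rbrakk> \<Longrightarrow> s \<sqsubseteq>\<^bsub>mv_order A\<^esub> z"
    by (simp_all add: is_lub_iff[OF S'] del: A.le_mv_order)
  show ?thesis
    unfolding is_lub_iff[OF hS]
  proof (intro conjI ballI impI)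
    show "h s \<in> carrier (mv_order B)" using s(1) im by auto
    fix y assume "y \<in> h ` S"
    then show "y \<sqsubseteq>\<^bsub>mv_order B\<^esub> h s"
      using s(1,2) S by (auto simp: bij_mv_hom_le_iff subset_iff simp del: A.le_mv_order B.le_mv_order)
  next
    fix z assume "z \<in> carrier (mv_order B)" and z: "\<forall>y\<in>h ` S. y \<sqsubseteq>\<^bsub>mv_order B\<^esub> z"
    then obtain a where a: "a \<in> carrier A" "z = h a" using im by auto
    have "x \<sqsubseteq>\<^bsub>mv_order A\<^esub> a" if "x \<in> S" for x
      using z a S that bij_mv_hom_le_iff[of x a] by blast
    then have "s \<sqsubseteq>\<^bsub>mv_order A\<^esub> a" using a(1) by (intro s(3))
    then show "h s \<sqsubseteq>\<^bsub>mv_order B\<^esub> z" using a s(1) bij_mv_hom_le_iff by blast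
  qed
qed

lemma bij_mv_hom_preserves_sups: "preserves_sups (mv_order A) (mv_order B) h"
  using bij_mv_hom_is_lub by (simp add: preserves_sups_def)

lemma bij_mv_hom_inverse:
  "restrict (inv_into (carrier A) h) (carrier B) \<in> mv_hom B A"
proof -
  let ?g = "inv_into (carrier A) h"
  have im: "h ` carrier A = carrier B" and inj: "inj_on h (carrier A)"
    using bij by (simp_all add: bij_betw_def)
  have g: "?g y \<in> carrier A" "h (?g y) = y" if "y \<in> carrier B" for y
    using that im by (auto intro: inv_into_into f_inv_into_f)
  have gh: "?g y = x" if "y = h x" "x \<in> carrier A" for x y
    using that inj by simp
  show ?thesis
    using g by (auto simp: mv_hom_def hom_def mv_monoid_def mv_homD[OF h] intro!: gh)
qed

end

lemma mv_frame_bij: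
  assumes A: "mv_frame A" and B: "mv_algebra B" and h: "h \<in> mv_hom A B"
    and bij: "bij_betw h (carrier A) (carrier B)"
  shows "complete_lattice (mv_order B)"
proof -
  have A': "mv_algebra A" "complete_lattice (mv_order A)" using A by (simp_all add: mv_frame_def)
  interpret A: mv_algebra A by (rule A')
  interpret B: mv_algebra B by (rule B)
  have lub: "\<exists>s. is_lub (mv_order B) s T" if T: "T \<subseteq> carrier B" for T
  proof -
    let ?S = "inv_into (carrier A) h ` T"
    have im: "h ` carrier A = carrier B" using bij by (simp add: bij_betw_def)
    have "T \<subseteq> h ` carrier A" using T im by simp
    then have S: "?S \<subseteq> carrier A" by (auto intro: inv_into_into)
    have "h (inv_into (carrier A) h y) = y" if "y \<in> T" for y
      using that \<open>T \<subseteq> h ` carrier A\<close> by (intro f_inv_into_f) auto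
    then have hS: "h ` ?S = T" by (simp add: image_image)
    obtain s where "is_lub (mv_order A) s ?S"
      using complete_lattice.sup_exists[OF A'(2), of ?S] S by auto
    from bij_mv_hom_is_lub[OF A'(1) B h bij S this] show ?thesis unfolding hS by blast
  qed
  show ?thesis
  proof (rule partial_order.complete_latticeI[OF B.partial_order_mv_order])
    fix T assume "T \<subseteq> carrier (mv_order B)"
    then have T: "T \<subseteq> carrier B" by simp
    then show "\<exists>s. is_lub (mv_order B) s T" by (rule lub)
    \<comment> \<open>Only suprema have been transported; the infimum of \<open>T\<close> is
      obtained as the supremum of its lower bounds.\<close>
    let ?L = "Lower (mv_order B) T"
    have L: "?L \<subseteq> carrier B" by (auto simp: Lower_def)
    then obtain i where i: "is_lub (mv_order B) i ?L" using lub by blast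
    have "is_glb (mv_order B) i T"
      unfolding greatest_def
    proof (intro conjI ballI)
      show "?L \<subseteq> carrier (mv_order B)" using L by simp
      show "x \<sqsubseteq>\<^bsub>mv_order B\<^esub> i" if "x \<in> ?L" for x
        using i that L by (auto simp: least_def Upper_def)
      have "i \<sqsubseteq>\<^bsub>mv_order B\<^esub> x" if "x \<in> T" for x
      proof -
        have "x \<in> Upper (mv_order B) ?L" using that T by (auto simp: Upper_def Lower_def)
        then show ?thesis using i by (simp add: least_def)
      qed
      then show "i \<in> ?L" using i by (auto simp: least_def Upper_def Lower_def)
    qed
    then show "\<exists>i. is_glb (mv_order B) i T" ..
  qed
qed

theorem theorem4p3:
  assumes "infinite (UNIV :: 'a set)"
  shows "is_equivalence (lu_Frm :: ('a lu_group, 'a \<Rightarrow> 'a) category)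
           (MV_Frm :: ('a mv_algebra, 'a \<Rightarrow> 'a) category) Gamma"
proof (rule ff_functor.is_equivalence, intro ff_functor.intro Gamma_functor ff_functor_axioms.intro)
  fix G H :: "'a lu_group" assume "G \<in> Obj lu_Frm" "H \<in> Obj lu_Frm"
  then have G: "lu_group G" and H: "lu_group H" by (simp_all add: lu_frame_lu_group)
  interpret G: lu_group G by (rule G)
  {
    fix f assume arr: "f \<in> Hom MV_Frm (on_obj Gamma G) (on_obj Gamma H)"
    interpret mv_hom_extension G H f
      using G H arr by (intro mv_hom_extension.intro mv_hom_extension_axioms.intro) simp_all
    \<comment> \<open>Arrows are extensional, while \<open>extension\<close> takes arbitrary chosen
      values outside \<open>G\<close>.\<close>
    let ?F = "restrict extension (carrier G)"
    have F: "?F \<in> lu_hom G H"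
      using extension_lu_hom G.join_closed G.meet_closed
      by (intro lu_homI[OF G H]) (simp_all add: lu_hom_closed lu_hom_add lu_hom_join lu_hom_meet lu_hom_unit)
    have eq: "restrict ?F (carrier (Gamma_obj G)) = f"
    proof
      fix a
      show "restrict ?F (carrier (Gamma_obj G)) a = f a"
      proof (cases "a \<in> carrier (Gamma_obj G)")
        case True
        then show ?thesis by (simp add: extension_on_interval G.interval_carrier)
      next
        case False
        then show ?thesis using arr extensional_arb[of f "carrier (Gamma_obj G)" a] by simp
      qed
    qed
    have "preserves_sups G H ?F"
      by (rule preserves_sups_of_Gamma[OF G H F]) (use arr eq in simp)
    then show "\<exists>f'\<in>Hom lu_Frm G H. on_arr Gamma G H f' = f"
      using F eq by (intro bexI[of _ ?F]) simp_all
  }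
  fix f g assume f: "f \<in> Hom lu_Frm G H" and g: "g \<in> Hom lu_Frm G H"
    and eq: "on_arr Gamma G H f = on_arr Gamma G H g"
  have on_interval: "f a = g a" if "a \<in> G.unit_interval" for a
    using that fun_cong[OF eq, of a] by simp
  have "f \<in> lu_hom G H" "g \<in> lu_hom G H" using f g by simp_all
  from lu_hom_eq_on_carrier[OF G H this on_interval]
  show "f = g" using f g by (intro extensionalityI[of f "carrier G" g]) simp_all
next
  fix B :: "'a mv_algebra" assume "B \<in> Obj MV_Frm"
  then have B: "mv_frame B" "mv_algebra B" by (simp_all add: mv_frame_mv_algebra)
  obtain G :: "'a lu_group" and h where G: "lu_group G" and h: "h \<in> mv_hom B (Gamma_obj G)"
    and bij: "bij_betw h (carrier B) (carrier (Gamma_obj G))"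
    using mv_algebra_eq_Gamma[OF assms B(2)] by blast
  interpret G: lu_group G by (rule G)
  have Gamma: "mv_algebra (Gamma_obj G)" by (rule G.mv_algebra_Gamma)
  \<comment> \<open>Completeness of \<open>B\<close> travels along \<open>h\<close> to the unit
    interval and from there to all of \<open>G\<close>, so the group built for a mere MV-algebra is
    an object of \<open>lu_Frm\<close>.\<close>
  have "complete_lattice (mv_order (Gamma_obj G))" by (rule mv_frame_bij[OF B(1) Gamma h bij])
  then have frame: "lu_frame G" by (rule G.lu_frame_of_complete)
  \<comment> \<open>Essential surjectivity asks for an isomorphism from \<open>\<Gamma>(G)\<close>
    to \<open>B\<close>, so the inverse of \<open>h\<close> plays the forward role. Both maps
    preserve suprema because they are bijective homomorphisms.\<close>
  let ?h = "restrict h (carrier B)" and ?g = "restrict (inv_into (carrier B) h) (carrier (Gamma_obj G))"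
  have im: "h ` carrier B = carrier (Gamma_obj G)" and inj: "inj_on h (carrier B)"
    using bij by (simp_all add: bij_betw_def)
  have g: "?g \<in> mv_hom (Gamma_obj G) B" by (rule bij_mv_hom_inverse[OF B(2) Gamma h bij])
  have bij_g: "bij_betw ?g (carrier (Gamma_obj G)) (carrier B)"
    using bij_betw_inv_into[OF bij] by (subst bij_betw_cong[where g = "inv_into (carrier B) h"]) simp_all
  have h': "?h \<in> mv_hom B (Gamma_obj G)"
  proof -
    interpret B: mv_algebra B by (rule B)
    show ?thesis using h by (auto simp: mv_hom_def hom_def mv_monoid_def)
  qed
  have bij_h': "bij_betw ?h (carrier B) (carrier (Gamma_obj G))"
    using bij by (subst bij_betw_cong[where g = h]) simp_all
  have "is_iso MV_Frm (on_obj Gamma G) B ?g"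
    unfolding is_iso_def
  proof (intro conjI bexI[of _ ?h])
    show "?g \<in> Hom MV_Frm (on_obj Gamma G) B"
      using g bij_mv_hom_preserves_sups[OF Gamma B(2) g bij_g] by simp
    show "?h \<in> Hom MV_Frm B (on_obj Gamma G)"
      using h' bij_mv_hom_preserves_sups[OF B(2) Gamma h' bij_h'] by simp
    have "inv_into (carrier B) h x \<in> carrier B" "h (inv_into (carrier B) h x) = x"
      if "x \<in> carrier (Gamma_obj G)" for x
      using that im by (metis inv_into_into, metis f_inv_into_f)
    then show "Comp MV_Frm (on_obj Gamma G) B (on_obj Gamma G) ?h ?g = Id MV_Frm (on_obj Gamma G)"
      by (auto simp: compose_def fun_eq_iff)
    have "h b \<in> carrier (Gamma_obj G)" if "b \<in> carrier B" for b using that im by blast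
    then show "Comp MV_Frm B (on_obj Gamma G) B ?g ?h = Id MV_Frm B"
      using inj by (auto simp: compose_def fun_eq_iff)
  qed
  then show "\<exists>X\<in>Obj lu_Frm. \<exists>e. is_iso MV_Frm (on_obj Gamma X) B e"
    using frame by (intro bexI[of _ G]) auto
qed

end
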